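(* For an integer $m\ge 1$ and odd integers $\ell,\ell'$, put $\alpha=1+2^m\ell$ and $\alpha'=1+2^m\ell'$, and let $J_2(\cdot)$ and $K_2(\cdot)$ be the groups defined in the context. Then: (1) if $m=1$, then $J_2(1+2\ell)\cong J_2(3)$; (2) if $m=2$, then $J_2(1+4\ell)\cong J_2(5)$; (3) if $m>2$, then $J_2(\alpha)\cong J_2(\alpha')$ if and only if $\alpha\equiv\alpha'\bmod 2^{2m}$. In particular, for fixed $m>2$ there are exactly $\varphi(2^m)$ isomorphism classes of groups $J_2(1+2^m\ell)$ ($\ell$ odd), where $\varphi$ is Euler's function; (4) for every $m\ge 1$, the derived subgroups of $J_2(\alpha)$ and $J_2(\alpha')$ are isomorphic, and all corresponding factors of the upper central series of $J_2(\alpha)$ and $J_2(\alpha')$ are isomorphic; (5) for every $m\geq 1$, $K_2(1+2^m\ell)\cong K_2(1+2^m)$.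
   Context: Conventions: $[a,b]=a^{-1}b^{-1}ab$ and $b^a=a^{-1}ba$. For a group $T$, $Z_0(T)=1$ and $Z_{i+1}(T)/Z_i(T)$ is the center of $T/Z_i(T)$; the factors of the upper central series are the quotients $Z_{i+1}(T)/Z_i(T)$. For $m\ge1$, $\ell$ odd and $\alpha=1+2^m\ell$ (note that $m$ is determined by $\alpha$), $$J_2(\alpha)=\langle x,y\mid x^{[x,y]}=x^{\alpha},\ y^{[y,x]}=y^{\alpha},\ x^{2^{3m-1}}=y^{2^{3m-1}}=1\rangle,$$ and $K_2(\alpha)=J_2(\alpha)/Z_2(J_2(\alpha))$. *)

theory Defs
  imports
    "HOL-Algebra.Algebra"
    "HOL-Computational_Algebra.Computational_Algebra"
    "HOL-Number_Theory.Number_Theory"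
begin

text \<open>The letter \<open>(a, True)\<close> stands for the generator \<open>a\<close>, and \<open>(a, False)\<close> for its formal inverse.\<close>

type_synonym 'a word = "('a \<times> bool) list"

inductive cancels :: "'a word \<Rightarrow> 'a word \<Rightarrow> bool" where
  "cancels (u @ (a, b) # (a, \<not> b) # v) (u @ v)"

definition word_eq :: "('a word \<times> 'a word) set" where
  "word_eq = {(u, v). equivclp cancels u v}"

definition free_group :: "'a word set monoid" where
  "free_group =
    \<lparr>carrier = UNIV // word_eq,
     monoid.mult = (\<lambda>A B. word_eq `` {u @ v |u v. u \<in> A \<and> v \<in> B}),
     one = word_eq `` {[]}\<rparr>"

definition free_gen :: "'a \<Rightarrow> 'a word set" where
  "free_gen a = word_eq `` {[(a, True)]}"

definition normal_closure :: "('a, 'b) monoid_scheme \<Rightarrow> 'a set \<Rightarrow> 'a set" where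
  "normal_closure G R = \<Inter>{N. N \<lhd> G \<and> R \<subseteq> N}"

definition presented_group :: "'a word set set \<Rightarrow> 'a word set set monoid" where
  "presented_group R = free_group Mod normal_closure free_group R"

definition center :: "('a, 'b) monoid_scheme \<Rightarrow> 'a set" where
  "center G = {z \<in> carrier G. \<forall>g \<in> carrier G. z \<otimes>\<^bsub>G\<^esub> g = g \<otimes>\<^bsub>G\<^esub> z}"

primrec upper_central :: "('a, 'b) monoid_scheme \<Rightarrow> nat \<Rightarrow> 'a set" where
  "upper_central G 0 = {\<one>\<^bsub>G\<^esub>}"
| "upper_central G (Suc i) =
    {g \<in> carrier G. upper_central G i #>\<^bsub>G\<^esub> g \<in> center (G Mod upper_central G i)}"

definition upper_central_factor :: "('a, 'b) monoid_scheme \<Rightarrow> nat \<Rightarrow> 'a set monoid" where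
  "upper_central_factor G i =
    (G\<lparr>carrier := upper_central G (Suc i)\<rparr>) Mod upper_central G i"

definition derived_subgroup :: "('a, 'b) monoid_scheme \<Rightarrow> ('a, 'b) monoid_scheme" where
  "derived_subgroup G = G\<lparr>carrier := derived G (carrier G)\<rparr>"

text \<open>Conventions: \<open>grp_conj G b a\<close> is $b^a = a^{-1}ba$, and \<open>grp_comm G a b\<close> is $[a,b] = a^{-1}b^{-1}ab$.\<close>

definition grp_conj :: "('a, 'b) monoid_scheme \<Rightarrow> 'a \<Rightarrow> 'a \<Rightarrow> 'a" where
  "grp_conj G b a = inv\<^bsub>G\<^esub> a \<otimes>\<^bsub>G\<^esub> b \<otimes>\<^bsub>G\<^esub> a"

definition grp_comm :: "('a, 'b) monoid_scheme \<Rightarrow> 'a \<Rightarrow> 'a \<Rightarrow> 'a" where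
  "grp_comm G a b = inv\<^bsub>G\<^esub> a \<otimes>\<^bsub>G\<^esub> inv\<^bsub>G\<^esub> b \<otimes>\<^bsub>G\<^esub> a \<otimes>\<^bsub>G\<^esub> b"

datatype gen = Gen_x | Gen_y

text \<open>A relation \<open>u = v\<close> is encoded by the relator \<open>u v\<^sup>-\<^sup>1\<close>.\<close>

definition J2_relators :: "nat \<Rightarrow> int \<Rightarrow> gen word set set" where
  "J2_relators m \<alpha> =
    (let F = free_group; x = free_gen Gen_x; y = free_gen Gen_y in
      {grp_conj F x (grp_comm F x y) \<otimes>\<^bsub>F\<^esub> inv\<^bsub>F\<^esub> (x [^]\<^bsub>F\<^esub> \<alpha>),
       grp_conj F y (grp_comm F y x) \<otimes>\<^bsub>F\<^esub> inv\<^bsub>F\<^esub> (y [^]\<^bsub>F\<^esub> \<alpha>),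
       x [^]\<^bsub>F\<^esub> (2 ^ (3 * m - 1) :: nat),
       y [^]\<^bsub>F\<^esub> (2 ^ (3 * m - 1) :: nat)})"

text \<open>
  For \<open>\<alpha> = 1 + 2 ^ m * l\<close> with \<open>l\<close> odd, the number \<open>m\<close> is recovered from \<open>\<alpha>\<close> as the 2-adic
  valuation of \<open>\<alpha> - 1\<close> (lemma \<open>multiplicity_alpha\<close> below). Only \<open>\<alpha>\<close> of this form with \<open>m \<ge> 1\<close>
  are meaningful.
\<close>

definition J2 :: "int \<Rightarrow> gen word set set monoid" where
  "J2 \<alpha> = presented_group (J2_relators (multiplicity 2 (\<alpha> - 1)) \<alpha>)"

definition K2 :: "int \<Rightarrow> gen word set set set monoid" where
  "K2 \<alpha> = J2 \<alpha> Mod upper_central (J2 \<alpha>) 2"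

lemma multiplicity_alpha:
  fixes l :: int
  assumes "odd l"
  shows "multiplicity 2 ((1 + 2 ^ m * l) - 1) = m"
proof -
  have "multiplicity 2 (2 ^ m * l) = m"
    using assms by (intro multiplicity_eqI) auto
  then show ?thesis by simp
qed

lemma equiv_word_eq: "equiv UNIV word_eq"
  by (rule equivI)
    (simp_all add: word_eq_def refl_on_def sym_def trans_def, meson equivclp_sym,
      meson equivclp_trans)

lemma cancels_context: "cancels u v \<Longrightarrow> cancels (p @ u @ q) (p @ v @ q)"
  by (erule cancels.cases) (metis append.assoc append_Cons cancels.intros)

lemma equivclp_context:
  assumes "equivclp cancels u v"
  shows "equivclp cancels (p @ u @ q) (p @ v @ q)"
  using assms
proof (induction rule: equivclp_induct)
  case base
  then show ?case by simp
next
  case (step y z)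
  then have "cancels (p @ y @ q) (p @ z @ q) \<or> cancels (p @ z @ q) (p @ y @ q)"
    using cancels_context by blast
  then show ?case using step.IH
    by (meson equivclp_trans r_into_equivclp converse_r_into_equivclp)
qed

lemma word_eq_append:
  assumes "(u, u') \<in> word_eq" "(v, v') \<in> word_eq"
  shows "(u @ v, u' @ v') \<in> word_eq"
  using equivclp_context[of u u' "[]" v] equivclp_context[of v v' u' "[]"] assms
    equivclp_trans[of cancels "u @ v" "u' @ v" "u' @ v'"]
  by (simp add: word_eq_def)

lemma word_eq_refl: "(u, u) \<in> word_eq"
  by (simp add: word_eq_def)

lemma word_eq_class_iff: "word_eq `` {u} = word_eq `` {v} \<longleftrightarrow> (u, v) \<in> word_eq"
  by (simp add: eq_equiv_class_iff[OF equiv_word_eq])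

lemma free_group_mult:
  "word_eq `` {u} \<otimes>\<^bsub>free_group\<^esub> word_eq `` {v} = word_eq `` {u @ v}"
proof -
  have "(u @ v, w) \<in> word_eq"
    if "(u, u') \<in> word_eq" "(v, v') \<in> word_eq" "(u' @ v', w) \<in> word_eq" for u' v' w
    using that word_eq_append equiv_word_eq by (meson equivE transD)
  then have "word_eq `` {u' @ v' |u' v'. u' \<in> word_eq `` {u} \<and> v' \<in> word_eq `` {v}} =
      word_eq `` {u @ v}"
    using word_eq_refl[of u] word_eq_refl[of v] by blast
  then show ?thesis
    by (simp add: free_group_def)
qed

lemma free_group_carrier: "carrier free_group = range (\<lambda>u. word_eq `` {u})"
  by (auto simp: free_group_def quotient_def)

lemma free_group_one: "\<one>\<^bsub>free_group\<^esub> = word_eq `` {[]}"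
  by (simp add: free_group_def)

definition word_inv :: "'a word \<Rightarrow> 'a word" where
  "word_inv u = rev (map (\<lambda>(a, b). (a, \<not> b)) u)"

lemma word_inv_left: "(word_inv u @ u, []) \<in> word_eq"
proof (induction u)
  case Nil
  then show ?case by (simp add: word_inv_def word_eq_refl)
next
  case (Cons c u)
  obtain a b where c: "c = (a, b)" by fastforce
  have "cancels (word_inv u @ (a, \<not> b) # (a, \<not> \<not> b) # u) (word_inv u @ u)"
    by (rule cancels.intros)
  then have "(word_inv (c # u) @ c # u, word_inv u @ u) \<in> word_eq"
    by (auto simp: word_eq_def c word_inv_def)
  then show ?case using Cons equiv_word_eq by (meson equivE transD)
qed

lemma group_free_group: "group free_group"
proof (rule groupI)
  fix A :: "'a word set"
  assume "A \<in> carrier free_group"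
  then obtain u where "A = word_eq `` {u}" by (auto simp: free_group_carrier)
  then show "\<exists>B \<in> carrier free_group. B \<otimes>\<^bsub>free_group\<^esub> A = \<one>\<^bsub>free_group\<^esub>"
    using word_inv_left[of u]
    by (auto simp: free_group_carrier free_group_mult free_group_one word_eq_class_iff)
qed (auto simp: free_group_carrier free_group_one free_group_mult)

lemma free_gen_closed: "free_gen a \<in> carrier free_group"
  by (auto simp: free_gen_def free_group_carrier)

lemma (in group) normal_closure_normal:
  assumes "R \<subseteq> carrier G"
  shows "normal_closure G R \<lhd> G"
proof -
  let ?S = "{N. N \<lhd> G \<and> R \<subseteq> N}"
  have "carrier G \<in> ?S" using assms normal_self by blast
  then have "subgroup (\<Inter>?S) G"
    by (intro subgroups_Inter) (auto intro: normal_imp_subgroup)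
  then show ?thesis
    unfolding normal_closure_def normal_inv_iff by (auto simp: normal_inv_iff)
qed

lemma J2_relators_closed: "J2_relators m \<alpha> \<subseteq> carrier free_group"
proof -
  interpret group "free_group :: gen word set monoid" by (rule group_free_group)
  show ?thesis
    by (auto simp: J2_relators_def Let_def grp_conj_def grp_comm_def free_gen_closed)
qed

lemma group_J2: "group (J2 \<alpha>)"
  unfolding J2_def presented_group_def
  by (intro normal.factorgroup_is_group group.normal_closure_normal
      group_free_group J2_relators_closed)

end

theory Submission
  imports Defs
begin

text \<open>
  Put \<open>h = 2\<^sup>m\<^sup>-\<^sup>1\<close>, \<open>u = 2hl\<close> and \<open>C = [A, B]\<close>. For \<open>m \<ge> 2\<close> every element of \<open>J\<close> has the form
  \<open>A\<^sup>a C\<^sup>c B\<^sup>b\<close>; it is trivial exactly when \<open>2h\<^sup>2\<close> divides \<open>b\<close> and \<open>c\<close>, and \<open>4h\<^sup>3\<close> divides \<open>a - b + hc\<close>.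
  The product formula is proved from the relations, faithfulness by a permutation action on the triples.
  Hence \<open>Z\<^sub>1\<close> is generated by \<open>A\<close> to the power \<open>2h\<^sup>2\<close>, and \<open>Z\<^sub>2\<close> by this element and \<open>C\<^sup>h\<close>.

  If \<open>ln \<equiv> l'\<close>, then replacing \<open>A\<close> by \<open>A\<^sup>n\<close> turns a pair with parameter \<open>l\<close> into one with parameter \<open>l'\<close>
  modulo \<open>Z\<^sub>2\<close>, and if moreover \<open>n \<equiv> 1\<close> modulo \<open>2h\<close>, already in \<open>J\<close> itself. For \<open>m = 2\<close> the two remaining groups are matched
  by \<open>A \<mapsto> A B\<^sup>2, B \<mapsto> B\<^sup>7\<close>; for \<open>m = 1\<close> the exponents only matter modulo 4.

  For \<open>m > 2\<close> let \<open>X, Y\<close> be a generating pair for the parameter \<open>l'\<close> and \<open>W = [X, Y]\<close>. Modulo the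
  \<open>8h\<^sup>2\<close>-th powers of \<open>A\<close>, comparing normal forms in \<open>XW = WX\<^sup>\<alpha>\<close>, in the same relation for \<open>Y\<close>, and in the
  definition of \<open>W\<close> yields congruences between the exponents that force \<open>l \<equiv> l'\<close> modulo \<open>2h = 2\<^sup>m\<close>.
\<close>

text \<open>All exponents are polynomial in the data: \<open>u ^ 3\<close> is divisible by
  \<open>4 * h ^ 3\<close>, so powers of \<open>1 + u\<close> and sums of such powers may be cut off
  after the quadratic binomial term. This covers negative exponents too and leaves identities for
  Groebner bases. The denominators 2 and 3 are harmless because \<open>h\<close> is even and prime
  to 3; evenness of \<open>h\<close> is why \<open>m = 1\<close> is handled apart. The presentation
  does not show that powers of \<open>A\<close> and \<open>B\<close> meet. This follows by comparing
  \<open>A\<close> times \<open>B ^ (1 + u)\<close> with the product in the other order, and it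
  produces the centre. Interchanging \<open>A\<close> and \<open>B\<close> inverts \<open>C\<close>
  and preserves the relations, so every fact about one generator yields one about the other. For
  non-isomorphism the obstacle is that conjugation by \<open>W\<close> alone only gives
  \<open>l * d\<close> congruent to \<open>l'\<close> modulo \<open>h\<close>, where
  \<open>d\<close> is the unknown exponent of \<open>C\<close> in \<open>W\<close>. The equation
  defining \<open>W\<close> expresses \<open>d\<close> by the exponents of \<open>X\<close> and
  \<open>Y\<close>, and two mirror-image congruences modulo \<open>4 * h\<close> restrict these
  enough to gain the missing factor 2. Cancelling \<open>2 * h\<close> from the modulus
  \<open>8 * h ^ 2\<close> leaves exactly \<open>4 * h\<close>.\<close>

section \<open>Evaluation of words and the universal property of the free group\<close>

fun word_eval :: "('b, 'c) monoid_scheme \<Rightarrow> ('a \<Rightarrow> 'b) \<Rightarrow> 'a word \<Rightarrow> 'b" where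
  "word_eval G f [] = \<one>\<^bsub>G\<^esub>"
| "word_eval G f ((a, b) # w) = (if b then f a else inv\<^bsub>G\<^esub> (f a)) \<otimes>\<^bsub>G\<^esub> word_eval G f w"

context group
begin

lemma word_eval_closed: "range f \<subseteq> carrier G \<Longrightarrow> word_eval G f w \<in> carrier G"
  by (induction w) (auto simp: image_subset_iff)

lemma word_eval_append:
  "range f \<subseteq> carrier G \<Longrightarrow> word_eval G f (u @ v) = word_eval G f u \<otimes> word_eval G f v"
proof (induction u)
  case (Cons p u)
  obtain a b where p: "p = (a, b)" by fastforce
  have "f a \<in> carrier G" using Cons.prems by auto
  then show ?case
    using Cons word_eval_closed[OF Cons.prems] by (auto simp: p m_assoc)
qed (simp add: word_eval_closed)

lemma word_eval_cancels:
  assumes f: "range f \<subseteq> carrier G" and "cancels u v"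
  shows "word_eval G f u = word_eval G f v"
  using assms(2)
proof cases
  case (1 p a b q)
  have "f a \<in> carrier G" using f by auto
  then have "word_eval G f ((a, b) # (a, \<not> b) # q) = word_eval G f q"
    using word_eval_closed[OF f, of q] by (auto simp flip: m_assoc)
  then show ?thesis unfolding 1 by (simp add: word_eval_append[OF f])
qed

lemma word_eval_word_eq:
  assumes f: "range f \<subseteq> carrier G" and "(u, v) \<in> word_eq"
  shows "word_eval G f u = word_eval G f v"
proof -
  have "equivclp cancels u v" using assms by (simp add: word_eq_def)
  then show ?thesis
    by (induction rule: equivclp_induct) (use word_eval_cancels[OF f] in fastforce)+
qed

lemma free_group_universal:
  assumes f: "range f \<subseteq> carrier G"
  obtains \<phi> where "\<phi> \<in> hom free_group G" "\<And>a. \<phi> (free_gen a) = f a"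
proof
  \<comment> \<open>Any representative will do, since evaluation is invariant under cancellation
    (\<open>word_eval_word_eq\<close>).\<close>
  define \<phi> where "\<phi> A = word_eval G f (SOME u. u \<in> A)" for A
  have \<phi>: "\<phi> (word_eq `` {u}) = word_eval G f u" for u
  proof -
    have "u \<in> word_eq `` {u}" by (simp add: word_eq_refl)
    then have "(SOME v. v \<in> word_eq `` {u}) \<in> word_eq `` {u}" by (rule someI)
    then show ?thesis unfolding \<phi>_def using word_eval_word_eq[OF f] by fastforce
  qed
  show "\<phi> \<in> hom free_group G"
    by (auto simp: hom_def free_group_carrier \<phi> word_eval_closed[OF f] free_group_mult
        word_eval_append[OF f])
  show "\<phi> (free_gen a) = f a" for a
    using f by (auto simp: free_gen_def \<phi> image_subset_iff)
qed

end

lemma free_group_generate: "generate free_group (range free_gen) = carrier free_group"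
proof
  interpret group "free_group :: 'a word set monoid" by (rule group_free_group)
  show "generate free_group (range free_gen) \<subseteq> carrier (free_group :: 'a word set monoid)"
    by (rule generate_incl) (auto simp: free_gen_closed)
  show "carrier (free_group :: 'a word set monoid) \<subseteq> generate free_group (range free_gen)"
  proof
    fix A :: "'a word set"
    assume "A \<in> carrier free_group"
    then obtain u where A: "A = word_eq `` {u}" by (auto simp: free_group_carrier)
    have "word_eq `` {u} \<in> generate free_group (range free_gen)"
    proof (induction u)
      case Nil
      then show ?case using generate.one[of free_group] by (simp add: free_group_one)
    next
      case (Cons p u)
      obtain a b where p: "p = (a, b)" by fastforce
      have eq: "word_eq `` {p # u} = word_eq `` {[(a, b)]} \<otimes>\<^bsub>free_group\<^esub> word_eq `` {u}"
        by (simp add: free_group_mult p)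
      have "word_eq `` {[(a, False)]} = inv\<^bsub>free_group\<^esub> (free_gen a)"
      proof (rule inv_equality[symmetric])
        show "word_eq `` {[(a, False)]} \<otimes>\<^bsub>free_group\<^esub> free_gen a = \<one>\<^bsub>free_group\<^esub>"
          using word_inv_left[of "[(a, True)]"]
          by (simp add: free_gen_def free_group_mult free_group_one word_inv_def word_eq_class_iff)
      qed (simp_all add: free_gen_closed, simp add: free_group_carrier)
      then have "word_eq `` {[(a, b)]} \<in> generate free_group (range free_gen)"
        by (cases b) (auto simp: free_gen_def intro: generate.incl generate.inv)
      then show ?case unfolding eq using Cons.IH by (rule generate.eng)
    qed
    then show "A \<in> generate free_group (range free_gen)" by (simp add: A)
  qed
qed

lemma (in group) subset_normal_closure: "R \<subseteq> normal_closure G R"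
  by (auto simp: normal_closure_def)

lemma (in group) normal_closure_minimal: "N \<lhd> G \<Longrightarrow> R \<subseteq> N \<Longrightarrow> normal_closure G R \<subseteq> N"
  by (auto simp: normal_closure_def)

lemma (in group_hom) normal_closure_le_kernel:
  assumes "R \<subseteq> carrier G" "\<And>r. r \<in> R \<Longrightarrow> h r = \<one>\<^bsub>H\<^esub>"
  shows "normal_closure G R \<subseteq> kernel G H h"
  using assms by (intro G.normal_closure_minimal normal_kernel) (auto simp: kernel_def)

section \<open>The group \<open>J2\<close> as the universal group with two elements satisfying its
  relations\<close>

definition J2_x :: "int \<Rightarrow> gen word set set" where
  "J2_x \<alpha> = normal_closure free_group (J2_relators (multiplicity 2 (\<alpha> - 1)) \<alpha>)
     #>\<^bsub>free_group\<^esub> free_gen Gen_x"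

definition J2_y :: "int \<Rightarrow> gen word set set" where
  "J2_y \<alpha> = normal_closure free_group (J2_relators (multiplicity 2 (\<alpha> - 1)) \<alpha>)
     #>\<^bsub>free_group\<^esub> free_gen Gen_y"

text \<open>The defining relations as a property of two elements of an arbitrary group. Here
  \<open>m\<close> is an argument of its own, so that the relations can be moved along homomorphisms
  and tested in quotients and permutation groups.\<close>

definition macdonald_pair :: "('a, 'b) monoid_scheme \<Rightarrow> nat \<Rightarrow> int \<Rightarrow> 'a \<Rightarrow> 'a \<Rightarrow> bool" where
  "macdonald_pair G m \<alpha> x y \<longleftrightarrow>
     x \<in> carrier G \<and> y \<in> carrier G \<and>
     grp_conj G x (grp_comm G x y) = x [^]\<^bsub>G\<^esub> \<alpha> \<and>
     grp_conj G y (grp_comm G y x) = y [^]\<^bsub>G\<^esub> \<alpha> \<and>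
     x [^]\<^bsub>G\<^esub> (2 ^ (3 * m - 1) :: nat) = \<one>\<^bsub>G\<^esub> \<and>
     y [^]\<^bsub>G\<^esub> (2 ^ (3 * m - 1) :: nat) = \<one>\<^bsub>G\<^esub>"

lemma (in group_hom) hom_grp_comm:
  "a \<in> carrier G \<Longrightarrow> b \<in> carrier G \<Longrightarrow> h (grp_comm G a b) = grp_comm H (h a) (h b)"
  by (simp add: grp_comm_def)

lemma (in group_hom) hom_grp_conj:
  "a \<in> carrier G \<Longrightarrow> b \<in> carrier G \<Longrightarrow> h (grp_conj G a b) = grp_conj H (h a) (h b)"
  by (simp add: grp_conj_def)

lemma (in group) grp_comm_closed [simp]:
  "a \<in> carrier G \<Longrightarrow> b \<in> carrier G \<Longrightarrow> grp_comm G a b \<in> carrier G"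
  by (simp add: grp_comm_def)

lemma (in group) grp_conj_closed [simp]:
  "a \<in> carrier G \<Longrightarrow> b \<in> carrier G \<Longrightarrow> grp_conj G a b \<in> carrier G"
  by (simp add: grp_conj_def)

lemma (in group_hom) macdonald_pair_hom:
  assumes "macdonald_pair G m \<alpha> x y"
  shows "macdonald_pair H m \<alpha> (h x) (h y)"
proof -
  have x: "x \<in> carrier G" and y: "y \<in> carrier G" using assms by (auto simp: macdonald_pair_def)
  have p: "h (z [^]\<^bsub>G\<^esub> (k::int)) = h z [^]\<^bsub>H\<^esub> k" "h (z [^]\<^bsub>G\<^esub> (n::nat)) = h z [^]\<^bsub>H\<^esub> n"
    if "z \<in> carrier G" for z k n
    using that by (simp_all add: hom_int_pow hom_nat_pow)
  from assms show ?thesis unfolding macdonald_pair_def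
    by (metis x y p hom_grp_comm hom_grp_conj G.grp_comm_closed hom_closed hom_one)
qed

lemma J2_pair: "macdonald_pair (J2 \<alpha>) (multiplicity 2 (\<alpha> - 1)) \<alpha> (J2_x \<alpha>) (J2_y \<alpha>)"
proof -
  let ?F = "free_group :: gen word set monoid" and ?x = "free_gen Gen_x" and ?y = "free_gen Gen_y"
  let ?m = "multiplicity 2 (\<alpha> - 1)"
  let ?R = "J2_relators ?m \<alpha>"
  let ?N = "normal_closure ?F ?R"
  interpret F: group ?F by (rule group_free_group)
  interpret N: normal ?N ?F by (rule F.normal_closure_normal[OF J2_relators_closed])
  interpret Q: group "J2 \<alpha>" by (rule group_J2)
  have J: "J2 \<alpha> = ?F Mod ?N" by (simp add: J2_def presented_group_def)
  interpret q: group_hom ?F "J2 \<alpha>" "\<lambda>a. ?N #>\<^bsub>?F\<^esub> a"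
    using N.r_coset_hom_Mod by (unfold_locales) (simp add: J)
  have one: "?N #>\<^bsub>?F\<^esub> r = \<one>\<^bsub>J2 \<alpha>\<^esub>" if "r \<in> ?R" for r
    using that F.subset_normal_closure J2_relators_closed
    by (metis F.coset_join2 J N.subgroup_axioms N.mem_carrier one_FactGroup subsetD)
  have eq: "?N #>\<^bsub>?F\<^esub> a = ?N #>\<^bsub>?F\<^esub> b"
    if "a \<otimes>\<^bsub>?F\<^esub> inv\<^bsub>?F\<^esub> b \<in> ?R" "a \<in> carrier ?F" "b \<in> carrier ?F" for a b
  proof -
    have "(?N #>\<^bsub>?F\<^esub> a) \<otimes>\<^bsub>J2 \<alpha>\<^esub> inv\<^bsub>J2 \<alpha>\<^esub> (?N #>\<^bsub>?F\<^esub> b) = \<one>\<^bsub>J2 \<alpha>\<^esub>"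
      using one[OF that(1)] that(2,3) q.hom_mult[of a "inv\<^bsub>?F\<^esub> b"] q.hom_inv[of b] by simp
    then show ?thesis
      using Q.inv_equality[of "?N #>\<^bsub>?F\<^esub> a" "inv\<^bsub>J2 \<alpha>\<^esub> (?N #>\<^bsub>?F\<^esub> b)"]
        q.hom_closed[OF that(2)] q.hom_closed[OF that(3)] by simp
  qed
  have mem: "grp_conj ?F ?x (grp_comm ?F ?x ?y) \<otimes>\<^bsub>?F\<^esub> inv\<^bsub>?F\<^esub> (?x [^]\<^bsub>?F\<^esub> \<alpha>) \<in> ?R"
    "grp_conj ?F ?y (grp_comm ?F ?y ?x) \<otimes>\<^bsub>?F\<^esub> inv\<^bsub>?F\<^esub> (?y [^]\<^bsub>?F\<^esub> \<alpha>) \<in> ?R"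
    "?x [^]\<^bsub>?F\<^esub> (2 ^ (3 * ?m - 1) :: nat) \<in> ?R" "?y [^]\<^bsub>?F\<^esub> (2 ^ (3 * ?m - 1) :: nat) \<in> ?R"
    by (auto simp: J2_relators_def Let_def)
  have c: "?x \<in> carrier ?F" "?y \<in> carrier ?F" by (simp_all add: free_gen_closed)
  have c': "grp_comm ?F ?x ?y \<in> carrier ?F" "grp_comm ?F ?y ?x \<in> carrier ?F" using c by simp_all
  note hs = q.hom_grp_conj[OF c(1) c'(1)] q.hom_grp_conj[OF c(2) c'(2)] q.hom_grp_comm[OF c]
    q.hom_grp_comm[OF c(2) c(1)] q.hom_int_pow[OF c(1)] q.hom_int_pow[OF c(2)]
    q.hom_nat_pow[OF c(1)] q.hom_nat_pow[OF c(2)]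
  show ?thesis
    unfolding macdonald_pair_def J2_x_def J2_y_def hs[symmetric]
    using eq[OF mem(1)] eq[OF mem(2)] one[OF mem(3)] one[OF mem(4)] c c' by simp
qed

lemma J2_generate: "generate (J2 \<alpha>) {J2_x \<alpha>, J2_y \<alpha>} = carrier (J2 \<alpha>)"
proof -
  let ?F = "free_group :: gen word set monoid"
  let ?N = "normal_closure ?F (J2_relators (multiplicity 2 (\<alpha> - 1)) \<alpha>)"
  interpret F: group ?F by (rule group_free_group)
  interpret N: normal ?N ?F by (rule F.normal_closure_normal[OF J2_relators_closed])
  interpret Q: group "J2 \<alpha>" by (rule group_J2)
  have J: "J2 \<alpha> = ?F Mod ?N" by (simp add: J2_def presented_group_def)
  interpret q: group_hom ?F "J2 \<alpha>" "\<lambda>a. ?N #>\<^bsub>?F\<^esub> a"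
    using N.r_coset_hom_Mod by (unfold_locales) (simp add: J)
  have gens: "range (free_gen :: gen \<Rightarrow> _) = {free_gen Gen_x, free_gen Gen_y}"
    using gen.exhaust by (metis (full_types) UNIV_eq_I image_insert image_empty insertCI)
  have "(\<lambda>a. ?N #>\<^bsub>?F\<^esub> a) ` carrier ?F = carrier (J2 \<alpha>)"
    by (simp add: J carrier_FactGroup)
  moreover have "(\<lambda>a. ?N #>\<^bsub>?F\<^esub> a) ` generate ?F (range free_gen) = generate (J2 \<alpha>) ((\<lambda>a. ?N #>\<^bsub>?F\<^esub> a) ` range free_gen)"
    by (rule q.generate_img[symmetric]) (auto simp: free_gen_closed)
  ultimately have "generate (J2 \<alpha>) ((\<lambda>a. ?N #>\<^bsub>?F\<^esub> a) ` range free_gen) = carrier (J2 \<alpha>)"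
    by (simp add: free_group_generate)
  then show ?thesis
    by (simp add: gens J2_x_def J2_y_def)
qed

text \<open>Von Dyck's principle. Every homomorphism out of \<open>J2\<close> below is obtained from
  it, so that only relations between two concrete elements ever have to be verified.\<close>

lemma (in group) J2_universal:
  assumes "macdonald_pair G (multiplicity 2 (\<alpha> - 1)) \<alpha> x y"
  obtains \<phi> where "\<phi> \<in> hom (J2 \<alpha>) G" "\<phi> (J2_x \<alpha>) = x" "\<phi> (J2_y \<alpha>) = y"
proof -
  let ?F = "free_group :: gen word set monoid"
  let ?R = "J2_relators (multiplicity 2 (\<alpha> - 1)) \<alpha>"
  let ?N = "normal_closure ?F ?R"
  interpret F: group ?F by (rule group_free_group)
  have xy: "x \<in> carrier G" "y \<in> carrier G" using assms by (auto simp: macdonald_pair_def)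
  define f where "f g = (case g of Gen_x \<Rightarrow> x | Gen_y \<Rightarrow> y)" for g
  have f: "range f \<subseteq> carrier G" using xy by (auto simp: f_def split: gen.splits)
  obtain \<psi> where \<psi>: "\<psi> \<in> hom ?F G" "\<And>a. \<psi> (free_gen a) = f a"
    using free_group_universal[OF f] by blast
  interpret h: group_hom ?F G \<psi> using \<psi>(1) by unfold_locales
  have gen: "\<psi> (free_gen Gen_x) = x" "\<psi> (free_gen Gen_y) = y" by (simp_all add: \<psi> f_def)
  have "\<psi> r = \<one>" if "r \<in> ?R" for r
    using that assms xy
    by (auto simp: J2_relators_def Let_def macdonald_pair_def h.hom_grp_conj h.hom_grp_comm
        h.hom_int_pow h.hom_nat_pow free_gen_closed gen)
  then have ker: "?N \<subseteq> kernel ?F G \<psi>" by (intro h.normal_closure_le_kernel J2_relators_closed)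
  have "?N \<lhd> ?F" by (rule F.normal_closure_normal[OF J2_relators_closed])
  then obtain \<phi> where "\<phi> \<in> hom (?F Mod ?N) G" "\<And>a. a \<in> carrier ?F \<Longrightarrow> \<phi> (?N #>\<^bsub>?F\<^esub> a) = \<psi> a"
    using h.FactGroup_universal_kernel[OF _ ker] by blast
  then show thesis
    using that[of \<phi>] gen by (simp add: J2_def presented_group_def J2_x_def J2_y_def free_gen_closed)
qed

lemma (in group) hom_eq_on_generate:
  assumes "group H" "\<phi> \<in> hom G H" "\<psi> \<in> hom G H" "S \<subseteq> carrier G" "\<And>s. s \<in> S \<Longrightarrow> \<phi> s = \<psi> s"
    and "g \<in> generate G S"
  shows "\<phi> g = \<psi> g"
proof -
  interpret p: group_hom G H \<phi> using assms by (simp add: group_hom_def group_hom_axioms_def is_group)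
  interpret q: group_hom G H \<psi> using assms by (simp add: group_hom_def group_hom_axioms_def is_group)
  from assms(6) show ?thesis
  proof induction
    case (inv s)
    then have "s \<in> carrier G" using assms(4) by blast
    then show ?case using inv assms(5) by simp
  next
    case (eng s t)
    then have "s \<in> carrier G" "t \<in> carrier G" using generate_in_carrier[OF assms(4)] by blast+
    then show ?case using eng by simp
  qed (use assms(5) in auto)
qed

lemma is_isoI_inverse_hom:
  assumes "\<phi> \<in> hom G H" "\<psi> \<in> hom H G"
    and "\<And>g. g \<in> carrier G \<Longrightarrow> \<psi> (\<phi> g) = g" "\<And>k. k \<in> carrier H \<Longrightarrow> \<phi> (\<psi> k) = k"
  shows "G \<cong> H"
proof -
  have "bij_betw \<phi> (carrier G) (carrier H)"
    by (rule bij_betw_byWitness[where f' = \<psi>]) (use assms in \<open>auto simp: hom_def\<close>)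
  then show ?thesis using assms(1) by (auto simp: is_iso_def iso_def)
qed

text \<open>Both composites fix the two generators and hence are the identity; neither injectivity
  nor surjectivity needs a computation in the groups.\<close>

lemma J2_iso_inverse:
  assumes "\<phi> \<in> hom (J2 \<alpha>) (J2 \<beta>)" "\<psi> \<in> hom (J2 \<beta>) (J2 \<alpha>)"
    and "\<psi> (\<phi> (J2_x \<alpha>)) = J2_x \<alpha>" "\<psi> (\<phi> (J2_y \<alpha>)) = J2_y \<alpha>"
    and "\<phi> (\<psi> (J2_x \<beta>)) = J2_x \<beta>" "\<phi> (\<psi> (J2_y \<beta>)) = J2_y \<beta>"
  shows "J2 \<alpha> \<cong> J2 \<beta>"
proof (rule is_isoI_inverse_hom[OF assms(1,2)])
  have id: "\<chi> g = g"
    if "\<chi> \<in> hom (J2 \<gamma>) (J2 \<gamma>)" "\<chi> (J2_x \<gamma>) = J2_x \<gamma>" "\<chi> (J2_y \<gamma>) = J2_y \<gamma>"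
      "g \<in> carrier (J2 \<gamma>)" for \<gamma> \<chi> g
    using group.hom_eq_on_generate[OF group_J2 group_J2 that(1), of "\<lambda>g. g" "{J2_x \<gamma>, J2_y \<gamma>}" g]
      that J2_pair[of \<gamma>] J2_generate[of \<gamma>]
    by (auto simp: macdonald_pair_def hom_def)
  have 1: "\<psi> \<circ> \<phi> \<in> hom (J2 \<alpha>) (J2 \<alpha>)" "\<phi> \<circ> \<psi> \<in> hom (J2 \<beta>) (J2 \<beta>)"
    using assms(1,2) by (auto intro: Group.hom_compose)
  show "\<psi> (\<phi> g) = g" if "g \<in> carrier (J2 \<alpha>)" for g
    using id[OF 1(1) _ _ that] assms by simp
  show "\<phi> (\<psi> g) = g" if "g \<in> carrier (J2 \<beta>)" for g
    using id[OF 1(2) _ _ that] assms by simp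
qed

section \<open>Arithmetic of the exponents\<close>

text \<open>\<open>t2\<close> and \<open>t3\<close> are the binomial coefficients over 2 and 3,
  continued as polynomials to negative integers because negative exponents occur throughout. The
  identities \<open>t2\<close> and \<open>t3\<close> clear the denominators, which is the form that
  polynomial reasoning can use.\<close>

definition t2 :: "int \<Rightarrow> int" where "t2 x = x * (x - 1) div 2"
definition t3 :: "int \<Rightarrow> int" where "t3 x = x * (x - 1) * (x - 2) div 6"

lemma t2: "2 * t2 x = x * (x - 1)"
  unfolding t2_def by (intro dvd_mult_div_cancel) simp

lemma t3: "6 * t3 x = x * (x - 1) * (x - 2)"
proof -
  have "2 dvd x * (x - 1) * (x - 2)" by simp
  moreover have "(3::int) dvd x * (x - 1) * (x - 2)"
  proof -
    have "x mod 3 = 0 \<or> x mod 3 = 1 \<or> x mod 3 = 2" by presburger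
    then have "3 dvd x \<or> 3 dvd x - 1 \<or> 3 dvd x - 2" by presburger
    then show ?thesis by auto
  qed
  ultimately have "2 * 3 dvd x * (x - 1) * (x - 2)" by (intro divides_mult) auto
  then show ?thesis unfolding t3_def by simp
qed

lemma t2_add: "t2 (x + y) = t2 x + t2 y + x * y"
  using t2[of "x + y"] t2[of x] t2[of y] by (simp add: algebra_simps)

lemma t2_Suc: "t2 (x + 1) = t2 x + x"
  using t2_add[of x 1] by (simp add: t2_def)

lemma t3_Suc: "t3 (x + 1) = t3 x + t2 x"
  using t3[of "x + 1"] t3[of x] t2[of x] by (simp add: algebra_simps)

lemma t2_mult: "t2 (n * b) = t2 n * b\<^sup>2 + n * t2 b"
proof -
  have "2 * t2 (n * b) = 2 * (t2 n * b\<^sup>2 + n * t2 b)"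
    using t2[of "n * b"] t2[of n] t2[of b] by Groebner_Basis.algebra
  then show ?thesis by simp
qed

lemma congI: "x = y + n * k \<Longrightarrow> [x = y] (mod (n::int))"
  by (simp add: cong_iff_dvd_diff)

locale macdonald_param =
  fixes m :: nat and l :: int
  assumes m: "2 \<le> m" and l: "odd l"
begin

text \<open>Since \<open>2 * h = 2 ^ m\<close>, the order \<open>2 ^ (3 * m - 1)\<close> in the
  presentation is \<open>4 * h ^ 3\<close>. Half of \<open>2 ^ m\<close> is the natural unit: the
  denominator of \<open>t2\<close> turns multiples of \<open>2 * h\<close> into multiples of
  \<open>h\<close>.\<close>

definition h :: int where "h = 2 ^ (m - 1)"
definition u :: int where "u = 2 * h * l"
text \<open>The binomial expansion of \<open>(1 + u) ^ k\<close>, cut off where \<open>u ^ 3\<close>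
  vanishes modulo \<open>4 * h ^ 3\<close>. For negative \<open>k\<close> it represents the inverse
  power.\<close>

definition ap :: "int \<Rightarrow> int" where "ap k = 1 + u * k + u\<^sup>2 * t2 k"
text \<open>The sum of \<open>ap 1\<close>, ..., \<open>ap b\<close> in closed form, by the
  hockey-stick identity. It is the exponent of \<open>A\<close> in the \<open>b\<close>-th power of
  \<open>A\<close> times \<open>C\<close>; see \<open>AC_pow\<close>.\<close>

definition sg :: "int \<Rightarrow> int" where "sg b = b + u * t2 (b + 1) + u\<^sup>2 * t3 (b + 1)"
text \<open>These are the exponents in \<open>B\<^sup>b A\<^sup>n = A^(an b n) C^(- Sn b n) B^(bn b n)\<close>; see \<open>B_A_pow\<close>.\<close>

definition an :: "int \<Rightarrow> int \<Rightarrow> int" where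
  "an b n = n + u * b * t2 n + u\<^sup>2 * (t3 n * (t2 (b + 1) + b\<^sup>2) + t2 n * (t2 (b + 1) - b))"
definition Sn :: "int \<Rightarrow> int \<Rightarrow> int" where
  "Sn b n = n * b + u * t2 (b + 1) * t2 n + 2 * h\<^sup>2 * t3 n * t2 (b + 1)"
definition bn :: "int \<Rightarrow> int \<Rightarrow> int" where
  "bn b n = b + n * u * t2 (b + 1) + n * u\<^sup>2 * t3 (b + 1)
     + 2 * h\<^sup>2 * l\<^sup>2 * t2 n * t2 (b + 1) * (2 * b + 1) + 2 * h ^ 3 * t3 n * t2 (b + 1)"

lemma even_h: "even h"
  using m by (simp add: h_def)

lemma h_pos: "h > 0" by (simp add: h_def)

lemma coprime_h_3: "coprime h 3"
  unfolding h_def by (intro coprime_power_left_iff[THEN iffD2]) simp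

text \<open>Of the denominator 6, the factor 2 is paid by the shift \<open>2 * h\<close>, and the
  factor 3 is invertible modulo the power of two \<open>h\<close>.\<close>

lemma t3_shift: "\<exists>z. t3 (y + 2 * h * w) = t3 y + h * z"
proof -
  have "3 * (t3 (y + 2 * h * w) - t3 y) =
    h * (w * (3 * y\<^sup>2 + 6 * y * h * w + 4 * h\<^sup>2 * w\<^sup>2 - 6 * y - 6 * h * w + 2))"
    using t3[of y] t3[of "y + 2 * h * w"] by Groebner_Basis.algebra
  then have "h dvd (t3 (y + 2 * h * w) - t3 y) * 3" by (metis dvd_triv_left mult.commute)
  then have "h dvd t3 (y + 2 * h * w) - t3 y"
    using coprime_h_3 coprime_dvd_mult_left_iff by blast
  then show ?thesis by (metis add.commute diff_eq_eq dvdE)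
qed

lemma t2_shift: "t2 (y + 2 * h * w) = t2 y + h * (w * (2 * y + 2 * h * w - 1))"
  using t2[of y] t2[of "y + 2 * h * w"] by Groebner_Basis.algebra

text \<open>In a term that already carries half of the modulus, \<open>l ^ 2\<close> and
  \<open>l ^ 3\<close> may be replaced by 1. This is why the last terms of \<open>Sn\<close> and
  \<open>bn\<close> do not contain \<open>l\<close>.\<close>

lemma cube_l: "\<exists>j. l ^ 3 = 1 + 2 * j" "\<exists>j. l\<^sup>2 = 1 + 2 * j"
  using l by (metis add.commute even_power oddE)+

text \<open>Right multiplication of a normal form by \<open>A\<close> applies \<open>sg\<close> to
  the exponent of \<open>B\<close> (\<open>nf_A\<close>), so \<open>bn b n\<close> has to be a
  closed form of the \<open>n\<close>-fold iterate of \<open>sg\<close> at \<open>b\<close>. Its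
  distance \<open>2 * h * w\<close> from \<open>b\<close> makes \<open>t3_shift\<close>
  applicable.\<close>

lemma bn_Suc: "[bn b (n + 1) = sg (bn b n)] (mod 4 * h ^ 3)"
proof -
  define T where "T = t2 (b + 1)"
  define S where "S = t3 (b + 1)"
  define w where "w = n * l * T + 2 * n * h * l\<^sup>2 * S + h * l\<^sup>2 * t2 n * T * (2 * b + 1) + h\<^sup>2 * t3 n * T"
  have y: "bn b n = b + 2 * h * w"
    unfolding bn_def w_def T_def S_def u_def by Groebner_Basis.algebra
  obtain z where z: "t3 (bn b n + 1) = S + h * z"
    using t3_shift[of "b + 1" w] by (auto simp: y S_def algebra_simps)
  obtain j where j: "l ^ 3 = 1 + 2 * j" using cube_l by blast
  obtain g where g: "h = 2 * g" using even_h by blast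
  have T: "b * b = 2 * T - b" using t2[of "b + 1"] by (simp add: T_def algebra_simps)
  have "2 * t2 (bn b n + 1) = (bn b n + 1) * bn b n" using t2[of "bn b n + 1"] by simp
  then have "sg (bn b n) = bn b n + h * l * ((bn b n + 1) * bn b n) + u\<^sup>2 * (S + h * z)"
    unfolding sg_def u_def z by Groebner_Basis.algebra
  also have "\<dots> = bn b n + h * l * (2 * T + 2 * h * w * (2 * b + 1) + 4 * h\<^sup>2 * w\<^sup>2) + u\<^sup>2 * (S + h * z)"
    unfolding y using T by Groebner_Basis.algebra
  also have "2 * h * w * (2 * b + 1) = 2 * h * n * l * T * (2 * b + 1) + 4 * n * h\<^sup>2 * l\<^sup>2 * S * (2 * b + 1)
    + 2 * h\<^sup>2 * l\<^sup>2 * t2 n * T * (8 * T + 1) + 2 * h ^ 3 * t3 n * T * (2 * b + 1)"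
    unfolding w_def using T by Groebner_Basis.algebra
  finally have "sg (bn b n) = bn b (n + 1)
    + 4 * h ^ 3 * (l * w\<^sup>2 + l ^ 3 * (2 * b + 1) * n * S + j * t2 n * T + 4 * l ^ 3 * t2 n * T\<^sup>2
       + g * l * t3 n * T * (2 * b + 1) + l\<^sup>2 * z)"
    unfolding bn_def[of b "n + 1"] bn_def[of b n] t2_Suc[of n] t3_Suc[of n] u_def T_def[symmetric] S_def[symmetric]
    using j g by Groebner_Basis.algebra
  then show ?thesis by (intro cong_sym[OF congI])
qed


text \<open>Each further \<open>A\<close> lowers the exponent of \<open>C\<close> by the current
  exponent of \<open>B\<close>. The modulus is smaller than for \<open>A\<close> and
  \<open>B\<close> because \<open>C\<close> satisfies \<open>C_cong\<close>.\<close>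

lemma Sn_Suc: "[Sn b (n + 1) = Sn b n + bn b n] (mod 4 * h\<^sup>2)"
proof -
  define T where "T = t2 (b + 1)"
  define S where "S = t3 (b + 1)"
  obtain j where j: "l\<^sup>2 = 1 + 2 * j" using cube_l by blast
  have "Sn b n + bn b n = Sn b (n + 1)
    + 4 * h\<^sup>2 * (n * l\<^sup>2 * S + l\<^sup>2 * b * t2 n * T + j * t2 n * T) + 2 * h ^ 3 * t3 n * T"
    unfolding Sn_def bn_def t2_Suc[of n] t3_Suc[of n] u_def T_def[symmetric] S_def[symmetric]
    using j by Groebner_Basis.algebra
  moreover obtain g where g: "h = 2 * g" using even_h by blast
  ultimately have "Sn b n + bn b n = Sn b (n + 1)
    + 4 * h\<^sup>2 * (n * l\<^sup>2 * S + l\<^sup>2 * b * t2 n * T + j * t2 n * T + g * t3 n * T)"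
    by Groebner_Basis.algebra
  then show ?thesis by (intro cong_sym[OF congI])
qed

text \<open>The new \<open>A\<close> has to pass the power of \<open>C\<close> with exponent
  \<open>- Sn b n\<close>, which raises it to the power \<open>ap (Sn b n)\<close>.\<close>

lemma an_Suc: "[an b (n + 1) = an b n + ap (Sn b n)] (mod 4 * h ^ 3)"
proof -
  define T where "T = t2 (b + 1)"
  define w where "w = l * T * t2 n + h * t3 n * T"
  have S: "Sn b n = n * b + 2 * h * w"
    unfolding Sn_def w_def T_def u_def by Groebner_Basis.algebra
  have tS: "t2 (Sn b n) = t2 n * b\<^sup>2 + n * (T - b) + h * (w * (2 * (n * b) + 2 * h * w - 1))"
    unfolding S t2_shift t2_mult using t2_Suc[of b] by (simp add: T_def)
  have "an b n + ap (Sn b n) = an b (n + 1)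
    + 4 * h ^ 3 * (l * t3 n * T + l\<^sup>2 * w * (2 * (n * b) + 2 * h * w - 1))"
    unfolding ap_def tS an_def t2_Suc[of n] t3_Suc[of n] T_def[symmetric]
    unfolding S w_def u_def by Groebner_Basis.algebra
  then show ?thesis by (intro cong_sym[OF congI])
qed

lemma ap_0 [simp]: "ap 0 = 1" and ap_1: "ap 1 = 1 + u"
  by (simp_all add: ap_def t2_def)

lemma sg_0 [simp]: "sg 0 = 0"
  by (simp add: sg_def t2_def t3_def)

lemma an_0 [simp]: "an b 0 = 0" and Sn_0 [simp]: "Sn b 0 = 0" and bn_0 [simp]: "bn b 0 = b"
  by (simp_all add: an_def Sn_def bn_def t2_def t3_def)

lemma an_at_0 [simp]: "an 0 n = n" and Sn_at_0 [simp]: "Sn 0 n = 0" and bn_at_0 [simp]: "bn 0 n = 0"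
  by (simp_all add: an_def Sn_def bn_def t2_def t3_def)

lemma ap_add: "[ap (k + k') = ap k * ap k'] (mod 4 * h ^ 3)"
proof -
  have "ap k * ap k' = ap (k + k') + 4 * h ^ 3 * (l ^ 3 * (2 * k * t2 k' + 2 * k' * t2 k + 2 * u * t2 k * t2 k'))"
    unfolding ap_def t2_add u_def by Groebner_Basis.algebra
  then show ?thesis by (intro cong_sym[OF congI])
qed

lemma ap_cong:
  assumes "[k = k'] (mod 2 * h\<^sup>2)" shows "[ap k = ap k'] (mod 4 * h ^ 3)"
proof -
  obtain r where "k = k' + 2 * h\<^sup>2 * r"
    using assms by (metis cong_iff_lin cong_sym)
  then have r: "k = k' + 2 * h * (h * r)" by (simp add: power2_eq_square)
  have "ap k = ap k' + 4 * h ^ 3 * (l * r + l\<^sup>2 * (h * r) * (2 * k' + 2 * h * (h * r) - 1))"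
    unfolding ap_def r t2_shift u_def by Groebner_Basis.algebra
  then show ?thesis by (rule congI)
qed

lemma ap_neg: "[ap k * ap (- k) = 1] (mod 4 * h ^ 3)"
  using ap_add[of k "- k"] by (simp add: cong_sym)

lemma ap_neg1: "[(1 + u) * ap (- 1) = 1] (mod 4 * h ^ 3)"
  using ap_neg[of 1] by (simp add: ap_1)

lemma sg_Suc: "[sg (b + 1) = (1 + u) * (sg b + 1)] (mod 4 * h ^ 3)"
proof -
  have "(1 + u) * (sg b + 1) = sg (b + 1) + 4 * h ^ 3 * (2 * l ^ 3 * t3 (b + 1))"
    unfolding sg_def t2_Suc[of "b + 1"] t3_Suc[of "b + 1"] t2_Suc[of b] u_def
    by Groebner_Basis.algebra
  then show ?thesis by (intro cong_sym[OF congI])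
qed

text \<open>The shift changes \<open>t2 (b + 1)\<close> by \<open>h * (h * r)\<close> times an odd
  number. Multiplied by \<open>u = 2 * h * l\<close> with \<open>l\<close> odd, this leaves
  \<open>2 * h ^ 3 * r\<close> modulo \<open>4 * h ^ 3\<close>. That extra term is the origin of the
  relation \<open>C_2h2\<close>.\<close>

lemma sg_shift:
  "[sg (b + 2 * h\<^sup>2 * r) = sg b + 2 * h\<^sup>2 * r + 2 * h ^ 3 * r] (mod 4 * h ^ 3)"
proof -
  obtain z where z: "t3 (b + 1 + 2 * h * (h * r)) = t3 (b + 1) + h * z"
    using t3_shift by blast
  obtain k where k: "l = 2 * k + 1" using l oddE by blast
  obtain g where g: "h = 2 * g" using even_h by blast
  have e: "b + 2 * h\<^sup>2 * r + 1 = b + 1 + 2 * h * (h * r)" by (simp add: power2_eq_square)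
  have "sg (b + 2 * h\<^sup>2 * r) = sg b + 2 * h\<^sup>2 * r + 2 * h ^ 3 * r
    + 4 * h ^ 3 * (l * r * b + k * r + l * h * r\<^sup>2 * h + l\<^sup>2 * z)"
    unfolding sg_def e z t2_shift u_def using k g by Groebner_Basis.algebra
  then show ?thesis by (rule congI)
qed

lemma sg_cong:
  assumes "[b = b'] (mod 4 * h ^ 3)" shows "[sg b = sg b'] (mod 4 * h ^ 3)"
proof -
  obtain r where "b = b' + 4 * h ^ 3 * r"
    using assms by (metis cong_iff_lin cong_sym)
  then have r: "b = b' + 2 * h\<^sup>2 * (2 * h * r)" by (simp add: power2_eq_square power3_eq_cube)
  have "sg b' + 2 * h\<^sup>2 * (2 * h * r) + 2 * h ^ 3 * (2 * h * r) = sg b' + 4 * h ^ 3 * (r + h * r)"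
    by Groebner_Basis.algebra
  then show ?thesis using sg_shift[of b' "2 * h * r"] congI[of _ "sg b'"] cong_trans
    unfolding r by metis
qed

lemma t2_alpha: "t2 (1 + u) = h * l * (1 + u)"
  using t2[of "1 + u"] by (simp add: u_def algebra_simps)

lemma t3_alpha: "\<exists>z. t3 (1 + u) = h * z"
proof -
  have "3 * t3 (1 + u) = h * (l * (1 + u) * (u - 1))"
    using t3[of "1 + u"] by (simp add: u_def algebra_simps)
  then have "h dvd t3 (1 + u) * 3" by (metis dvd_triv_left mult.commute)
  then show ?thesis using coprime_h_3 coprime_dvd_mult_left_iff by blast
qed

lemma an_alpha: "[an b (1 + u) = (1 + u) * (1 + 2 * h\<^sup>2 * l\<^sup>2 * b)] (mod 4 * h ^ 3)"
proof -
  obtain z where z: "t3 (1 + u) = h * z" using t3_alpha by blast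
  define T where "T = t2 (b + 1)"
  have "an b (1 + u) = (1 + u) * (1 + 2 * h\<^sup>2 * l\<^sup>2 * b)
    + 4 * h ^ 3 * (l\<^sup>2 * (z * (T + b\<^sup>2) + l * (1 + u) * (T - b)))"
    unfolding an_def t2_alpha z T_def[symmetric] unfolding u_def by Groebner_Basis.algebra
  then show ?thesis by (rule congI)
qed

lemma Sn_alpha: "[Sn b (1 + u) = (1 + u) * b + 2 * h\<^sup>2 * t2 (b + 1)] (mod 4 * h\<^sup>2)"
proof -
  obtain z where z: "t3 (1 + u) = h * z" using t3_alpha by blast
  obtain g where g: "h = 2 * g" using even_h by blast
  obtain j where j: "l\<^sup>2 = 1 + 2 * j" using cube_l by blast
  define T where "T = t2 (b + 1)"
  have "Sn b (1 + u) = (1 + u) * b + 2 * h\<^sup>2 * T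
    + 4 * h\<^sup>2 * (j * T + l\<^sup>2 * T * h * l + g * z * T)"
    unfolding Sn_def t2_alpha z T_def[symmetric] unfolding u_def using g j by Groebner_Basis.algebra
  then show ?thesis unfolding T_def by (rule congI)
qed

text \<open>Stated at \<open>(1 + u) * b\<close> because it is applied where passing
  \<open>C\<close> has divided the exponent of \<open>B\<close> by \<open>1 + u\<close>. The two
  correction terms are those that the identifications between powers of \<open>A\<close>,
  \<open>B\<close> and \<open>C\<close> absorb in \<open>act_AC\<close>.\<close>

lemma bn_alpha:
  "[sg ((1 + u) * b) = (1 + u) * (bn b (1 + u) - 2 * h\<^sup>2 * l\<^sup>2 * b - 2 * h ^ 3 * t2 (b + 1))] (mod 4 * h ^ 3)"
proof -
  obtain z where z: "t3 (1 + u) = h * z" using t3_alpha by blast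
  obtain g where g: "h = 2 * g" using even_h by blast
  obtain j where j: "l ^ 3 = 1 + 2 * j" using cube_l by blast
  define T where "T = t2 (b + 1)"
  define S where "S = t3 (b + 1)"
  have T: "b * b = 2 * T - b" using t2[of "b + 1"] by (simp add: T_def algebra_simps)
  obtain y where y: "t3 (b + 1 + 2 * h * (l * b)) = S + h * y"
    using t3_shift unfolding S_def by blast
  have e: "(1 + u) * b + 1 = b + 1 + 2 * h * (l * b)" by (simp add: u_def algebra_simps)
  have "sg ((1 + u) * b) = (1 + u) * b + u * (T + h * (l * b * (2 * (b + 1) + 2 * h * (l * b) - 1))) + u\<^sup>2 * (S + h * y)"
    unfolding sg_def e y t2_shift T_def ..
  also have "\<dots> = (1 + u) * b + u * T + 2 * h\<^sup>2 * l\<^sup>2 * (4 * T - b) + 4 * h ^ 3 * (l ^ 3 * b\<^sup>2)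
       + u\<^sup>2 * (S + h * y)"
    unfolding u_def using T by Groebner_Basis.algebra
  finally have 1: "sg ((1 + u) * b) = (1 + u) * b + u * T + 2 * h\<^sup>2 * l\<^sup>2 * (4 * T - b) + u\<^sup>2 * S
       + 4 * h ^ 3 * (l ^ 3 * b\<^sup>2 + l\<^sup>2 * y)"
    unfolding u_def by Groebner_Basis.algebra
  have 2: "bn b (1 + u) = b + u * T + u\<^sup>2 * T + u\<^sup>2 * S + 2 * h ^ 3 * T
    + 4 * h ^ 3 * (2 * l ^ 3 * S + j * T + l ^ 3 * T * b + l ^ 3 * h * l * T * (2 * b + 1) + g * z * T)"
    unfolding bn_def t2_alpha z T_def[symmetric] S_def[symmetric] unfolding u_def using g j by Groebner_Basis.algebra
  have "(1 + u) * (bn b (1 + u) - 2 * h\<^sup>2 * l\<^sup>2 * b - 2 * h ^ 3 * T) = sg ((1 + u) * b)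
    + 4 * h ^ 3 * ((1 + u) * (2 * l ^ 3 * S + j * T + l ^ 3 * T * b + l ^ 3 * h * l * T * (2 * b + 1) + g * z * T)
       + 2 * l ^ 3 * T + 2 * l ^ 3 * S - l ^ 3 * b - l ^ 3 * b\<^sup>2 - l\<^sup>2 * y)"
    unfolding 1 2 unfolding u_def by Groebner_Basis.algebra
  then show ?thesis unfolding T_def by (intro cong_sym[OF congI])
qed

lemma an_period: "[an b (4 * h ^ 3) = 0] (mod 4 * h ^ 3)"
  and Sn_period: "[Sn b (4 * h ^ 3) = 0] (mod 4 * h\<^sup>2)"
  and bn_period: "[bn b (4 * h ^ 3) = b] (mod 4 * h ^ 3)"
proof -
  obtain z where z: "t3 (4 * h ^ 3) = h * z"
  proof -
    have "4 * h ^ 3 = 0 + 2 * h * (2 * h\<^sup>2)" by (simp add: power2_eq_square power3_eq_cube)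
    then show ?thesis using t3_shift[of 0 "2 * h\<^sup>2"] that by (auto simp: t3_def)
  qed
  obtain g where g: "h = 2 * g" using even_h by blast
  have t: "t2 (4 * h ^ 3) = 2 * h ^ 3 * (4 * h ^ 3 - 1)" using t2[of "4 * h ^ 3"] by simp
  define T where "T = t2 (b + 1)"
  define S where "S = t3 (b + 1)"
  have "an b (4 * h ^ 3) = 0 + 4 * h ^ 3 * (1 + b * (h * l) * (4 * h ^ 3 - 1)
     + l\<^sup>2 * (z * (T + b\<^sup>2) + 2 * h\<^sup>2 * (4 * h ^ 3 - 1) * (T - b)))"
    unfolding an_def t z T_def[symmetric] u_def by Groebner_Basis.algebra
  then show "[an b (4 * h ^ 3) = 0] (mod 4 * h ^ 3)" by (rule congI)
  have "Sn b (4 * h ^ 3) = 0 + 4 * h\<^sup>2 * (h * b + h\<^sup>2 * l * T * (4 * h ^ 3 - 1) + g * z * T)"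
    unfolding Sn_def t z T_def[symmetric] u_def using g by Groebner_Basis.algebra
  then show "[Sn b (4 * h ^ 3) = 0] (mod 4 * h\<^sup>2)" by (rule congI)
  have "bn b (4 * h ^ 3) = b + 4 * h ^ 3 * (u * T + u\<^sup>2 * S + h\<^sup>2 * l\<^sup>2 * (4 * h ^ 3 - 1) * T * (2 * b + 1) + g * z * T)"
    unfolding bn_def t z T_def[symmetric] S_def[symmetric] u_def using g by Groebner_Basis.algebra
  then show "[bn b (4 * h ^ 3) = b] (mod 4 * h ^ 3)" by (rule congI)
qed

lemma t3_Suc_alpha: "\<exists>z. t3 (1 + u + 1) = h * z"
  using t3_shift[of 2 l] by (auto simp: u_def t3_def add.commute mult.assoc)

text \<open>The exponents of \<open>A\<close> and \<open>B\<close> that are left over in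
  \<open>A_B_relation\<close>. That they are opposite is the reason why the resulting central powers
  of \<open>A\<close> and \<open>B\<close> are inverse to each other.\<close>

lemma alpha_relation_A: "[ap (1 + u) - sg (1 + u) * ap (- 1) = 2 * h\<^sup>2 * l\<^sup>2] (mod 4 * h ^ 3)"
  and alpha_relation_B: "[sg (1 + u) * ap (- (1 + u)) - (1 + u) = - 2 * h\<^sup>2 * l\<^sup>2] (mod 4 * h ^ 3)"
proof -
  obtain z where z: "t3 (1 + u + 1) = h * z" using t3_Suc_alpha by blast
  have t: "t2 (1 + u + 1) = h * l * (1 + u) + 1 + u" using t2_Suc[of "1 + u"] t2_alpha by simp
  have t1: "t2 (- 1) = 1" by (simp add: t2_def)
  have t': "t2 (- (1 + u)) = 1 + 3 * h * l + 2 * h\<^sup>2 * l\<^sup>2"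
    using t2[of "- (1 + u)"] unfolding u_def by Groebner_Basis.algebra
  have "ap (1 + u) - sg (1 + u) * ap (- 1) = 2 * h\<^sup>2 * l\<^sup>2 + 4 * h ^ 3 * (0 - l ^ 3 - 2 * h * l ^ 4 - 4 * h ^ 2 * l ^ 5 - l ^ 2 * z + 2 * h * l ^ 3 * z - 4 * h ^ 2 * l ^ 4 * z)"
    unfolding ap_def sg_def t z t1 t2_alpha unfolding u_def by Groebner_Basis.algebra
  then show "[ap (1 + u) - sg (1 + u) * ap (- 1) = 2 * h\<^sup>2 * l\<^sup>2] (mod 4 * h ^ 3)" by (rule congI)
  have "sg (1 + u) * ap (- (1 + u)) - (1 + u) = - 2 * h\<^sup>2 * l\<^sup>2 + 4 * h ^ 3 * (l ^ 3 + 12 * h * l ^ 4 + 26 * h ^ 2 * l ^ 5 + 24 * h ^ 3 * l ^ 6 + 8 * h ^ 4 * l ^ 7 + l ^ 2 * z - 2 * h * l ^ 3 * z + 12 * h ^ 3 * l ^ 5 * z + 8 * h ^ 4 * l ^ 6 * z)"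
    unfolding ap_def sg_def t z t' unfolding u_def by Groebner_Basis.algebra
  then show "[sg (1 + u) * ap (- (1 + u)) - (1 + u) = - 2 * h\<^sup>2 * l\<^sup>2] (mod 4 * h ^ 3)" by (rule congI)
qed

lemma ap_absorb: "[2 * h\<^sup>2 * x * ap k = 2 * h\<^sup>2 * x] (mod 4 * h ^ 3)"
proof -
  have "2 * h\<^sup>2 * x * ap k = 2 * h\<^sup>2 * x + 4 * h ^ 3 * (x * (l * k + 2 * h * l\<^sup>2 * t2 k))"
    unfolding ap_def u_def by Groebner_Basis.algebra
  then show ?thesis by (rule congI)
qed

lemma coprime_l_power: "coprime l (2 ^ k)"
  using l by (simp add: coprime_commute)

lemma l_inverse: "\<exists>i. [l\<^sup>2 * i = 1] (mod 4 * h ^ 3)"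
proof -
  have "4 * h ^ 3 = 2 ^ (2 + (m - 1) * 3)" unfolding h_def by (simp add: power_add power_mult)
  then have "coprime (l\<^sup>2) (4 * h ^ 3)" using coprime_l_power by (metis coprime_power_left_iff)
  then show ?thesis by (rule cong_solve_coprime_int)
qed

lemma sg_2h2: "[sg (2 * h\<^sup>2) = 2 * h\<^sup>2 + 2 * h ^ 3] (mod 4 * h ^ 3)"
  using sg_shift[of 0 1] by simp

end

section \<open>Normal forms\<close>

lemma (in group) conj_int_pow:
  fixes k :: int
  assumes "x \<in> carrier G" "y \<in> carrier G" "c \<in> carrier G" "x \<otimes> c = c \<otimes> y"
  shows "x [^] k \<otimes> c = c \<otimes> y [^] k"
proof (induction k rule: int_induct[where k = 0])
  case base
  then show ?case using assms by simp
next
  case (step1 i)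
  have "x [^] (i + 1) \<otimes> c = x [^] i \<otimes> (x \<otimes> c)"
    using assms by (simp add: int_pow_mult m_assoc)
  also have "\<dots> = (x [^] i \<otimes> c) \<otimes> y"
    using assms by (simp add: m_assoc)
  also have "\<dots> = c \<otimes> y [^] (i + 1)"
    using assms step1 by (simp add: int_pow_mult m_assoc)
  finally show ?case .
next
  case (step2 i)
  have "x [^] (i - 1) \<otimes> c \<otimes> y = x [^] (i - 1) \<otimes> x \<otimes> c"
    using assms by (simp add: m_assoc)
  also have "\<dots> = x [^] i \<otimes> c"
    using assms int_pow_mult[of x "i - 1" 1] by simp
  also have "\<dots> = c \<otimes> y [^] (i - 1) \<otimes> y"
    using assms step2 int_pow_mult[of y "i - 1" 1] by (simp add: m_assoc)
  finally show ?case using assms by simp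
qed

lemma (in group) int_pow_mult_left:
  "x \<in> carrier G \<Longrightarrow> z \<in> carrier G \<Longrightarrow> x [^] (i::int) \<otimes> (x [^] (j::int) \<otimes> z) = x [^] (i + j) \<otimes> z"
  by (simp add: int_pow_mult m_assoc)

lemma (in group) comm_swap: "a \<in> carrier G \<Longrightarrow> b \<in> carrier G \<Longrightarrow> grp_comm G b a = inv (grp_comm G a b)"
  by (simp add: grp_comm_def inv_mult_group m_assoc)

lemma (in group) mult_comm_eq: "a \<in> carrier G \<Longrightarrow> b \<in> carrier G \<Longrightarrow> b \<otimes> a \<otimes> grp_comm G a b = a \<otimes> b"
  by (simp add: grp_comm_def m_assoc) (simp flip: m_assoc)

lemma (in group) grp_conj_eq_iff:
  "a \<in> carrier G \<Longrightarrow> b \<in> carrier G \<Longrightarrow> z \<in> carrier G \<Longrightarrow> grp_conj G b a = z \<longleftrightarrow> b \<otimes> a = a \<otimes> z"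
  by (metis (no_types, lifting) grp_conj_def inv_closed inv_solve_left m_assoc m_closed)

lemma (in group) comm_unique:
  "a \<in> carrier G \<Longrightarrow> b \<in> carrier G \<Longrightarrow> w \<in> carrier G \<Longrightarrow> b \<otimes> a \<otimes> w = a \<otimes> b \<Longrightarrow> grp_comm G a b = w"
  by (metis grp_comm_closed l_cancel m_closed mult_comm_eq)

text \<open>Only the relations and generation are required, not that \<open>G\<close> is
  \<open>J2\<close> itself: the locale is also used for the interchanged pair and for a quotient of
  \<open>J2\<close>. Faithfulness of the normal form is added later.\<close>

locale macdonald = macdonald_param m l + group G
  for m :: nat and l :: int and G (structure) +
  fixes A B
  assumes pair: "macdonald_pair G m (1 + u) A B"
    and gen: "carrier G = generate G {A, B}"
begin

lemma A_closed [simp]: "A \<in> carrier G" and B_closed [simp]: "B \<in> carrier G"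
  using pair by (auto simp: macdonald_pair_def)

definition C where "C = grp_comm G A B"

lemma C_closed [simp]: "C \<in> carrier G" by (simp add: C_def)

text \<open>The presentation is symmetric because the commutator of \<open>B\<close> and
  \<open>A\<close> is the inverse of \<open>C\<close>. Every lemma of the locale thus has a mirror
  image, with \<open>A\<close> and \<open>B\<close> interchanged and \<open>C\<close>
  inverted.\<close>

lemma swap: "macdonald m l G B A"
  using pair gen by unfold_locales (auto simp: macdonald_pair_def insert_commute)

lemma C_swap: "macdonald.C G B A = inv C"
  using macdonald.C_def[OF swap] comm_swap[of A B] by (simp add: C_def)

lemma AB: "A \<otimes> B = B \<otimes> (A \<otimes> C)"
  using mult_comm_eq[of A B] by (simp add: C_def m_assoc)

lemma AC: "A \<otimes> C = C \<otimes> A [^] (1 + u)"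
  using pair by (simp add: macdonald_pair_def C_def grp_conj_eq_iff)

lemma four_h3: "4 * h ^ 3 = int (2 ^ (3 * m - 1))"
proof -
  have "3 * m - 1 = 2 + (m - 1) * 3" using m by simp
  then show ?thesis by (simp add: h_def power_add power_mult)
qed

lemma A_order: "A [^] (4 * h ^ 3) = \<one>"
  unfolding four_h3 int_pow_int using pair by (simp add: macdonald_pair_def)

lemma A_cong:
  assumes "[i = j] (mod 4 * h ^ 3)" shows "A [^] i = A [^] j"
proof -
  obtain r where "i = j + 4 * h ^ 3 * r" using assms by (metis cong_iff_lin cong_sym)
  then show ?thesis by (simp add: int_pow_mult A_order flip: int_pow_pow)
qed

lemma B_cong: "[i = j] (mod 4 * h ^ 3) \<Longrightarrow> B [^] i = B [^] j"
  by (rule macdonald.A_cong[OF swap])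

lemma A_C1: "A [^] i \<otimes> C = C \<otimes> A [^] (i * (1 + u))"
  using conj_int_pow[OF _ _ _ AC, of i] by (simp add: int_pow_pow mult.commute)

lemma A_C: "A [^] (i::int) \<otimes> C [^] (k::int) = C [^] k \<otimes> A [^] (i * ap k)"
proof (induction k arbitrary: i rule: int_induct[where k = 0])
  case base
  then show ?case by simp
next
  case (step1 k)
  have "A [^] i \<otimes> C [^] (k + 1) = C [^] k \<otimes> (A [^] (i * ap k) \<otimes> C)"
    using step1(2)[of i] by (simp add: int_pow_mult flip: m_assoc)
  also have "\<dots> = C [^] (k + 1) \<otimes> A [^] (i * ap k * (1 + u))"
    by (simp add: A_C1 int_pow_mult m_assoc)
  also have "A [^] (i * ap k * (1 + u)) = A [^] (i * ap (k + 1))"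
    by (intro A_cong) (metis ap_1 ap_add cong_scalar_left cong_sym mult.assoc)
  finally show ?case .
next
  case (step2 k)
  have "[i * ap (k - 1) * (1 + u) = i * ap k] (mod 4 * h ^ 3)"
    using ap_add[of "k - 1" 1] by (metis ap_1 cong_scalar_left cong_sym diff_add_cancel mult.assoc)
  then have "C [^] (k - 1) \<otimes> A [^] (i * ap (k - 1)) \<otimes> C = C [^] (k - 1) \<otimes> C \<otimes> A [^] (i * ap k)"
    by (simp add: m_assoc A_C1 A_cong)
  also have "\<dots> = A [^] i \<otimes> C [^] k"
    using int_pow_mult[of C "k - 1" 1] step2(2)[of i] by simp
  also have "\<dots> = A [^] i \<otimes> C [^] (k - 1) \<otimes> C"
    using int_pow_mult[of C "k - 1" 1] by (simp add: m_assoc)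
  finally show ?case by simp
qed

lemma C_A: "C [^] (k::int) \<otimes> A [^] (i::int) = A [^] (i * ap (- k)) \<otimes> C [^] k"
proof -
  have "[i * ap (- k) * ap k = i] (mod 4 * h ^ 3)"
    using cong_scalar_left[OF ap_neg[of k], of i] by (simp add: mult_ac)
  then show ?thesis using A_C[of "i * ap (- k)" k] A_cong by metis
qed

lemma B_C: "B [^] (i::int) \<otimes> C [^] (k::int) = C [^] k \<otimes> B [^] (i * ap (- k))"
  using macdonald.A_C[OF swap, of i "- k"] by (simp add: C_swap int_pow_neg int_pow_inv)

lemma C_B: "C [^] (k::int) \<otimes> B [^] (i::int) = B [^] (i * ap k) \<otimes> C [^] k"
  using macdonald.C_A[OF swap, of "- k" i] by (simp add: C_swap int_pow_neg int_pow_inv)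

lemma AC_pow: "(A \<otimes> C) [^] (n::int) = C [^] n \<otimes> A [^] sg n"
proof -
  have step: "C [^] k \<otimes> A [^] sg k \<otimes> (A \<otimes> C) = C [^] (k + 1) \<otimes> A [^] sg (k + 1)" for k :: int
  proof -
    have "C [^] k \<otimes> A [^] sg k \<otimes> (A \<otimes> C) = C [^] k \<otimes> (A [^] (sg k + 1) \<otimes> C)"
      by (simp add: int_pow_mult m_assoc)
    also have "\<dots> = C [^] (k + 1) \<otimes> A [^] ((sg k + 1) * (1 + u))"
      by (simp only: A_C1) (simp add: int_pow_mult m_assoc)
    also have "A [^] ((sg k + 1) * (1 + u)) = A [^] sg (k + 1)"
      using sg_Suc[of k] by (intro A_cong) (simp add: cong_sym mult.commute)
    finally show ?thesis .
  qed
  show ?thesis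
  proof (induction n rule: int_induct[where k = 0])
    case base
    then show ?case by simp
  next
    case (step1 i)
    then show ?case using step[of i] by (simp add: int_pow_mult)
  next
    case (step2 i)
    have "(A \<otimes> C) [^] (i - 1) \<otimes> (A \<otimes> C) = C [^] (i - 1) \<otimes> A [^] sg (i - 1) \<otimes> (A \<otimes> C)"
      using step[of "i - 1"] step2 int_pow_mult[of "A \<otimes> C" "i - 1" 1] by simp
    then show ?case by (simp del: m_assoc)
  qed
qed

lemma A_B: "A [^] (n::int) \<otimes> B = B \<otimes> C [^] n \<otimes> A [^] sg n"
  using conj_int_pow[OF _ _ _ AB, of n] by (simp add: AC_pow m_assoc)

lemma B_A: "B [^] (n::int) \<otimes> A = A \<otimes> C [^] (- n) \<otimes> B [^] sg n"
  using macdonald.A_B[OF swap, of n] by (simp add: C_swap int_pow_neg int_pow_inv)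

text \<open>With \<open>\<alpha> = 1 + u\<close>, moving \<open>C\<close> through the product of
  \<open>A\<close>, \<open>B ^ \<alpha>\<close> and \<open>C\<close> shows that \<open>A\<close>
  times \<open>B ^ \<alpha>\<close> is \<open>B ^ \<alpha>\<close> times \<open>C ^ \<alpha>\<close>
  times \<open>A ^ y\<close>. The opposite product is known independently from \<open>B_A\<close>,
  and the comparison leaves a power of \<open>A\<close> equal to a power of
  \<open>B\<close>.\<close>

lemma A_B_relation: "A [^] (2 * h\<^sup>2 * l\<^sup>2) = B [^] (- 2 * h\<^sup>2 * l\<^sup>2)"
proof -
  let ?\<alpha> = "1 + u"
  define y where "y = sg ?\<alpha> * ap (- 1)"
  have CB: "C \<otimes> B = B [^] ?\<alpha> \<otimes> C" using C_B[of 1 1] by (simp add: ap_1)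
  have "A \<otimes> B [^] ?\<alpha> \<otimes> C = A \<otimes> C \<otimes> B" using CB by (simp add: m_assoc)
  also have "\<dots> = C \<otimes> (A [^] ?\<alpha> \<otimes> B)" by (simp add: AC m_assoc)
  also have "\<dots> = C \<otimes> B \<otimes> C [^] ?\<alpha> \<otimes> A [^] sg ?\<alpha>" by (simp add: A_B m_assoc)
  also have "\<dots> = B [^] ?\<alpha> \<otimes> C [^] (?\<alpha> + 1) \<otimes> A [^] sg ?\<alpha>"
    using CB int_pow_mult[of C 1 ?\<alpha>] by (simp add: m_assoc add.commute)
  also have "\<dots> = B [^] ?\<alpha> \<otimes> (C [^] ?\<alpha> \<otimes> (C [^] (1::int) \<otimes> A [^] sg ?\<alpha>))"
    using int_pow_mult[of C ?\<alpha> 1] by (simp add: m_assoc)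
  also have "\<dots> = B [^] ?\<alpha> \<otimes> C [^] ?\<alpha> \<otimes> A [^] y \<otimes> C"
    unfolding C_A y_def by (simp add: m_assoc)
  finally have 1: "A \<otimes> B [^] ?\<alpha> = B [^] ?\<alpha> \<otimes> (C [^] ?\<alpha> \<otimes> A [^] y)" by (simp add: m_assoc[symmetric])
  have "A \<otimes> B [^] ?\<alpha> \<otimes> A [^] (- y) \<otimes> C [^] (- ?\<alpha>) = B [^] ?\<alpha>"
    unfolding 1 by (simp add: int_pow_neg m_assoc del: minus_add_distrib)
  \<comment> \<open>Appending \<open>A\<close> makes the right-hand side a product to which
    \<open>B_A\<close> applies. Then the leading \<open>A\<close> cancels, and so does the power of
    \<open>C\<close> once it has been moved to the right end of both sides.\<close>
  then have "A \<otimes> B [^] ?\<alpha> \<otimes> A [^] (- y) \<otimes> C [^] (- ?\<alpha>) \<otimes> A = A \<otimes> C [^] (- ?\<alpha>) \<otimes> B [^] sg ?\<alpha>"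
    using B_A[of ?\<alpha>] by simp
  then have 2: "B [^] ?\<alpha> \<otimes> A [^] (- y) \<otimes> (C [^] (- ?\<alpha>) \<otimes> A [^] (1::int)) = C [^] (- ?\<alpha>) \<otimes> B [^] sg ?\<alpha>"
    by (simp add: m_assoc)
  then have "B [^] ?\<alpha> \<otimes> A [^] (ap ?\<alpha> - y) \<otimes> C [^] (- ?\<alpha>) = B [^] (sg ?\<alpha> * ap (- ?\<alpha>)) \<otimes> C [^] (- ?\<alpha>)"
    unfolding C_A C_B by (simp add: int_pow_mult_left m_assoc del: minus_add_distrib)
  then have "B [^] ?\<alpha> \<otimes> A [^] (ap ?\<alpha> - y) = B [^] (sg ?\<alpha> * ap (- ?\<alpha>))"
    by simp
  then have "A [^] (ap ?\<alpha> - y) = B [^] (- ?\<alpha>) \<otimes> B [^] (sg ?\<alpha> * ap (- ?\<alpha>))"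
    by (metis A_closed B_closed int_pow_closed int_pow_neg inv_solve_left)
  also have "\<dots> = B [^] (sg ?\<alpha> * ap (- ?\<alpha>) - ?\<alpha>)"
    by (simp add: int_pow_mult[symmetric] del: minus_add_distrib)
  also have "\<dots> = B [^] (- 2 * h\<^sup>2 * l\<^sup>2)" by (rule B_cong) (rule alpha_relation_B)
  also have "A [^] (ap ?\<alpha> - y) = A [^] (2 * h\<^sup>2 * l\<^sup>2)"
    unfolding y_def by (rule A_cong) (rule alpha_relation_A)
  finally show ?thesis .
qed

lemma B_2h2: "B [^] (2 * h\<^sup>2 * r) = A [^] (- 2 * h\<^sup>2 * r)"
proof -
  obtain i where i: "[l\<^sup>2 * i = 1] (mod 4 * h ^ 3)" using l_inverse by blast
  have *: "[2 * h\<^sup>2 * l\<^sup>2 * (i * s) = 2 * h\<^sup>2 * s] (mod 4 * h ^ 3)" for s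
    using cong_scalar_left[OF i, of "2 * h\<^sup>2 * s"] by (simp add: mult_ac)
  have "A [^] (2 * h\<^sup>2 * l\<^sup>2 * (i * - r)) = B [^] (- 2 * h\<^sup>2 * l\<^sup>2 * (i * - r))"
    using A_B_relation by (metis A_closed B_closed int_pow_pow)
  moreover have "A [^] (2 * h\<^sup>2 * l\<^sup>2 * (i * - r)) = A [^] (- 2 * h\<^sup>2 * r)"
    using *[of "- r"] by (intro A_cong) simp
  moreover have "B [^] (- 2 * h\<^sup>2 * l\<^sup>2 * (i * - r)) = B [^] (2 * h\<^sup>2 * r)"
    using *[of r] by (intro B_cong) simp
  ultimately show ?thesis by simp
qed

lemma generate_induct_centralizer:
  assumes "z \<in> carrier G" "z \<otimes> A = A \<otimes> z" "z \<otimes> B = B \<otimes> z" "g \<in> carrier G"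
  shows "z \<otimes> g = g \<otimes> z"
proof -
  have "g \<in> generate G {A, B}" using assms(4) gen by simp
  then show ?thesis
  proof induction
    case (inv x)
    then show ?case using assms
      by (metis A_closed B_closed insertE inv_closed inv_solve_left inv_solve_right m_assoc m_closed singletonD)
  next
    case (eng x y)
    then have "x \<in> carrier G" "y \<in> carrier G" using gen by auto
    then show ?case using eng assms(1) by (metis m_assoc)
  qed (use assms in auto)
qed

text \<open>The element is a power of \<open>A\<close> and, by \<open>B_2h2\<close>, also a power of
  \<open>B\<close>, so it commutes with both generators.\<close>

lemma A_2h2_central:
  assumes "g \<in> carrier G" shows "A [^] (2 * h\<^sup>2 * r) \<otimes> g = g \<otimes> A [^] (2 * h\<^sup>2 * r)"
proof (rule generate_induct_centralizer[OF _ _ _ assms])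
  show "A [^] (2 * h\<^sup>2 * r) \<otimes> A = A \<otimes> A [^] (2 * h\<^sup>2 * r)"
    using int_pow_mult[of A "2 * h\<^sup>2 * r" 1] int_pow_mult[of A 1 "2 * h\<^sup>2 * r"] by (simp add: add.commute)
  have "A [^] (2 * h\<^sup>2 * r) = B [^] (2 * h\<^sup>2 * - r)" using B_2h2[of "- r"] by simp
  then show "A [^] (2 * h\<^sup>2 * r) \<otimes> B = B \<otimes> A [^] (2 * h\<^sup>2 * r)"
    using int_pow_mult[of B "2 * h\<^sup>2 * - r" 1] int_pow_mult[of B 1 "2 * h\<^sup>2 * - r"] by (simp add: add.commute)
qed simp

text \<open>\<open>A_B\<close> describes how the power of \<open>A\<close> with exponent
  \<open>2 * h\<^sup>2\<close> passes \<open>B\<close>. As this power is central, \<open>C\<close>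
  must compensate the discrepancy \<open>2 * h ^ 3\<close> between \<open>sg (2 * h\<^sup>2)\<close>
  and \<open>2 * h\<^sup>2\<close>.\<close>

lemma C_2h2: "C [^] (2 * h\<^sup>2 * r) = A [^] (2 * h ^ 3 * r)"
proof -
  have "B \<otimes> (C [^] (2 * h\<^sup>2) \<otimes> A [^] sg (2 * h\<^sup>2)) = B \<otimes> A [^] (2 * h\<^sup>2)"
    using A_B[of "2 * h\<^sup>2"] A_2h2_central[of B 1] by (simp add: m_assoc)
  then have "C [^] (2 * h\<^sup>2) \<otimes> A [^] sg (2 * h\<^sup>2) = A [^] (2 * h\<^sup>2)" by simp
  then have "C [^] (2 * h\<^sup>2) = A [^] (2 * h\<^sup>2) \<otimes> A [^] (- sg (2 * h\<^sup>2))"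
    by (metis A_closed C_closed int_pow_closed int_pow_neg inv_solve_right)
  also have "\<dots> = A [^] (2 * h ^ 3)"
  proof -
    have "[2 * h\<^sup>2 - sg (2 * h\<^sup>2) = 2 * h\<^sup>2 - (2 * h\<^sup>2 + 2 * h ^ 3)] (mod 4 * h ^ 3)"
      by (intro cong_diff cong_refl sg_2h2)
    moreover have "[2 * h\<^sup>2 - (2 * h\<^sup>2 + 2 * h ^ 3) = 2 * h ^ 3] (mod 4 * h ^ 3)"
      by (rule congI[of _ _ _ "- 1"]) simp
    ultimately have "A [^] (2 * h\<^sup>2 - sg (2 * h\<^sup>2)) = A [^] (2 * h ^ 3)"
      by (intro A_cong) (rule cong_trans)
    then show ?thesis by (simp add: int_pow_mult[symmetric])
  qed
  finally show ?thesis by (simp flip: int_pow_pow)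
qed

lemma C_cong:
  assumes "[i = j] (mod 4 * h\<^sup>2)" shows "C [^] i = C [^] j"
proof -
  obtain r where "i = j + 4 * h\<^sup>2 * r" using assms by (metis cong_iff_lin cong_sym)
  then have r: "i = j + 2 * h\<^sup>2 * (2 * r)" by simp
  have "C [^] (2 * h\<^sup>2 * (2 * r)) = A [^] (4 * h ^ 3 * r)" unfolding C_2h2 by (simp add: mult_ac)
  then show ?thesis unfolding r by (simp add: int_pow_mult A_order flip: int_pow_pow)
qed

definition nf :: "int \<Rightarrow> int \<Rightarrow> int \<Rightarrow> 'a" where
  "nf a c b = A [^] a \<otimes> C [^] c \<otimes> B [^] b"

lemma nf_closed [simp]: "nf a c b \<in> carrier G" by (simp add: nf_def)

lemma nf_0 [simp]: "nf 0 0 0 = \<one>" by (simp add: nf_def)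

lemma nf_cong:
  assumes "[a = a'] (mod 4 * h ^ 3)" "[c = c'] (mod 4 * h\<^sup>2)" "[b = b'] (mod 4 * h ^ 3)"
  shows "nf a c b = nf a' c' b'"
  unfolding nf_def using A_cong[OF assms(1)] C_cong[OF assms(2)] B_cong[OF assms(3)] by simp

lemma A_nf: "A [^] x \<otimes> nf a c b = nf (x + a) c b"
  by (simp add: nf_def int_pow_mult m_assoc)

lemma nf_B: "nf a c b \<otimes> B [^] y = nf a c (b + y)"
  by (simp add: nf_def int_pow_mult m_assoc)

lemma nf_C: "nf a c b \<otimes> C [^] y = nf a (c + y) (b * ap (- y))"
  by (simp add: nf_def int_pow_mult m_assoc B_C)

lemma C_nf: "C [^] y \<otimes> nf a c b = nf (a * ap (- y)) (y + c) b"
  by (simp add: nf_def int_pow_mult C_A flip: m_assoc)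

lemma nf_A: "nf a c b \<otimes> A = nf (a + ap (- c)) (c - b) (sg b)"
proof -
  have "nf a c b \<otimes> A = A [^] a \<otimes> (C [^] c \<otimes> A [^] (1::int)) \<otimes> (C [^] (- b) \<otimes> B [^] sg b)"
    using B_A[of b] by (simp add: nf_def m_assoc)
  also have "\<dots> = nf (a + ap (- c)) (c + - b) (sg b)"
    unfolding C_A nf_def by (simp add: int_pow_mult_left m_assoc)
  finally show ?thesis by simp
qed

lemma B_A_pow: "B [^] b \<otimes> A [^] n = nf (an b n) (- Sn b n) (bn b n)" for b n :: int
proof -
  have step: "nf (an b k) (- Sn b k) (bn b k) \<otimes> A = nf (an b (k + 1)) (- Sn b (k + 1)) (bn b (k + 1))" for k
    unfolding nf_A using an_Suc[of b k] Sn_Suc[of b k] bn_Suc[of b k]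
    by (intro nf_cong) (auto simp: cong_sym cong_minus_minus_iff[symmetric, of "- Sn b k - bn b k"] add.commute)
  show ?thesis
  proof (induction n rule: int_induct[where k = 0])
    case base
    then show ?case by (simp add: nf_def)
  next
    case (step1 i)
    then show ?case using step[of i] by (simp add: int_pow_mult flip: m_assoc)
  next
    case (step2 i)
    have "B [^] b \<otimes> A [^] (i - 1) \<otimes> A = nf (an b (i - 1)) (- Sn b (i - 1)) (bn b (i - 1)) \<otimes> A"
      using step[of "i - 1"] step2 int_pow_mult[of A "i - 1" 1] by (simp add: m_assoc)
    then show ?case by simp
  qed
qed

lemma nf_mult: "nf a c b \<otimes> nf a' c' b' =
  nf (a + an b a' * ap (- c)) (c - Sn b a' + c') (bn b a' * ap (- c') + b')"
proof -
  have "nf a c b \<otimes> nf a' c' b' = A [^] a \<otimes> (C [^] c \<otimes> (B [^] b \<otimes> A [^] a') \<otimes> C [^] c') \<otimes> B [^] b'"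
    by (simp add: nf_def m_assoc)
  also have "\<dots> = nf (a + an b a' * ap (- c)) (c - Sn b a' + c') (bn b a' * ap (- c') + b')"
    unfolding B_A_pow C_nf nf_C A_nf nf_B by simp
  finally show ?thesis .
qed

text \<open>Multiples of \<open>2 * h\<^sup>2\<close> in the exponents of \<open>B\<close> and
  \<open>C\<close> turn into central powers of \<open>A\<close> by \<open>B_2h2\<close> and
  \<open>C_2h2\<close>; the combination \<open>a - b + h * c\<close> is what these exchanges leave
  unchanged.\<close>

lemma nf_eqI:
  assumes "[b = b'] (mod 2 * h\<^sup>2)" "[c = c'] (mod 2 * h\<^sup>2)"
    and "[a - b + h * c = a' - b' + h * c'] (mod 4 * h ^ 3)"
  shows "nf a c b = nf a' c' b'"
proof -
  obtain r where r: "b = b' + 2 * h\<^sup>2 * r" using assms(1) by (metis cong_iff_lin cong_sym)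
  obtain s where s: "c = c' + 2 * h\<^sup>2 * s" using assms(2) by (metis cong_iff_lin cong_sym)
  have "nf a c b = A [^] a \<otimes> (C [^] c' \<otimes> A [^] (2 * h ^ 3 * s)) \<otimes> (B [^] b' \<otimes> A [^] (- 2 * h\<^sup>2 * r))"
    unfolding nf_def r s by (simp only: int_pow_mult[OF B_closed] int_pow_mult[OF C_closed] B_2h2 C_2h2)
  also have "2 * h ^ 3 * s = 2 * h\<^sup>2 * (h * s)" by (simp add: power2_eq_square power3_eq_cube)
  also have "C [^] c' \<otimes> A [^] (2 * h\<^sup>2 * (h * s)) = A [^] (2 * h\<^sup>2 * (h * s)) \<otimes> C [^] c'"
    by (simp add: A_2h2_central)
  also have "A [^] a \<otimes> (A [^] (2 * h\<^sup>2 * (h * s)) \<otimes> C [^] c') \<otimes> (B [^] b' \<otimes> A [^] (- 2 * h\<^sup>2 * r))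
     = (A [^] a \<otimes> A [^] (2 * h\<^sup>2 * (h * s)) \<otimes> C [^] c' \<otimes> B [^] b') \<otimes> A [^] (2 * h\<^sup>2 * - r)"
    by (simp add: m_assoc)
  also have "\<dots> = A [^] (2 * h\<^sup>2 * - r) \<otimes> (A [^] a \<otimes> A [^] (2 * h\<^sup>2 * (h * s)) \<otimes> C [^] c' \<otimes> B [^] b')"
    by (rule A_2h2_central[symmetric]) simp
  also have "\<dots> = nf (- 2 * h\<^sup>2 * r + a + 2 * h\<^sup>2 * (h * s)) c' b'"
    by (simp add: nf_def int_pow_mult_left m_assoc) (simp add: algebra_simps)
  also have "\<dots> = nf a' c' b'"
  proof (intro nf_cong cong_refl)
    have "- 2 * h\<^sup>2 * r + a + 2 * h\<^sup>2 * (h * s) = (a - b + h * c) + b' - h * c'"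
      unfolding r s by (simp add: algebra_simps power2_eq_square)
    moreover have "a' = (a' - b' + h * c') + b' - h * c'" by simp
    ultimately show "[- 2 * h\<^sup>2 * r + a + 2 * h\<^sup>2 * (h * s) = a'] (mod 4 * h ^ 3)"
      using assms(3) by (metis cong_add cong_diff cong_refl)
  qed
  finally show ?thesis .
qed

lemma nf_surj:
  assumes "g \<in> carrier G"
  obtains a c b where "g = nf a c b"
proof -
  let ?S = "{nf a c b | a c b. True}"
  have A: "s \<otimes> A \<in> ?S" if "s \<in> ?S" for s using that nf_A by blast
  have B: "s \<otimes> B \<in> ?S" if "s \<in> ?S" for s
    using that nf_B[of _ _ _ 1] by fastforce
  have pw: "s \<otimes> x [^] (n::nat) \<in> ?S" if "s \<in> ?S" "\<And>s. s \<in> ?S \<Longrightarrow> s \<otimes> x \<in> ?S" "x \<in> carrier G" for s x n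
  proof (induction n)
    case 0
    have "s \<in> carrier G" using that(1) by auto
    then show ?case using that by simp
  next
    case (Suc n)
    have "s \<in> carrier G" using that(1) by auto
    then have "s \<otimes> x [^] Suc n = s \<otimes> x [^] n \<otimes> x" using that by (simp add: m_assoc)
    then show ?case using that(2)[OF Suc] by (simp only:)
  qed
  \<comment> \<open>Right multiplication by \<open>A\<close> and \<open>B\<close> is known to
    preserve the set of normal forms; since both have finite order, their inverses are reached
    through positive powers.\<close>
  have inv_pow: "inv x = x [^] (nat (4 * h ^ 3 - 1))" if "x \<in> carrier G" "x [^] (4 * h ^ 3) = \<one>" for x
  proof -
    have "4 * h ^ 3 > 0" using h_pos by simp
    then have "int (nat (4 * h ^ 3 - 1)) = 4 * h ^ 3 - 1" by linarith
    then have "x [^] (nat (4 * h ^ 3 - 1)) = x [^] (4 * h ^ 3 - 1)"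
      by (metis int_pow_int)
    also have "\<dots> = inv x" using that int_pow_diff[of x "4 * h ^ 3" 1] by simp
    finally show ?thesis by simp
  qed
  have "g \<in> generate G {A, B}" using assms gen by simp
  then have "\<forall>s \<in> ?S. s \<otimes> g \<in> ?S"
  proof induction
    case one
    have "s \<otimes> \<one> = s" if "s \<in> ?S" for s using that by auto
    then show ?case by (simp only: Ball_def) blast
  next
    case (incl x)
    then show ?case using A B by blast
  next
    case (inv x)
    have x: "x \<in> carrier G" "x [^] (4 * h ^ 3) = \<one>"
      using inv A_order macdonald.A_order[OF swap] by auto
    have xS: "s \<otimes> x \<in> ?S" if "s \<in> ?S" for s using inv A B that by blast
    show ?case
    proof
      fix s assume "s \<in> ?S"
      then have "s \<otimes> x [^] (nat (4 * h ^ 3 - 1)) \<in> ?S" by (rule pw[OF _ xS x(1)])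
      then show "s \<otimes> inv x \<in> ?S" using inv_pow[OF x] by (simp only:)
    qed
  next
    case (eng x y)
    then have xy: "x \<in> carrier G" "y \<in> carrier G" using gen by auto
    show ?case
    proof
      fix s assume s: "s \<in> ?S"
      then have "s \<in> carrier G" by auto
      then have "s \<otimes> (x \<otimes> y) = s \<otimes> x \<otimes> y" using xy by (simp add: m_assoc)
      then show "s \<otimes> (x \<otimes> y) \<in> ?S" using eng s by simp
    qed
  qed
  moreover have "\<one> \<in> ?S" using nf_0 by (metis (mono_tags, lifting) mem_Collect_eq)
  ultimately have "\<one> \<otimes> g \<in> ?S" by blast
  then show thesis using that assms by auto
qed

end

section \<open>Faithfulness of the normal form\<close>

lemma (in group) mult_inv_swap:
  assumes "c \<in> carrier G" "b \<in> carrier G" "b' \<in> carrier G" "c \<otimes> b = b' \<otimes> c"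
  shows "b \<otimes> inv c = inv c \<otimes> b'"
proof -
  have "inv c \<otimes> (c \<otimes> b) \<otimes> inv c = inv c \<otimes> (b' \<otimes> c) \<otimes> inv c" using assms(4) by (simp only:)
  moreover have "inv c \<otimes> (c \<otimes> b) \<otimes> inv c = b \<otimes> inv c" using assms(1-3) by (simp flip: m_assoc)
  moreover have "inv c \<otimes> (b' \<otimes> c) \<otimes> inv c = inv c \<otimes> b'" using assms(1-3) by (simp add: m_assoc)
  ultimately show ?thesis by (simp only:)
qed

text \<open>Permutations composed from left to right, so that a right action is a homomorphism.\<close>

definition perm_group :: "'a set \<Rightarrow> ('a \<Rightarrow> 'a) monoid" where
  "perm_group S = \<lparr>carrier = {p. p permutes S}, monoid.mult = (\<lambda>p q. q \<circ> p), one = id\<rparr>"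

lemma perm_group_mult: "p \<otimes>\<^bsub>perm_group S\<^esub> q = q \<circ> p"
  and perm_group_one: "\<one>\<^bsub>perm_group S\<^esub> = id"
  and perm_group_carrier: "p \<in> carrier (perm_group S) \<longleftrightarrow> p permutes S"
  by (simp_all add: perm_group_def)

lemma group_perm_group: "group (perm_group S)"
proof (rule groupI)
  fix p assume "p \<in> carrier (perm_group S)"
  then have "p permutes S" by (simp add: perm_group_carrier)
  then show "\<exists>q \<in> carrier (perm_group S). q \<otimes>\<^bsub>perm_group S\<^esub> p = \<one>\<^bsub>perm_group S\<^esub>"
    by (intro bexI[of _ "inv_into UNIV p"])
      (auto simp: perm_group_carrier perm_group_mult perm_group_one permutes_inv permutes_inv_o)
qed (auto simp: perm_group_carrier perm_group_mult perm_group_one permutes_id permutes_compose comp_assoc)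

context macdonald_param
begin

text \<open>
  The triple \<open>(a, c, b)\<close> stands for \<open>A\<^sup>a C\<^sup>c B\<^sup>b\<close>; two triples have the same key if and only if the
  relations \<open>B ^ (2 * h\<^sup>2) = A ^ (- 2 * h\<^sup>2)\<close>, \<open>C ^ (2 * h\<^sup>2) = A ^ (2 * h ^ 3)\<close> and
  \<open>A ^ (4 * h ^ 3) = 1\<close> identify them.
\<close>

fun key :: "int \<times> int \<times> int \<Rightarrow> int \<times> int \<times> int" where
  "key (a, c, b) = ((a - b + h * c) mod (4 * h ^ 3), c mod (2 * h\<^sup>2), b mod (2 * h\<^sup>2))"

declare key.simps [simp del]

fun rep :: "int \<times> int \<times> int \<Rightarrow> int \<times> int \<times> int" where
  "rep (k, c, b) = (k + b - h * c, c, b)"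

text \<open>Transports a map on triples to the finite set of keys through the representative
  \<open>rep\<close>. Outside the keys it is the identity, as \<open>permutes\<close>
  demands.\<close>

definition keyed :: "(int \<times> int \<times> int \<Rightarrow> int \<times> int \<times> int) \<Rightarrow> int \<times> int \<times> int \<Rightarrow> int \<times> int \<times> int" where
  "keyed f w = (if w \<in> range key then key (f (rep w)) else w)"

lemma key_eq_iff: "key (a, c, b) = key (a', c', b') \<longleftrightarrow>
    [b = b'] (mod 2 * h\<^sup>2) \<and> [c = c'] (mod 2 * h\<^sup>2) \<and> [a - b + h * c = a' - b' + h * c'] (mod 4 * h ^ 3)"
  by (auto simp: key.simps cong_def)

lemma key_congI:
  assumes "[a = a'] (mod 4 * h ^ 3)" "[c = c'] (mod 4 * h\<^sup>2)" "[b = b'] (mod 4 * h ^ 3)"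
  shows "key (a, c, b) = key (a', c', b')"
proof -
  obtain x where x: "a = a' + 4 * h ^ 3 * x" using assms(1) by (metis cong_iff_lin cong_sym)
  obtain y where y: "c = c' + 4 * h\<^sup>2 * y" using assms(2) by (metis cong_iff_lin cong_sym)
  obtain z where z: "b = b' + 4 * h ^ 3 * z" using assms(3) by (metis cong_iff_lin cong_sym)
  have "[b = b'] (mod 2 * h\<^sup>2)" unfolding z
    by (rule congI[where k = "2 * h * z"]) Groebner_Basis.algebra
  moreover have "[c = c'] (mod 2 * h\<^sup>2)" unfolding y
    by (rule congI[where k = "2 * y"]) Groebner_Basis.algebra
  moreover have "[a - b + h * c = a' - b' + h * c'] (mod 4 * h ^ 3)" unfolding x y z
    by (rule congI[where k = "x - z + y"]) Groebner_Basis.algebra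
  ultimately show ?thesis unfolding key_eq_iff by blast
qed

lemma key_rep: "key (rep (key x)) = key x"
  by (cases x) (simp add: key.simps)

lemma finite_range_key: "finite (range key)"
proof (rule finite_subset)
  show "range key \<subseteq> {0..<4 * h ^ 3} \<times> {0..<2 * h\<^sup>2} \<times> {0..<2 * h\<^sup>2}"
    using h_pos by (auto simp: key.simps)
qed simp

definition respects_key :: "(int \<times> int \<times> int \<Rightarrow> int \<times> int \<times> int) \<Rightarrow> bool" where
  "respects_key f \<longleftrightarrow> (\<forall>x y. key x = key y \<longrightarrow> key (f x) = key (f y))"

lemma keyed_key: "respects_key f \<Longrightarrow> keyed f (key x) = key (f x)"
  by (metis key_rep keyed_def rangeI respects_key_def)

text \<open>A right inverse up to keys makes the induced map surjective, and a surjective map of a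
  finite set onto itself is injective.\<close>

lemma keyed_permutes:
  assumes "respects_key f" "\<And>x. key (f (g x)) = key x"
  shows "keyed f permutes range key"
proof (rule bij_imp_permutes)
  have "keyed f ` range key = range key"
  proof
    show "keyed f ` range key \<subseteq> range key" unfolding image_subset_iff using keyed_key[OF assms(1)] by blast
    show "range key \<subseteq> keyed f ` range key"
      by (metis assms keyed_key image_eqI image_subsetI rangeI)
  qed
  then show "bij_betw (keyed f) (range key) (range key)"
    unfolding bij_betw_def using finite_range_key by (simp add: eq_card_imp_inj_on)
qed (simp add: keyed_def)

lemma perm_eqI:
  assumes "p permutes range key" "q permutes range key" "\<And>x. p (key x) = q (key x)"
  shows "p = q"
proof
  fix w show "p w = q w"
  proof (cases "w \<in> range key")
    case True
    then obtain x where "w = key x" by blast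
    then show ?thesis by (simp only: assms(3))
  next
    case False
    then show ?thesis using permutes_not_in[OF assms(1)] permutes_not_in[OF assms(2)] by simp
  qed
qed

abbreviation PG :: "(int \<times> int \<times> int \<Rightarrow> int \<times> int \<times> int) monoid" where
  "PG \<equiv> perm_group (range key)"

lemma keyed_pow:
  fixes n :: int
  assumes f: "respects_key f" "keyed f permutes range key"
    and F: "\<And>x. F 0 x = x" "\<And>k x. key (f (F k x)) = key (F (k + 1) x)"
  shows "(keyed f [^]\<^bsub>PG\<^esub> n) (key x) = key (F n x)"
proof -
  interpret group PG by (rule group_perm_group)
  have c: "keyed f \<in> carrier PG" using f by (simp add: perm_group_carrier)
  have step: "(keyed f [^]\<^bsub>PG\<^esub> (k + 1)) w = keyed f ((keyed f [^]\<^bsub>PG\<^esub> k) w)" for k :: int and w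
    using c int_pow_mult[OF c, of k 1] by (simp add: perm_group_mult)
  show ?thesis
  proof (induction n rule: int_induct[where k = 0])
    case base
    then show ?case by (simp add: perm_group_one F)
  next
    case (step1 i)
    then show ?case by (simp add: step keyed_key[OF f(1)] F)
  next
    case (step2 i)
    have "keyed f ((keyed f [^]\<^bsub>PG\<^esub> (i - 1)) (key x)) = keyed f (key (F (i - 1) x))"
      using step[of "i - 1"] step2 F(2)[of "i - 1" x] by (simp add: keyed_key[OF f(1)])
    then show ?case using f(2) by (metis permutes_inverses(2))
  qed
qed

text \<open>The maps \<open>act_A\<close>, \<open>act_A_pow\<close>, \<open>act_B\<close> and
  \<open>act_C\<close> are the right multiplications that \<open>nf_A\<close>,
  \<open>nf_mult\<close>, \<open>nf_B\<close> and \<open>nf_C\<close> predict. Here they are taken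
  as definitions, and the relations have to be verified for them.\<close>

fun act_A :: "int \<times> int \<times> int \<Rightarrow> int \<times> int \<times> int" where
  "act_A (a, c, b) = (a + ap (- c), c - b, sg b)"

fun act_A_pow :: "int \<Rightarrow> int \<times> int \<times> int \<Rightarrow> int \<times> int \<times> int" where
  "act_A_pow n (a, c, b) = (a + an b n * ap (- c), c - Sn b n, bn b n)"

fun act_B :: "int \<Rightarrow> int \<times> int \<times> int \<Rightarrow> int \<times> int \<times> int" where
  "act_B n (a, c, b) = (a, c, b + n)"

fun act_C :: "int \<Rightarrow> int \<times> int \<times> int \<Rightarrow> int \<times> int \<times> int" where
  "act_C n (a, c, b) = (a, c + n, b * ap (- n))"

lemma respects_key_act_A: "respects_key act_A"
  unfolding respects_key_def
proof (intro allI impI)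
  fix x y :: "int \<times> int \<times> int"
  obtain a c b a' c' b' where xy: "x = (a, c, b)" "y = (a', c', b')" by (metis prod_cases3)
  assume "key x = key y"
  then have e: "[b = b'] (mod 2 * h\<^sup>2)" "[c = c'] (mod 2 * h\<^sup>2)"
    "[a - b + h * c = a' - b' + h * c'] (mod 4 * h ^ 3)" unfolding xy key_eq_iff by auto
  obtain r where r: "b = b' + 2 * h\<^sup>2 * r" using e(1) by (metis cong_iff_lin cong_sym)
  obtain s where s: "c = c' + 2 * h\<^sup>2 * s" using e(2) by (metis cong_iff_lin cong_sym)
  obtain k where k: "a - b + h * c = a' - b' + h * c' + 4 * h ^ 3 * k" using e(3) by (metis cong_iff_lin cong_sym)
  obtain z where z: "sg b = sg b' + 2 * h\<^sup>2 * r + 2 * h ^ 3 * r + 4 * h ^ 3 * z"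
    using sg_shift[of b' r] unfolding r by (metis cong_iff_lin cong_sym)
  have "[- c = - c'] (mod 2 * h\<^sup>2)" using e(2) by (simp add: cong_minus_minus_iff)
  then obtain v where v: "ap (- c) = ap (- c') + 4 * h ^ 3 * v" using ap_cong by (metis cong_iff_lin cong_sym)
  have "[sg b = sg b'] (mod 2 * h\<^sup>2)" unfolding z
    by (rule congI[where k = "r + h * r + 2 * h * z"]) Groebner_Basis.algebra
  moreover have "[c - b = c' - b'] (mod 2 * h\<^sup>2)" using e by (intro cong_diff)
  \<comment> \<open>The surplus \<open>2 * h ^ 3 * r\<close> from \<open>sg_shift\<close> meets an
    equal contribution of \<open>h * (c - b)\<close>; together they give a multiple of
    \<open>4 * h ^ 3\<close>, whence the summand \<open>- r\<close> of the witness.\<close>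
  moreover have "[a + ap (- c) - sg b + h * (c - b) = a' + ap (- c') - sg b' + h * (c' - b')] (mod 4 * h ^ 3)"
    unfolding v z
    by (rule congI[where k = "k + v - z - r"]) (use k r s in Groebner_Basis.algebra)
  ultimately show "key (act_A x) = key (act_A y)" unfolding xy act_A.simps key_eq_iff by blast
qed

lemma act_A_pow_Suc: "key (act_A (act_A_pow n x)) = key (act_A_pow (n + 1) x)"
proof -
  obtain a c b where x: "x = (a, c, b)" by (metis prod_cases3)
  have "[an b n * ap (- c) + ap (- (c - Sn b n)) = an b n * ap (- c) + ap (Sn b n) * ap (- c)] (mod 4 * h ^ 3)"
    using ap_add[of "Sn b n" "- c"] by (intro cong_add cong_refl) simp
  also have "an b n * ap (- c) + ap (Sn b n) * ap (- c) = (an b n + ap (Sn b n)) * ap (- c)"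
    by (simp add: algebra_simps)
  also have "[\<dots> = an b (n + 1) * ap (- c)] (mod 4 * h ^ 3)"
    by (intro cong_scalar_right cong_sym[OF an_Suc])
  finally have 1: "[a + an b n * ap (- c) + ap (- (c - Sn b n)) = a + an b (n + 1) * ap (- c)] (mod 4 * h ^ 3)"
    by (simp add: add.assoc cong_add_lcancel)
  have "[c - (Sn b n + bn b n) = c - Sn b (n + 1)] (mod 4 * h\<^sup>2)"
    by (intro cong_diff cong_refl cong_sym[OF Sn_Suc])
  then have 2: "[c - Sn b n - bn b n = c - Sn b (n + 1)] (mod 4 * h\<^sup>2)" by (simp add: algebra_simps)
  show ?thesis unfolding x act_A_pow.simps act_A.simps
    by (intro key_congI 1 2 cong_sym[OF bn_Suc])
qed

lemma act_A_pow_0: "act_A_pow 0 x = x"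
  by (cases x) simp

lemma respects_key_act_B: "respects_key (act_B n)"
  unfolding respects_key_def
proof (intro allI impI)
  fix x y :: "int \<times> int \<times> int"
  obtain a c b a' c' b' where xy: "x = (a, c, b)" "y = (a', c', b')" by (metis prod_cases3)
  assume "key x = key y"
  then have e: "[b = b'] (mod 2 * h\<^sup>2)" "[c = c'] (mod 2 * h\<^sup>2)"
    "[a - b + h * c = a' - b' + h * c'] (mod 4 * h ^ 3)" unfolding xy key_eq_iff by auto
  have "[a - b + h * c - n = a' - b' + h * c' - n] (mod 4 * h ^ 3)" by (intro cong_diff e cong_refl)
  then have "[a - (b + n) + h * c = a' - (b' + n) + h * c'] (mod 4 * h ^ 3)" by (simp only: diff_add_eq diff_diff_add)
  moreover have "[b + n = b' + n] (mod 2 * h\<^sup>2)" by (intro cong_add e cong_refl)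
  ultimately show "key (act_B n x) = key (act_B n y)" unfolding xy act_B.simps key_eq_iff
    using e(2) by blast
qed

lemma respects_key_act_C: "respects_key (act_C n)"
  unfolding respects_key_def
proof (intro allI impI)
  fix x y :: "int \<times> int \<times> int"
  obtain a c b a' c' b' where xy: "x = (a, c, b)" "y = (a', c', b')" by (metis prod_cases3)
  assume "key x = key y"
  then have e: "[b = b'] (mod 2 * h\<^sup>2)" "[c = c'] (mod 2 * h\<^sup>2)"
    "[a - b + h * c = a' - b' + h * c'] (mod 4 * h ^ 3)" unfolding xy key_eq_iff by auto
  obtain r where r: "b = b' + 2 * h\<^sup>2 * r" using e(1) by (metis cong_iff_lin cong_sym)
  obtain k where k: "a - b + h * c = a' - b' + h * c' + 4 * h ^ 3 * k" using e(3) by (metis cong_iff_lin cong_sym)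
  obtain z where z: "2 * h\<^sup>2 * r * ap (- n) = 2 * h\<^sup>2 * r + 4 * h ^ 3 * z"
    using ap_absorb by (metis cong_iff_lin cong_sym)
  have "[a - b * ap (- n) + h * (c + n) = a' - b' * ap (- n) + h * (c' + n)] (mod 4 * h ^ 3)"
    by (rule congI[where k = "k - z"]) (use k r z in Groebner_Basis.algebra)
  moreover have "[b * ap (- n) = b' * ap (- n)] (mod 2 * h\<^sup>2)" using e(1) by (rule cong_scalar_right)
  ultimately show "key (act_C n x) = key (act_C n y)" unfolding xy act_C.simps key_eq_iff
    using e(2) by (simp add: cong_add_rcancel)
qed

lemma act_B_add: "act_B k (act_B n x) = act_B (n + k) x"
  by (cases x) simp

lemma act_C_add: "key (act_C k (act_C n x)) = key (act_C (n + k) x)"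
proof -
  obtain a c b where x: "x = (a, c, b)" by (metis prod_cases3)
  have "[b * ap (- n) * ap (- k) = b * ap (- (n + k))] (mod 4 * h ^ 3)"
    using ap_add[of "- n" "- k"] by (metis cong_scalar_left cong_sym minus_add_distrib mult.assoc)
  then show ?thesis unfolding x act_C.simps
    by (intro key_congI) (simp_all add: algebra_simps)
qed

lemma act_B_0: "act_B 0 x = x" and act_C_0: "act_C 0 x = x"
  by (cases x; simp)+

lemma keyed_act_permutes:
  "keyed act_A permutes range key" "keyed (act_B 1) permutes range key" "keyed (act_C 1) permutes range key"
proof -
  show "keyed act_A permutes range key"
    using respects_key_act_A act_A_pow_Suc[of "- 1"]
    by (intro keyed_permutes[where g = "act_A_pow (- 1)"]) (simp_all add: act_A_pow_0)
  show "keyed (act_B 1) permutes range key"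
    using respects_key_act_B by (intro keyed_permutes[where g = "act_B (- 1)"]) (simp_all add: act_B_add act_B_0)
  show "keyed (act_C 1) permutes range key"
    using respects_key_act_C by (intro keyed_permutes[where g = "act_C (- 1)"]) (simp_all add: act_C_add act_C_0)
qed

lemma act_AB: "key (act_B 1 (act_A x)) = key (act_C 1 (act_A (act_B 1 x)))"
proof -
  obtain a c b where x: "x = (a, c, b)" by (metis prod_cases3)
  have "[sg (b + 1) * ap (- 1) = (1 + u) * (sg b + 1) * ap (- 1)] (mod 4 * h ^ 3)"
    by (intro cong_scalar_right sg_Suc)
  also have "(1 + u) * (sg b + 1) * ap (- 1) = ((1 + u) * ap (- 1)) * (sg b + 1)" by simp
  also have "[\<dots> = 1 * (sg b + 1)] (mod 4 * h ^ 3)" by (intro cong_scalar_right ap_neg1)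
  finally show ?thesis unfolding x act_A.simps act_B.simps act_C.simps
    by (intro key_congI) (simp_all add: cong_sym)
qed

lemma act_CB: "key (act_B 1 (act_C 1 x)) = key (act_C 1 (act_B (1 + u) x))"
proof -
  obtain a c b where x: "x = (a, c, b)" by (metis prod_cases3)
  have "[b * ap (- 1) + (1 + u) * ap (- 1) = b * ap (- 1) + 1] (mod 4 * h ^ 3)"
    by (intro cong_add cong_refl ap_neg1)
  then show ?thesis unfolding x act_B.simps act_C.simps
    by (intro key_congI) (simp_all add: cong_sym algebra_simps)
qed

text \<open>The hardest relation. After \<open>C\<close> has acted, the exponent of \<open>B\<close>
  is \<open>\<beta>\<close>, with \<open>(1 + u) * \<beta>\<close> congruent to \<open>b\<close>, so
  the closed forms at \<open>n = 1 + u\<close> apply. The triples that they give differ; only the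
  keys agree, since \<open>2 * h\<^sup>2 * l\<^sup>2 * \<beta>\<close> can be moved from
  \<open>A\<close> to \<open>B\<close> and \<open>2 * h\<^sup>2 * T\<close> can be removed from
  \<open>C\<close>.\<close>

lemma act_AC: "key (act_C 1 (act_A x)) = key (act_A_pow (1 + u) (act_C 1 x))"
proof -
  obtain a c b where x: "x = (a, c, b)" by (metis prod_cases3)
  define \<beta> where "\<beta> = b * ap (- 1)"
  define T where "T = t2 (\<beta> + 1)"
  obtain i where i: "(1 + u) * ap (- 1) = 1 + 4 * h ^ 3 * i" using ap_neg1 by (metis cong_iff_lin cong_sym)
  have b: "(1 + u) * \<beta> = b + 4 * h ^ 3 * (i * b)" using i unfolding \<beta>_def by Groebner_Basis.algebra
  obtain p where p: "an \<beta> (1 + u) = (1 + u) * (1 + 2 * h\<^sup>2 * l\<^sup>2 * \<beta>) + 4 * h ^ 3 * p"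
    using an_alpha by (metis cong_iff_lin cong_sym)
  obtain q where q: "ap (- (c + 1)) = ap (- c) * ap (- 1) + 4 * h ^ 3 * q"
    using ap_add[of "- c" "- 1"] by (metis cong_iff_lin cong_sym minus_add_distrib)
  obtain r where r: "2 * h\<^sup>2 * (l\<^sup>2 * \<beta>) * ap (- c) = 2 * h\<^sup>2 * (l\<^sup>2 * \<beta>) + 4 * h ^ 3 * r"
    using ap_absorb by (metis cong_iff_lin cong_sym)
  have "[an \<beta> (1 + u) * ap (- (c + 1)) = ap (- c) + 2 * h\<^sup>2 * l\<^sup>2 * \<beta>] (mod 4 * h ^ 3)"
  proof (rule congI)
    show "an \<beta> (1 + u) * ap (- (c + 1)) = ap (- c) + 2 * h\<^sup>2 * l\<^sup>2 * \<beta> + 4 * h ^ 3 *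
      (r + i * ap (- c) * (1 + 2 * h\<^sup>2 * l\<^sup>2 * \<beta>) + q * (1 + u) * (1 + 2 * h\<^sup>2 * l\<^sup>2 * \<beta>) + p * ap (- (c + 1)))"
      unfolding p q using i r by Groebner_Basis.algebra
  qed
  then have A: "[a + an \<beta> (1 + u) * ap (- (c + 1)) = a + ap (- c) + 2 * h\<^sup>2 * l\<^sup>2 * \<beta>] (mod 4 * h ^ 3)"
    by (simp add: cong_add_lcancel add.assoc)
  have "[Sn \<beta> (1 + u) = (1 + u) * \<beta> + 2 * h\<^sup>2 * T] (mod 4 * h\<^sup>2)" unfolding T_def by (rule Sn_alpha)
  also have "[(1 + u) * \<beta> + 2 * h\<^sup>2 * T = b + 2 * h\<^sup>2 * T] (mod 4 * h\<^sup>2)"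
    unfolding b by (rule congI[where k = "h * (i * b)"]) Groebner_Basis.algebra
  finally have S: "[c + 1 - Sn \<beta> (1 + u) = c + 1 - (b + 2 * h\<^sup>2 * T)] (mod 4 * h\<^sup>2)"
    by (intro cong_diff cong_refl)
  have "[sg b * ap (- 1) = sg ((1 + u) * \<beta>) * ap (- 1)] (mod 4 * h ^ 3)"
    by (intro cong_scalar_right sg_cong cong_sym[OF congI[OF b]])
  also have "[sg ((1 + u) * \<beta>) * ap (- 1) =
      (1 + u) * (bn \<beta> (1 + u) - 2 * h\<^sup>2 * l\<^sup>2 * \<beta> - 2 * h ^ 3 * T) * ap (- 1)] (mod 4 * h ^ 3)"
    unfolding T_def by (intro cong_scalar_right bn_alpha)
  also have "(1 + u) * (bn \<beta> (1 + u) - 2 * h\<^sup>2 * l\<^sup>2 * \<beta> - 2 * h ^ 3 * T) * ap (- 1) =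
     ((1 + u) * ap (- 1)) * (bn \<beta> (1 + u) - 2 * h\<^sup>2 * l\<^sup>2 * \<beta> - 2 * h ^ 3 * T)" by simp
  also have "[\<dots> = 1 * (bn \<beta> (1 + u) - 2 * h\<^sup>2 * l\<^sup>2 * \<beta> - 2 * h ^ 3 * T)] (mod 4 * h ^ 3)"
    by (intro cong_scalar_right ap_neg1)
  finally have B: "[sg b * ap (- 1) = bn \<beta> (1 + u) - 2 * h\<^sup>2 * l\<^sup>2 * \<beta> - 2 * h ^ 3 * T] (mod 4 * h ^ 3)"
    by (simp only: mult_1)
  have "key (act_A_pow (1 + u) (act_C 1 x)) =
    key (a + ap (- c) + 2 * h\<^sup>2 * l\<^sup>2 * \<beta>, c + 1 - (b + 2 * h\<^sup>2 * T), bn \<beta> (1 + u))"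
    unfolding x act_C.simps act_A_pow.simps \<beta>_def[symmetric] by (intro key_congI A S cong_refl)
  also have "\<dots> = key (a + ap (- c), c + 1 - b, bn \<beta> (1 + u) - 2 * h\<^sup>2 * l\<^sup>2 * \<beta> - 2 * h ^ 3 * T)"
    unfolding key_eq_iff
  proof (intro conjI)
    show "[bn \<beta> (1 + u) = bn \<beta> (1 + u) - 2 * h\<^sup>2 * l\<^sup>2 * \<beta> - 2 * h ^ 3 * T] (mod 2 * h\<^sup>2)"
      by (rule congI[where k = "l\<^sup>2 * \<beta> + h * T"]) Groebner_Basis.algebra
    show "[c + 1 - (b + 2 * h\<^sup>2 * T) = c + 1 - b] (mod 2 * h\<^sup>2)"
      by (rule congI[where k = "- T"]) Groebner_Basis.algebra
    show "[a + ap (- c) + 2 * h\<^sup>2 * l\<^sup>2 * \<beta> - bn \<beta> (1 + u) + h * (c + 1 - (b + 2 * h\<^sup>2 * T)) =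
      a + ap (- c) - (bn \<beta> (1 + u) - 2 * h\<^sup>2 * l\<^sup>2 * \<beta> - 2 * h ^ 3 * T) + h * (c + 1 - b)] (mod 4 * h ^ 3)"
      by (rule congI[where k = "- T"]) Groebner_Basis.algebra
  qed
  also have "\<dots> = key (act_C 1 (act_A x))"
    unfolding x act_A.simps act_C.simps diff_add_eq[of c b 1, symmetric]
    by (intro key_congI cong_sym[OF B] cong_refl)
  finally show ?thesis ..
qed

lemma act_A_period: "key (act_A_pow (4 * h ^ 3) x) = key x"
proof -
  obtain a c b where x: "x = (a, c, b)" by (metis prod_cases3)
  have "[a + an b (4 * h ^ 3) * ap (- c) = a + 0 * ap (- c)] (mod 4 * h ^ 3)"
    by (intro cong_add cong_scalar_right an_period cong_refl)
  moreover have "[c - Sn b (4 * h ^ 3) = c - 0] (mod 4 * h\<^sup>2)" by (intro cong_diff Sn_period cong_refl)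
  ultimately show ?thesis unfolding x act_A_pow.simps
    by (intro key_congI bn_period) simp_all
qed

lemma act_B_period: "key (act_B (4 * h ^ 3) x) = key x"
proof -
  obtain a c b where x: "x = (a, c, b)" by (metis prod_cases3)
  show ?thesis unfolding x act_B.simps
    by (intro key_congI) (simp_all add: cong_def)
qed

lemma perm_comm: "grp_comm PG (keyed act_A) (keyed (act_B 1)) = keyed (act_C 1)"
proof -
  interpret group PG by (rule group_perm_group)
  show ?thesis
  proof (rule comm_unique)
    show "keyed (act_B 1) \<otimes>\<^bsub>PG\<^esub> keyed act_A \<otimes>\<^bsub>PG\<^esub> keyed (act_C 1) = keyed act_A \<otimes>\<^bsub>PG\<^esub> keyed (act_B 1)"
      unfolding perm_group_mult
      by (intro perm_eqI permutes_compose keyed_act_permutes)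
        (simp only: o_apply keyed_key respects_key_act_A respects_key_act_B respects_key_act_C act_AB)
  qed (simp_all add: perm_group_carrier keyed_act_permutes)
qed

lemma perm_pow:
  fixes n :: int
  shows "(keyed act_A [^]\<^bsub>PG\<^esub> n) (key x) = key (act_A_pow n x)"
    and "(keyed (act_B 1) [^]\<^bsub>PG\<^esub> n) (key x) = key (act_B n x)"
    and "(keyed (act_C 1) [^]\<^bsub>PG\<^esub> n) (key x) = key (act_C n x)"
  by (rule keyed_pow[OF respects_key_act_A keyed_act_permutes(1)], rule act_A_pow_0, rule act_A_pow_Suc)
    (rule keyed_pow[OF respects_key_act_B keyed_act_permutes(2)], rule act_B_0, simp only: act_B_add,
     rule keyed_pow[OF respects_key_act_C keyed_act_permutes(3)], rule act_C_0, rule act_C_add)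

lemma perm_pair: "macdonald_pair PG m (1 + u) (keyed act_A) (keyed (act_B 1))"
proof -
  interpret group PG by (rule group_perm_group)
  have c: "keyed act_A \<in> carrier PG" "keyed (act_B 1) \<in> carrier PG" "keyed (act_C 1) \<in> carrier PG"
    by (simp_all add: perm_group_carrier keyed_act_permutes)
  have pw: "(x [^]\<^bsub>PG\<^esub> (n::int)) permutes range key" if "x permutes range key" for x n
    using int_pow_closed[of x n] that by (simp add: perm_group_carrier)
  note resp = respects_key_act_A respects_key_act_B respects_key_act_C
  have A: "keyed act_A \<otimes>\<^bsub>PG\<^esub> keyed (act_C 1) = keyed (act_C 1) \<otimes>\<^bsub>PG\<^esub> keyed act_A [^]\<^bsub>PG\<^esub> (1 + u)"
    unfolding perm_group_mult
  proof (rule perm_eqI[OF permutes_compose permutes_compose])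
    show "(keyed (act_C 1) \<circ> keyed act_A) (key x) = (keyed act_A [^]\<^bsub>PG\<^esub> (1 + u) \<circ> keyed (act_C 1)) (key x)" for x
      by (simp only: o_apply keyed_key resp perm_pow act_AC)
  qed (rule pw keyed_act_permutes)+
  have CB: "keyed (act_C 1) \<otimes>\<^bsub>PG\<^esub> keyed (act_B 1) = keyed (act_B 1) [^]\<^bsub>PG\<^esub> (1 + u) \<otimes>\<^bsub>PG\<^esub> keyed (act_C 1)"
    unfolding perm_group_mult
  proof (rule perm_eqI[OF permutes_compose permutes_compose])
    show "(keyed (act_B 1) \<circ> keyed (act_C 1)) (key x) = (keyed (act_C 1) \<circ> keyed (act_B 1) [^]\<^bsub>PG\<^esub> (1 + u)) (key x)" for x
      by (simp only: o_apply keyed_key resp perm_pow act_CB)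
  qed (rule pw keyed_act_permutes)+
  have B: "keyed (act_B 1) \<otimes>\<^bsub>PG\<^esub> inv\<^bsub>PG\<^esub> keyed (act_C 1) = inv\<^bsub>PG\<^esub> keyed (act_C 1) \<otimes>\<^bsub>PG\<^esub> keyed (act_B 1) [^]\<^bsub>PG\<^esub> (1 + u)"
    by (rule mult_inv_swap[OF c(3) c(2) int_pow_closed[OF c(2)] CB])
  have M: "4 * h ^ 3 = int (2 ^ (3 * m - 1))"
  proof -
    have "3 * m - 1 = 2 + (m - 1) * 3" using m by simp
    then show ?thesis by (simp add: h_def power_add power_mult)
  qed
  have "keyed act_A [^]\<^bsub>PG\<^esub> (4 * h ^ 3) = \<one>\<^bsub>PG\<^esub>"
    unfolding perm_group_one
    using perm_eqI[OF pw[OF keyed_act_permutes(1)] permutes_id] by (simp only: id_apply perm_pow act_A_period)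
  moreover have "keyed (act_B 1) [^]\<^bsub>PG\<^esub> (4 * h ^ 3) = \<one>\<^bsub>PG\<^esub>"
    unfolding perm_group_one
    using perm_eqI[OF pw[OF keyed_act_permutes(2)] permutes_id] by (simp only: id_apply perm_pow act_B_period)
  moreover have "grp_conj PG (keyed act_A) (keyed (act_C 1)) = keyed act_A [^]\<^bsub>PG\<^esub> (1 + u)"
    using A grp_conj_eq_iff[OF c(3) c(1) int_pow_closed[OF c(1)]] by blast
  moreover have "grp_conj PG (keyed (act_B 1)) (inv\<^bsub>PG\<^esub> keyed (act_C 1)) = keyed (act_B 1) [^]\<^bsub>PG\<^esub> (1 + u)"
    using B grp_conj_eq_iff[OF inv_closed[OF c(3)] c(2) int_pow_closed[OF c(2)]] by blast
  ultimately show ?thesis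
    unfolding macdonald_pair_def comm_swap[OF c(1) c(2)] perm_comm M int_pow_int
    using c(1) c(2) by blast
qed

lemma perm_nf: "(keyed act_A [^]\<^bsub>PG\<^esub> (a::int) \<otimes>\<^bsub>PG\<^esub> keyed (act_C 1) [^]\<^bsub>PG\<^esub> (c::int) \<otimes>\<^bsub>PG\<^esub>
    keyed (act_B 1) [^]\<^bsub>PG\<^esub> (b::int)) (key (0, 0, 0)) = key (a, c, b)"
  by (simp add: perm_group_mult perm_pow)

end

locale macdonald_faithful = macdonald +
  assumes key_nf: "nf a c b = nf a' c' b' \<Longrightarrow> key (a, c, b) = key (a', c', b')"

lemma (in macdonald_param) J2_macdonald:
  "macdonald_faithful m l (J2 (1 + 2 ^ m * l)) (J2_x (1 + 2 ^ m * l)) (J2_y (1 + 2 ^ m * l))"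
proof -
  let ?J = "J2 (1 + 2 ^ m * l)"
  have "2 ^ m = 2 * h" using m unfolding h_def by (simp flip: power_Suc)
  then have u: "2 ^ m * l = u" by (simp add: u_def)
  have mult: "multiplicity 2 ((1 + u) - 1) = m" using multiplicity_alpha[OF l, of m] u by simp
  interpret group ?J by (rule group_J2)
  interpret macdonald m l ?J "J2_x (1 + 2 ^ m * l)" "J2_y (1 + 2 ^ m * l)"
    using J2_pair[of "1 + u"] J2_generate[of "1 + u"] mult u by unfold_locales auto
  interpret P: group PG by (rule group_perm_group)
  obtain \<phi> where \<phi>: "\<phi> \<in> hom ?J PG" "\<phi> (J2_x (1 + 2 ^ m * l)) = keyed act_A"
    "\<phi> (J2_y (1 + 2 ^ m * l)) = keyed (act_B 1)"
    using P.J2_universal[of "1 + u"] perm_pair mult u by metis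
  interpret p: group_hom ?J PG \<phi> using \<phi>(1) by unfold_locales
  have "\<phi> C = keyed (act_C 1)" unfolding C_def by (simp add: p.hom_grp_comm \<phi> perm_comm)
  \<comment> \<open>The image of the base point under an element displays the key of any of its
    normal forms, so equal elements have equal keys.\<close>
  then have "\<phi> (nf a c b) (key (0, 0, 0)) = key (a, c, b)" for a c b
    unfolding nf_def by (simp add: p.hom_int_pow \<phi> perm_nf)
  then show ?thesis by unfold_locales (metis (no_types))
qed

section \<open>Upper central series and derived subgroup\<close>

context group
begin

lemma r_coset_eq_iff:
  assumes "N \<lhd> G" "x \<in> carrier G" "y \<in> carrier G"
  shows "N #> x = N #> y \<longleftrightarrow> x \<otimes> inv y \<in> N"
proof -
  interpret normal N G by (rule assms)
  show ?thesis
  proof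
    assume "N #> x = N #> y"
    then have "x \<in> N #> y" using rcos_self[OF assms(2) subgroup_axioms] by simp
    then show "x \<otimes> inv y \<in> N" using rcos_module[OF is_group assms(3,2)] by simp
  next
    assume "x \<otimes> inv y \<in> N"
    then have "x \<in> N #> y" using rcos_module[OF is_group assms(3,2)] by simp
    then show "N #> x = N #> y" using repr_independence[OF _ assms(3) subgroup_axioms] by simp
  qed
qed

lemma center_subgroup: "subgroup (center G) G"
proof (rule subgroupI)
  fix a assume "a \<in> center G"
  then show "inv a \<in> center G"
    by (auto simp: center_def) (metis inv_closed mult_inv_swap)
next
  fix a b assume "a \<in> center G" "b \<in> center G"
  then have ab: "a \<in> carrier G" "b \<in> carrier G" "\<And>g. g \<in> carrier G \<Longrightarrow> a \<otimes> g = g \<otimes> a"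
    "\<And>g. g \<in> carrier G \<Longrightarrow> b \<otimes> g = g \<otimes> b" by (auto simp: center_def)
  have "a \<otimes> b \<otimes> g = g \<otimes> (a \<otimes> b)" if "g \<in> carrier G" for g
  proof -
    have "a \<otimes> b \<otimes> g = a \<otimes> (b \<otimes> g)" using ab(1,2) that by (simp only: m_assoc)
    also have "\<dots> = a \<otimes> g \<otimes> b" using ab(1,2) that by (simp only: ab(4)[OF that] m_assoc)
    also have "\<dots> = g \<otimes> (a \<otimes> b)" using ab(1,2) that by (simp only: ab(3)[OF that] m_assoc)
    finally show ?thesis .
  qed
  then show "a \<otimes> b \<in> center G" using ab(1,2) by (simp add: center_def)
qed (auto simp: center_def)

lemma mem_upper_central_Suc:
  assumes "upper_central G i \<lhd> G"
  shows "g \<in> upper_central G (Suc i) \<longleftrightarrow>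
    g \<in> carrier G \<and> (\<forall>x \<in> carrier G. g \<otimes> x \<otimes> inv (x \<otimes> g) \<in> upper_central G i)"
proof -
  interpret normal "upper_central G i" G by (rule assms)
  have "(upper_central G i #> g) <#> (upper_central G i #> x) = (upper_central G i #> x) <#> (upper_central G i #> g)
      \<longleftrightarrow> g \<otimes> x \<otimes> inv (x \<otimes> g) \<in> upper_central G i" if "g \<in> carrier G" "x \<in> carrier G" for g x
    using that r_coset_eq_iff[OF assms, of "g \<otimes> x" "x \<otimes> g"] by (simp add: rcos_sum)
  then show ?thesis by (auto simp: center_def carrier_FactGroup)
qed

lemma upper_central_normal: "upper_central G i \<lhd> G"
proof (induction i)
  case 0
  then show ?case by (simp add: one_is_normal)
next
  case (Suc i)
  interpret N: normal "upper_central G i" G by (rule Suc)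
  interpret Q: group "G Mod upper_central G i" by (rule N.factorgroup_is_group)
  interpret q: group_hom G "G Mod upper_central G i" "\<lambda>a. upper_central G i #> a"
    using N.r_coset_hom_Mod by unfold_locales
  have eq: "upper_central G (Suc i) = {g \<in> carrier G. upper_central G i #> g \<in> center (G Mod upper_central G i)}"
    by simp
  have "subgroup (upper_central G (Suc i)) G"
  proof (rule subgroupI)
    have "\<one> \<in> upper_central G (Suc i)"
      using subgroup.one_closed[OF Q.center_subgroup] by simp
    then show "upper_central G (Suc i) \<noteq> {}" by blast
  next
    fix a assume "a \<in> upper_central G (Suc i)"
    then show "inv a \<in> upper_central G (Suc i)"
      unfolding eq using subgroup.m_inv_closed[OF Q.center_subgroup] by (simp add: q.hom_inv)
  next
    fix a b assume "a \<in> upper_central G (Suc i)" "b \<in> upper_central G (Suc i)"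
    then show "a \<otimes> b \<in> upper_central G (Suc i)"
      unfolding eq using subgroup.m_closed[OF Q.center_subgroup] by (simp add: q.hom_mult del: mult_FactGroup)
  qed auto
  moreover have "x \<otimes> g \<otimes> inv x \<in> upper_central G (Suc i)"
    if "x \<in> carrier G" "g \<in> upper_central G (Suc i)" for x g
  proof -
    have g: "g \<in> carrier G" "upper_central G i #> g \<in> center (G Mod upper_central G i)" using that by auto
    have "upper_central G i #> (x \<otimes> g \<otimes> inv x) = upper_central G i #> g"
    proof -
      let ?q = "\<lambda>a. upper_central G i #> a"
      have "?q (x \<otimes> g \<otimes> inv x) = ?q x \<otimes>\<^bsub>G Mod upper_central G i\<^esub> ?q g \<otimes>\<^bsub>G Mod upper_central G i\<^esub> inv\<^bsub>G Mod upper_central G i\<^esub> ?q x"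
        using that g by (simp only: q.hom_mult q.hom_inv m_closed inv_closed)
      also have "?q x \<otimes>\<^bsub>G Mod upper_central G i\<^esub> ?q g = ?q g \<otimes>\<^bsub>G Mod upper_central G i\<^esub> ?q x"
        using g(2) q.hom_closed[OF that(1)] by (simp add: center_def)
      finally show ?thesis
        using Q.m_assoc[of "?q g" "?q x" "inv\<^bsub>G Mod upper_central G i\<^esub> ?q x"]
          q.hom_closed[OF that(1)] q.hom_closed[OF g(1)] by (simp del: mult_FactGroup one_FactGroup)
    qed
    then show ?thesis using that g by simp
  qed
  ultimately show ?case by (simp only: normal_inv_iff) blast
qed

lemma mem_upper_central_Suc':
  "g \<in> upper_central G (Suc i) \<longleftrightarrow>
    g \<in> carrier G \<and> (\<forall>x \<in> carrier G. g \<otimes> x \<otimes> inv (x \<otimes> g) \<in> upper_central G i)"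
  by (rule mem_upper_central_Suc[OF upper_central_normal])

declare upper_central.simps(2) [simp del]

lemma upper_central_subset_Suc: "upper_central G i \<subseteq> upper_central G (Suc i)"
proof
  interpret N: normal "upper_central G i" G by (rule upper_central_normal)
  fix g assume g: "g \<in> upper_central G i"
  have "g \<otimes> x \<otimes> inv (x \<otimes> g) \<in> upper_central G i" if "x \<in> carrier G" for x
  proof -
    have "g \<otimes> x \<otimes> inv (x \<otimes> g) = g \<otimes> (x \<otimes> inv g \<otimes> inv x)"
      using g that N.mem_carrier by (simp add: inv_mult_group m_assoc)
    then show ?thesis using g that N.inv_op_closed2 N.m_inv_closed N.m_closed by simp
  qed
  then show "g \<in> upper_central G (Suc i)"
    unfolding mem_upper_central_Suc' using g N.mem_carrier by blast
qed

lemma mem_upper_central_generateI: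
  assumes g: "g \<in> carrier G" and S: "carrier G = generate G S" "S \<subseteq> carrier G"
    and "\<And>s. s \<in> S \<Longrightarrow> g \<otimes> s \<otimes> inv (s \<otimes> g) \<in> upper_central G i"
  shows "g \<in> upper_central G (Suc i)"
  unfolding mem_upper_central_Suc'
proof (intro conjI ballI g)
  let ?N = "upper_central G i"
  interpret N: normal ?N G by (rule upper_central_normal)
  interpret Q: group "G Mod ?N" by (rule N.factorgroup_is_group)
  interpret q: group_hom G "G Mod ?N" "\<lambda>a. ?N #> a"
    using N.r_coset_hom_Mod by unfold_locales
  have comm: "g \<otimes> x \<otimes> inv (x \<otimes> g) \<in> ?N \<longleftrightarrow>
      (?N #> g) \<otimes>\<^bsub>G Mod ?N\<^esub> (?N #> x) = (?N #> x) \<otimes>\<^bsub>G Mod ?N\<^esub> (?N #> g)" if "x \<in> carrier G" for x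
    using g that r_coset_eq_iff[OF upper_central_normal, of "g \<otimes> x" "x \<otimes> g" i]
    by (simp only: q.hom_mult[symmetric] m_closed)
  fix x assume "x \<in> carrier G"
  then have "x \<in> generate G S" using S by simp
  then show "g \<otimes> x \<otimes> inv (x \<otimes> g) \<in> ?N"
  proof induction
    case one
    then show ?case using g N.one_closed by simp
  next
    case (incl s)
    then show ?case using assms(4) by simp
  next
    case (inv s)
    then have s: "s \<in> carrier G" using S by auto
    have "(?N #> g) \<otimes>\<^bsub>G Mod ?N\<^esub> (?N #> s) = (?N #> s) \<otimes>\<^bsub>G Mod ?N\<^esub> (?N #> g)"
      using comm[OF s] assms(4) inv by simp
    then have "(?N #> g) \<otimes>\<^bsub>G Mod ?N\<^esub> inv\<^bsub>G Mod ?N\<^esub> (?N #> s) = inv\<^bsub>G Mod ?N\<^esub> (?N #> s) \<otimes>\<^bsub>G Mod ?N\<^esub> (?N #> g)"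
      using Q.mult_inv_swap[OF q.hom_closed[OF s] q.hom_closed[OF g] q.hom_closed[OF g]] by simp
    then show ?case using comm[of "inv s"] s by (simp only: q.hom_inv inv_closed)
  next
    case (eng s t)
    then have st: "s \<in> carrier G" "t \<in> carrier G" using generate_in_carrier[OF S(2)] by auto
    have "(?N #> g) \<otimes>\<^bsub>G Mod ?N\<^esub> (?N #> s) = (?N #> s) \<otimes>\<^bsub>G Mod ?N\<^esub> (?N #> g)"
      "(?N #> g) \<otimes>\<^bsub>G Mod ?N\<^esub> (?N #> t) = (?N #> t) \<otimes>\<^bsub>G Mod ?N\<^esub> (?N #> g)"
      using comm eng st by blast+
    then have "(?N #> g) \<otimes>\<^bsub>G Mod ?N\<^esub> ((?N #> s) \<otimes>\<^bsub>G Mod ?N\<^esub> (?N #> t)) =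
        ((?N #> s) \<otimes>\<^bsub>G Mod ?N\<^esub> (?N #> t)) \<otimes>\<^bsub>G Mod ?N\<^esub> (?N #> g)"
      by (metis Q.m_assoc q.hom_closed g st)
    then show ?case using comm[of "s \<otimes> t"] st by (simp only: q.hom_mult m_closed)
  qed
qed

end

context group_hom
begin

text \<open>Used with \<open>k = 0\<close> for invariance under isomorphism, and with
  \<open>k = 2\<close> to recognise the upper central series of \<open>K2\<close> as that of
  \<open>J2\<close> shifted by two places.\<close>

lemma upper_central_epi:
  assumes "h ` carrier G = carrier H" "kernel G H h = upper_central G k" "g \<in> carrier G"
  shows "h g \<in> upper_central H i \<longleftrightarrow> g \<in> upper_central G (i + k)"
  using assms(3)
proof (induction i arbitrary: g)
  case 0
  then show ?case using assms(2) by (auto simp: kernel_def)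
next
  case (Suc i)
  have "h g \<in> upper_central H (Suc i) \<longleftrightarrow>
      (\<forall>x \<in> carrier G. h g \<otimes>\<^bsub>H\<^esub> h x \<otimes>\<^bsub>H\<^esub> inv\<^bsub>H\<^esub> (h x \<otimes>\<^bsub>H\<^esub> h g) \<in> upper_central H i)"
    unfolding H.mem_upper_central_Suc' assms(1)[symmetric] using Suc.prems by auto
  also have "\<dots> \<longleftrightarrow> (\<forall>x \<in> carrier G. h (g \<otimes> x \<otimes> inv (x \<otimes> g)) \<in> upper_central H i)"
    using Suc.prems by simp
  also have "\<dots> \<longleftrightarrow> (\<forall>x \<in> carrier G. g \<otimes> x \<otimes> inv (x \<otimes> g) \<in> upper_central G (i + k))"
    using Suc.prems by (intro ball_cong refl Suc.IH) simp
  also have "\<dots> \<longleftrightarrow> g \<in> upper_central G (Suc i + k)"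
    using Suc.prems G.mem_upper_central_Suc' by simp
  finally show ?case .
qed

lemma upper_central_factor_epi:
  assumes "h ` carrier G = carrier H" "kernel G H h = upper_central G k"
  shows "upper_central_factor G (i + k) \<cong> upper_central_factor H i"
proof -
  note epi = upper_central_epi[OF assms]
  let ?U = "upper_central G (Suc (i + k))" and ?V = "upper_central H (Suc i)"
  let ?N = "upper_central H i"
  let ?GU = "G\<lparr>carrier := ?U\<rparr>" and ?HV = "H\<lparr>carrier := ?V\<rparr>"
  have sU: "subgroup ?U G" and sV: "subgroup ?V H"
    using G.upper_central_normal H.upper_central_normal normal_imp_subgroup by blast+
  interpret GU: group ?GU by (rule subgroup.subgroup_is_group[OF sU]) (rule G.is_group)
  interpret HV: group ?HV by (rule subgroup.subgroup_is_group[OF sV]) (rule H.is_group)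
  have nN: "?N \<lhd> ?HV"
    using H.upper_central_normal normal_imp_subgroup[OF H.upper_central_normal] sV H.upper_central_subset_Suc
    by (intro H.normal_restrict_supergroup)
  interpret N: normal ?N ?HV by (rule nN)
  interpret Q: group "?HV Mod ?N" by (rule N.factorgroup_is_group)
  have coset: "?N #>\<^bsub>?HV\<^esub> y = ?N #>\<^bsub>H\<^esub> y" for y by (simp add: r_coset_def)
  have hV: "h g \<in> ?V" if "g \<in> ?U" for g
    using that epi[of g "Suc i"] subgroup.mem_carrier[OF sU] by (simp only: add_Suc)
  have hom: "(\<lambda>g. ?N #>\<^bsub>?HV\<^esub> h g) \<in> hom ?GU (?HV Mod ?N)"
  proof (rule homI)
    fix x assume "x \<in> carrier ?GU"
    then show "?N #>\<^bsub>?HV\<^esub> h x \<in> carrier (?HV Mod ?N)" using hV by (auto simp: carrier_FactGroup)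
  next
    fix x y assume xy: "x \<in> carrier ?GU" "y \<in> carrier ?GU"
    then have "h (x \<otimes> y) = h x \<otimes>\<^bsub>H\<^esub> h y" using subgroup.mem_carrier[OF sU] by simp
    then show "?N #>\<^bsub>?HV\<^esub> h (x \<otimes>\<^bsub>?GU\<^esub> y) = (?N #>\<^bsub>?HV\<^esub> h x) \<otimes>\<^bsub>?HV Mod ?N\<^esub> (?N #>\<^bsub>?HV\<^esub> h y)"
      using N.rcos_sum[of "h x" "h y"] xy hV by simp
  qed
  interpret q: group_hom ?GU "?HV Mod ?N" "\<lambda>g. ?N #>\<^bsub>?HV\<^esub> h g" using hom by unfold_locales
  have surj: "(\<lambda>g. ?N #>\<^bsub>?HV\<^esub> h g) ` carrier ?GU = carrier (?HV Mod ?N)"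
  proof -
    have "h ` ?U = ?V"
    proof
      show "h ` ?U \<subseteq> ?V" using hV by blast
      show "?V \<subseteq> h ` ?U"
      proof
        fix y assume y: "y \<in> ?V"
        then have "y \<in> carrier H" by (rule subgroup.mem_carrier[OF sV])
        then obtain g where g: "g \<in> carrier G" "y = h g" using assms(1) by blast
        then have "g \<in> ?U" using y epi[of g "Suc i"] by (simp only: add_Suc)
        then show "y \<in> h ` ?U" using g by blast
      qed
    qed
    moreover have "(\<lambda>g. ?N #>\<^bsub>?HV\<^esub> h g) ` ?U = (\<lambda>y. ?N #>\<^bsub>?HV\<^esub> y) ` h ` ?U" by (simp only: image_image)
    ultimately show ?thesis by (simp add: carrier_FactGroup)
  qed
  have ker: "kernel ?GU (?HV Mod ?N) (\<lambda>g. ?N #>\<^bsub>?HV\<^esub> h g) = upper_central G (i + k)"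
  proof -
    have "?N #>\<^bsub>?HV\<^esub> h g = ?N \<longleftrightarrow> g \<in> upper_central G (i + k)" if "g \<in> ?U" for g
    proof -
      have gG: "g \<in> carrier G" using that by (rule subgroup.mem_carrier[OF sU])
      have sN: "subgroup ?N H" by (rule normal_imp_subgroup[OF H.upper_central_normal])
      have "?N #>\<^bsub>?HV\<^esub> h g = ?N \<longleftrightarrow> h g \<in> ?N"
        unfolding coset using H.coset_join1[OF _ hom_closed[OF gG] sN] H.coset_join2[OF hom_closed[OF gG] sN] by iprover
      then show ?thesis using epi[OF gG] by simp
    qed
    then show ?thesis using G.upper_central_subset_Suc by (auto simp: kernel_def)
  qed
  show ?thesis
    unfolding upper_central_factor_def is_iso_def
    using q.FactGroup_iso_set[OF surj] ker by auto
qed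

end

lemma iso_obtain_group_hom:
  assumes "G \<cong> H" "group G" "group H"
  obtains \<phi> where "group_hom G H \<phi>" "\<phi> ` carrier G = carrier H" "inj_on \<phi> (carrier G)"
    "kernel G H \<phi> = upper_central G 0"
proof -
  obtain \<phi> where \<phi>: "\<phi> \<in> iso G H" using assms by (auto simp: is_iso_def)
  then have gh: "group_hom G H \<phi>"
    using assms by (simp add: group_hom_def group_hom_axioms_def iso_def)
  have "inj_on \<phi> (carrier G)" "\<phi> ` carrier G = carrier H" using \<phi> by (auto simp: iso_def bij_betw_def)
  moreover from this(1) have "kernel G H \<phi> = upper_central G 0"
    using group_hom.inj_on_one_iff[OF gh] by (auto simp: kernel_def group_hom.hom_one[OF gh] group.is_monoid[OF assms(2)] monoid.one_closed)
  ultimately show thesis using gh that by blast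
qed

lemma upper_central_factor_iso:
  assumes "G \<cong> H" "group G" "group H"
  shows "upper_central_factor G i \<cong> upper_central_factor H i"
proof -
  obtain \<phi> where \<phi>: "group_hom G H \<phi>" "\<phi> ` carrier G = carrier H" "kernel G H \<phi> = upper_central G 0"
    using iso_obtain_group_hom[OF assms] by metis
  show ?thesis using group_hom.upper_central_factor_epi[OF \<phi>, of i] by simp
qed

lemma upper_central_quotient_iso:
  assumes "G \<cong> H" "group G" "group H"
  shows "G Mod upper_central G i \<cong> H Mod upper_central H i"
proof -
  obtain \<phi> where \<phi>: "group_hom G H \<phi>" "\<phi> ` carrier G = carrier H" "kernel G H \<phi> = upper_central G 0"
    using iso_obtain_group_hom[OF assms] by metis
  interpret group_hom G H \<phi> by (rule \<phi>)
  let ?N = "upper_central H i"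
  interpret N: normal ?N H by (rule H.upper_central_normal)
  interpret Q: group "H Mod ?N" by (rule N.factorgroup_is_group)
  have "(\<lambda>g. ?N #>\<^bsub>H\<^esub> g) \<circ> \<phi> \<in> hom G (H Mod ?N)"
    using Group.hom_compose[OF homh N.r_coset_hom_Mod] .
  then interpret q: group_hom G "H Mod ?N" "(\<lambda>g. ?N #>\<^bsub>H\<^esub> g) \<circ> \<phi>" by unfold_locales
  have "kernel G (H Mod ?N) ((\<lambda>g. ?N #>\<^bsub>H\<^esub> g) \<circ> \<phi>) = upper_central G i"
  proof -
    have "?N #>\<^bsub>H\<^esub> \<phi> g = ?N \<longleftrightarrow> g \<in> upper_central G i" if "g \<in> carrier G" for g
      using upper_central_epi[OF \<phi>(2,3) that, of i] H.coset_join1[OF _ hom_closed[OF that] N.subgroup_axioms]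
        H.coset_join2[OF hom_closed[OF that] N.subgroup_axioms] unfolding add_0_right by iprover
    moreover have "upper_central G i \<subseteq> carrier G"
      using G.upper_central_normal normal_imp_subgroup subgroup.subset by blast
    ultimately show ?thesis by (auto simp: kernel_def)
  qed
  moreover have "((\<lambda>g. ?N #>\<^bsub>H\<^esub> g) \<circ> \<phi>) ` carrier G = carrier (H Mod ?N)"
    unfolding carrier_FactGroup image_comp[symmetric] \<phi>(2) ..
  ultimately show ?thesis
    using q.FactGroup_iso_set by (auto simp: is_iso_def)
qed

lemma derived_subgroup_iso:
  assumes "G \<cong> H" "group G" "group H"
  shows "derived_subgroup G \<cong> derived_subgroup H"
proof -
  obtain \<phi> where \<phi>: "group_hom G H \<phi>" "\<phi> ` carrier G = carrier H" "inj_on \<phi> (carrier G)"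
    using iso_obtain_group_hom[OF assms] by metis
  interpret group_hom G H \<phi> by (rule \<phi>)
  have sub: "derived G (carrier G) \<subseteq> carrier G" using G.derived_in_carrier[of "carrier G"] by simp
  have "\<phi> ` derived G (carrier G) = derived H (carrier H)"
    using derived_img[of "carrier G"] \<phi>(2) by simp
  then have "\<phi> \<in> iso (derived_subgroup G) (derived_subgroup H)"
    using sub \<phi>(3) unfolding derived_subgroup_def iso_def hom_def bij_betw_def
    by (auto simp: subsetD[OF sub] intro: inj_on_subset)
  then show ?thesis by (auto simp: is_iso_def)
qed

text \<open>Compares two groups through redundant coordinates: if both have the same coincidences
  between indices and the same product rule, no canonical representatives and no model group are
  needed.\<close>

lemma iso_by_index:
  assumes p: "range p = carrier G" and q: "range q = carrier H"
    and eq: "\<And>x y. p x = p y \<longleftrightarrow> q x = q y"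
    and mult: "\<And>x y. p x \<otimes>\<^bsub>G\<^esub> p y = p (f x y)" "\<And>x y. q x \<otimes>\<^bsub>H\<^esub> q y = q (f x y)"
  shows "G \<cong> H"
proof -
  define \<phi> where "\<phi> g = q (SOME x. p x = g)" for g
  have \<phi>: "\<phi> (p x) = q x" for x
    unfolding \<phi>_def using someI[of "\<lambda>y. p y = p x" x] eq by blast
  have "\<phi> \<in> hom G H"
    unfolding hom_def p[symmetric] q[symmetric] by (auto simp: \<phi> mult)
  moreover have "inj_on \<phi> (carrier G)"
    unfolding p[symmetric] by (rule inj_onI) (auto simp: \<phi> eq)
  moreover have "\<phi> ` carrier G = carrier H"
    unfolding p[symmetric] q[symmetric] by (simp only: image_image \<phi>)
  ultimately show ?thesis by (auto simp: is_iso_def iso_def bij_betw_def)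
qed

section \<open>The first two terms of the upper central series of \<open>J2\<close>\<close>

context macdonald_param
begin

lemma coprime_two_power_odd: "odd x \<Longrightarrow> coprime (2 ^ k) (x::int)"
  by (simp add: coprime_commute)

lemma h_dvd_odd: "odd x \<Longrightarrow> h dvd y * x \<longleftrightarrow> h dvd y"
  unfolding h_def using coprime_two_power_odd coprime_dvd_mult_left_iff by blast

lemma two_h2_eq: "2 * h\<^sup>2 = 2 ^ (2 * m - 1)"
proof -
  have "2 * m - 1 = Suc ((m - 1) * 2)" using m by simp
  then show ?thesis by (simp add: h_def power_mult)
qed

lemma two_h2_dvd_odd: "odd x \<Longrightarrow> 2 * h\<^sup>2 dvd y * x \<longleftrightarrow> 2 * h\<^sup>2 dvd y"
  unfolding two_h2_eq using coprime_two_power_odd coprime_dvd_mult_left_iff by blast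

lemma two_h_cancel: "2 * h * x = 2 * h * y \<Longrightarrow> x = y"
  using h_pos by simp

text \<open>As \<open>h\<close> is even, \<open>1 - ap (- c)\<close> is \<open>2 * h * c\<close>
  times an odd number, so the power of two dividing \<open>c\<close> can be read off.\<close>

lemma two_h2_dvd_ap: "[ap (- c) = 1 + 2 * h\<^sup>2 * k] (mod 4 * h ^ 3) \<Longrightarrow> h dvd c"
  and four_h3_dvd_ap: "[ap (- c) = 1] (mod 4 * h ^ 3) \<Longrightarrow> 2 * h\<^sup>2 dvd c"
proof -
  have t: "2 * t2 (- c) = c * (c + 1)" using t2[of "- c"] by (simp add: algebra_simps)
  have ap: "ap (- c) = 1 - 2 * h * (c * (l * (1 - h * l * (c + 1))))"
    unfolding ap_def u_def using t by Groebner_Basis.algebra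
  have odd: "odd (l * (1 - h * l * (c + 1)))" using l even_h by simp
  {
    assume "[ap (- c) = 1 + 2 * h\<^sup>2 * k] (mod 4 * h ^ 3)"
    then obtain r where "ap (- c) = 1 + 2 * h\<^sup>2 * k + 4 * h ^ 3 * r" by (metis cong_iff_lin cong_sym)
    then have "2 * h * (c * (l * (1 - h * l * (c + 1)))) = 2 * h * (h * (- k - 2 * h * r))"
      unfolding ap by Groebner_Basis.algebra
    then have "c * (l * (1 - h * l * (c + 1))) = h * (- k - 2 * h * r)" by (rule two_h_cancel)
    then show "h dvd c" using h_dvd_odd[OF odd] by (metis dvd_triv_left)
  }
  {
    assume "[ap (- c) = 1] (mod 4 * h ^ 3)"
    then obtain r where "ap (- c) = 1 + 4 * h ^ 3 * r" by (metis cong_iff_lin cong_sym)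
    then have "2 * h * (c * (l * (1 - h * l * (c + 1)))) = 2 * h * (2 * h\<^sup>2 * (- r))"
      unfolding ap by Groebner_Basis.algebra
    then have "c * (l * (1 - h * l * (c + 1))) = 2 * h\<^sup>2 * (- r)" by (rule two_h_cancel)
    then show "2 * h\<^sup>2 dvd c" using two_h2_dvd_odd[OF odd] by (metis dvd_triv_left)
  }
qed

text \<open>Up to a multiple of \<open>2 * h\<^sup>2\<close>, \<open>Sn 1 a\<close> is
  \<open>a\<close> times the odd number \<open>1 + h * l * (a - 1)\<close>.\<close>

lemma two_h2_dvd_Sn: "2 * h\<^sup>2 dvd Sn 1 a \<Longrightarrow> 2 * h\<^sup>2 dvd a"
proof -
  assume "2 * h\<^sup>2 dvd Sn 1 a"
  then obtain r where r: "Sn 1 a = 2 * h\<^sup>2 * r" ..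
  have t: "t2 (1 + 1) = 1" by (simp add: t2_def)
  have "a * (1 + h * l * (a - 1)) = 2 * h\<^sup>2 * (r - t3 a)"
    using r t2[of a] unfolding Sn_def t u_def by Groebner_Basis.algebra
  moreover have "odd (1 + h * l * (a - 1))" using even_h by simp
  ultimately show ?thesis using two_h2_dvd_odd by (metis dvd_triv_left)
qed

lemma ap_h: "\<exists>k. ap (h * j) = 1 + 2 * h\<^sup>2 * k"
  by (rule exI[of _ "l * j + 2 * l\<^sup>2 * t2 (h * j)"]) (simp add: ap_def u_def algebra_simps power2_eq_square)

lemma ap_mod_two_h2: "\<exists>k. ap n = 1 + 2 * h * l * n + 2 * h\<^sup>2 * k"
  by (rule exI[of _ "2 * l\<^sup>2 * t2 n"]) (simp add: ap_def u_def algebra_simps power2_eq_square)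

text \<open>This is the exponent of \<open>A\<close> in the commutator of \<open>A ^ n\<close> and
  \<open>B\<close> (\<open>comm_A_pow_B\<close>). The formula shows it to be divisible by
  \<open>2 * h\<close> for odd \<open>n\<close>, and by \<open>2 * h\<^sup>2\<close> if
  \<open>n\<close> is 0 or 1 modulo \<open>2 * h\<close>.\<close>

lemma sg_minus: "sg n - n * ap n = h * l * n * (1 - n) + 2 * h\<^sup>2 * (2 * l\<^sup>2 * (t3 (n + 1) - n * t2 n))"
  unfolding sg_def ap_def u_def using t2[of "n + 1"] by Groebner_Basis.algebra

end

context macdonald
begin

lemma AC_mult_A_B: "A [^] (n::int) \<otimes> B = B \<otimes> A [^] n \<otimes> (C [^] n \<otimes> A [^] (sg n - n * ap n))"
proof -
  have "A [^] n \<otimes> (C [^] n \<otimes> A [^] (sg n - n * ap n)) = C [^] n \<otimes> A [^] (n * ap n + (sg n - n * ap n))"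
    unfolding int_pow_mult[OF A_closed] by (simp add: A_C flip: m_assoc)
  then show ?thesis by (simp add: A_B m_assoc)
qed

lemma comm_A_pow_B: "grp_comm G (A [^] (n::int)) B = C [^] n \<otimes> A [^] (sg n - n * ap n)"
  by (rule comm_unique) (simp_all add: AC_mult_A_B)

lemma B_central: "g \<in> carrier G \<Longrightarrow> B [^] (2 * h\<^sup>2 * r) \<otimes> g = g \<otimes> B [^] (2 * h\<^sup>2 * r)"
  using A_2h2_central[of g "- r"] by (simp add: B_2h2)

end

context macdonald_faithful
begin

lemma nf_eqD:
  assumes "nf a c b = nf a' c' b'"
  shows "[b = b'] (mod 2 * h\<^sup>2)" "[c = c'] (mod 2 * h\<^sup>2)" "[a - b + h * c = a' - b' + h * c'] (mod 4 * h ^ 3)"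
  using key_nf[OF assms] unfolding key_eq_iff by auto

lemma A_pow_eq_iff: "A [^] (i::int) = A [^] (j::int) \<longleftrightarrow> [i = j] (mod 4 * h ^ 3)"
  using nf_eqD(3)[of i 0 0 j 0 0] A_cong[of i j] by (auto simp: nf_def)

text \<open>Commuting with \<open>A\<close> removes \<open>B\<close>, through the exponent of
  \<open>C\<close>, and then \<open>C\<close>, through \<open>ap\<close>; commuting with
  \<open>B\<close> restricts the remaining power of \<open>A\<close> through
  \<open>Sn 1\<close>.\<close>

lemma central_subset:
  assumes "g \<in> upper_central G 1" shows "\<exists>k. g = A [^] (2 * h\<^sup>2 * k)"
proof -
  have g: "g \<in> carrier G" "\<And>x. x \<in> carrier G \<Longrightarrow> g \<otimes> x = x \<otimes> g"
    using assms mem_upper_central_Suc'[of g 0] by (auto simp: inv_solve_right')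
  obtain a c b where nf: "g = nf a c b" using nf_surj[OF g(1)] .
  have "nf (a + ap (- c)) (c - b) (sg b) = nf (1 + a) c b"
    using g(2)[of A] A_nf[of 1] by (simp add: nf nf_A)
  then have "[c - b = c] (mod 2 * h\<^sup>2)" by (rule nf_eqD)
  then have "[b = 0] (mod 2 * h\<^sup>2)" by (simp add: cong_iff_dvd_diff)
  then have nf: "g = nf (a - b) c 0" unfolding nf by (intro nf_eqI) auto
  define a' where "a' = a - b"
  have "nf (a' + ap (- c)) c 0 = nf (1 + a') c 0"
    using g(2)[of A] A_nf[of 1] by (simp add: nf a'_def[symmetric] nf_A)
  then have "[a' + ap (- c) - 0 + h * c = 1 + a' - 0 + h * c] (mod 4 * h ^ 3)" by (rule nf_eqD)
  then have "[ap (- c) = 1] (mod 4 * h ^ 3)"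
    by (simp add: cong_iff_dvd_diff)
  then have "2 * h\<^sup>2 dvd c" by (rule four_h3_dvd_ap)
  then have nf: "g = nf (a' + h * c) 0 0" unfolding nf a'_def[symmetric] by (intro nf_eqI) (auto simp: cong_0_iff)
  define n where "n = a' + h * c"
  have "nf n 0 1 = nf (an 1 n) (- Sn 1 n) (bn 1 n)"
    using g(2)[of B] B_A_pow[of 1 n] nf_B[of n 0 0 1] by (simp add: nf n_def[symmetric]) (simp add: nf_def)
  then have "[0 = - Sn 1 n] (mod 2 * h\<^sup>2)" by (rule nf_eqD)
  then have "2 * h\<^sup>2 dvd Sn 1 n" by (simp add: cong_iff_dvd_diff)
  then have "2 * h\<^sup>2 dvd n" by (rule two_h2_dvd_Sn)
  then show ?thesis using nf unfolding n_def[symmetric] by (auto simp: nf_def dvd_def)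
qed

lemma upper_central_1: "upper_central G 1 = range (\<lambda>k. A [^] (2 * h\<^sup>2 * k))"
proof
  show "upper_central G 1 \<subseteq> range (\<lambda>k. A [^] (2 * h\<^sup>2 * k))" using central_subset by blast
  show "range (\<lambda>k. A [^] (2 * h\<^sup>2 * k)) \<subseteq> upper_central G 1"
  proof
    fix g assume "g \<in> range (\<lambda>k. A [^] (2 * h\<^sup>2 * k))"
    then obtain k where k: "g = A [^] (2 * h\<^sup>2 * k)" by blast
    have "g \<otimes> x \<otimes> inv (x \<otimes> g) = \<one>" if "x \<in> carrier G" for x
      using that A_2h2_central[of x k] by (simp add: k)
    then show "g \<in> upper_central G 1"
      using mem_upper_central_Suc'[of g 0] by (simp add: k)
  qed
qed

text \<open>The comparison of \<open>central_subset\<close>, now up to a central factor. That factor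
  weakens the condition on \<open>ap (- c)\<close> to one modulo \<open>2 * h\<^sup>2\<close>, which
  yields only \<open>h dvd c\<close>.\<close>

lemma upper_central_2_subset:
  assumes "g \<in> upper_central G 2" shows "\<exists>i j. g = A [^] (2 * h\<^sup>2 * i) \<otimes> C [^] (h * j)"
proof -
  have g: "g \<in> carrier G" using assms upper_central_normal normal_imp_subgroup subgroup.subset by blast
  have comm: "\<exists>k. g \<otimes> x = A [^] (2 * h\<^sup>2 * k) \<otimes> (x \<otimes> g)" if "x \<in> carrier G" for x
  proof -
    have "g \<otimes> x \<otimes> inv (x \<otimes> g) \<in> upper_central G 1"
      using assms that mem_upper_central_Suc'[of g 1] by (simp add: numeral_2_eq_2)
    then obtain k where "g \<otimes> x \<otimes> inv (x \<otimes> g) = A [^] (2 * h\<^sup>2 * k)" unfolding upper_central_1 by blast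
    then show ?thesis using g that by (intro exI[of _ k]) (simp add: inv_solve_right')
  qed
  obtain a c b where nf: "g = nf a c b" using nf_surj[OF g] .
  obtain k where "g \<otimes> A = A [^] (2 * h\<^sup>2 * k) \<otimes> (A \<otimes> g)" using comm[of A] by auto
  then have eq: "nf (a + ap (- c)) (c - b) (sg b) = nf (2 * h\<^sup>2 * k + (1 + a)) c b"
    using A_nf[of 1] by (simp add: nf nf_A A_nf)
  then have "[c - b = c] (mod 2 * h\<^sup>2)" by (rule nf_eqD)
  then have "[b = 0] (mod 2 * h\<^sup>2)" by (simp add: cong_iff_dvd_diff)
  then have nf: "g = nf (a - b) c 0" unfolding nf by (intro nf_eqI) auto
  define a' where "a' = a - b"
  obtain k where "g \<otimes> A = A [^] (2 * h\<^sup>2 * k) \<otimes> (A \<otimes> g)" using comm[of A] by auto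
  then have "nf (a' + ap (- c)) c 0 = nf (2 * h\<^sup>2 * k + (1 + a')) c 0"
    using A_nf[of 1] by (simp add: nf a'_def[symmetric] nf_A A_nf)
  then have "[a' + ap (- c) - 0 + h * c = 2 * h\<^sup>2 * k + (1 + a') - 0 + h * c] (mod 4 * h ^ 3)" by (rule nf_eqD)
  then have "[ap (- c) = 1 + 2 * h\<^sup>2 * k] (mod 4 * h ^ 3)"
    by (simp add: cong_iff_dvd_diff algebra_simps)
  then have "h dvd c" by (rule two_h2_dvd_ap)
  then obtain j where j: "c = h * j" ..
  obtain k where "g \<otimes> B = A [^] (2 * h\<^sup>2 * k) \<otimes> (B \<otimes> g)" using comm[of B] by auto
  moreover have "B \<otimes> g = nf (an 1 a') (- Sn 1 a' + c) (bn 1 a' * ap (- c))"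
  proof -
    have "B \<otimes> g = B [^] (1::int) \<otimes> A [^] a' \<otimes> C [^] c"
      by (simp add: nf a'_def[symmetric]) (simp add: nf_def m_assoc)
    then show ?thesis by (simp only: B_A_pow nf_C)
  qed
  ultimately have "nf a' c 1 = nf (2 * h\<^sup>2 * k + an 1 a') (- Sn 1 a' + c) (bn 1 a' * ap (- c))"
    using nf_B[of a' c 0 1] by (simp add: nf a'_def[symmetric] A_nf)
  then have "[c = - Sn 1 a' + c] (mod 2 * h\<^sup>2)" by (rule nf_eqD)
  then have "2 * h\<^sup>2 dvd Sn 1 a'" by (simp add: cong_iff_dvd_diff)
  then have "2 * h\<^sup>2 dvd a'" by (rule two_h2_dvd_Sn)
  then obtain i where "a' = 2 * h\<^sup>2 * i" ..
  then show ?thesis using nf j unfolding a'_def[symmetric] by (auto simp: nf_def)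
qed

lemma A_2h2_upper_central: "A [^] (2 * h\<^sup>2 * i) \<in> upper_central G 1"
  unfolding upper_central_1 by blast

lemma upper_central_mono: "upper_central G 1 \<subseteq> upper_central G 2"
proof
  fix g assume "g \<in> upper_central G 1"
  then obtain k where k: "g = A [^] (2 * h\<^sup>2 * k)" unfolding upper_central_1 by blast
  have one: "\<one> \<in> upper_central G 1" using A_2h2_upper_central[of 0] by simp
  have "g \<in> upper_central G (Suc 1)"
    unfolding mem_upper_central_Suc'
  proof (intro conjI ballI)
    fix x assume "x \<in> carrier G"
    then have "g \<otimes> x \<otimes> inv (x \<otimes> g) = \<one>"
      using A_2h2_central[of x k] by (simp add: k)
    then show "g \<otimes> x \<otimes> inv (x \<otimes> g) \<in> upper_central G 1" using one by (simp only:)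
  qed (simp add: k)
  then show "g \<in> upper_central G 2" by (simp only: Suc_1)
qed

text \<open>By \<open>ap_h\<close> the exponents \<open>ap (h * j)\<close> and
  \<open>ap (- (h * j))\<close> are 1 modulo \<open>2 * h\<^sup>2\<close>, so this power of
  \<open>C\<close> commutes with \<open>A\<close> and \<open>B\<close> up to central powers.\<close>

lemma C_h_upper_central: "C [^] (h * j) \<in> upper_central G 2"
  unfolding numeral_2_eq_2
proof (rule mem_upper_central_generateI[OF _ gen])
  fix s assume "s \<in> {A, B}"
  then consider "s = A" | "s = B" by blast
  then have "\<exists>k. C [^] (h * j) \<otimes> s = A [^] (2 * h\<^sup>2 * k) \<otimes> (s \<otimes> C [^] (h * j))"
  proof cases
    case 1
    obtain k where k: "ap (- (h * j)) = 2 * h\<^sup>2 * k + 1" using ap_h[of "- j"] by (metis add.commute mult_minus_right)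
    have "C [^] (h * j) \<otimes> A [^] (1::int) = A [^] (2 * h\<^sup>2 * k) \<otimes> A [^] (1::int) \<otimes> C [^] (h * j)"
      unfolding C_A by (simp add: k int_pow_mult)
    then show ?thesis using 1 by (auto simp: m_assoc)
  next
    case 2
    obtain k where k: "ap (h * j) = 2 * h\<^sup>2 * k + 1" using ap_h[of j] by (metis add.commute)
    have "C [^] (h * j) \<otimes> B [^] (1::int) = B [^] (2 * h\<^sup>2 * k) \<otimes> B [^] (1::int) \<otimes> C [^] (h * j)"
      unfolding C_B by (simp add: k int_pow_mult)
    then show ?thesis using 2 by (intro exI[of _ "- k"]) (simp add: B_2h2 m_assoc)
  qed
  then obtain k where "C [^] (h * j) \<otimes> s = A [^] (2 * h\<^sup>2 * k) \<otimes> (s \<otimes> C [^] (h * j))" by blast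
  then have "C [^] (h * j) \<otimes> s \<otimes> inv (s \<otimes> C [^] (h * j)) = A [^] (2 * h\<^sup>2 * k)"
    using \<open>s \<in> {A, B}\<close> by (auto simp: m_assoc r_inv)
  then show "C [^] (h * j) \<otimes> s \<otimes> inv (s \<otimes> C [^] (h * j)) \<in> upper_central G (Suc 0)"
    using A_2h2_upper_central by simp
qed simp_all

lemma upper_central_2: "upper_central G 2 = range (\<lambda>(i, j). A [^] (2 * h\<^sup>2 * i) \<otimes> C [^] (h * j))"
proof
  show "upper_central G 2 \<subseteq> range (\<lambda>(i, j). A [^] (2 * h\<^sup>2 * i) \<otimes> C [^] (h * j))"
    using upper_central_2_subset by fastforce
  have "subgroup (upper_central G 2) G" by (rule normal_imp_subgroup[OF upper_central_normal])
  then show "range (\<lambda>(i, j). A [^] (2 * h\<^sup>2 * i) \<otimes> C [^] (h * j)) \<subseteq> upper_central G 2"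
    using A_2h2_upper_central upper_central_mono C_h_upper_central by (auto intro: subgroup.m_closed)
qed

lemma C_h_central_iff: "C [^] (h * j) \<in> upper_central G 1 \<longleftrightarrow> 2 * h dvd j"
proof
  assume "C [^] (h * j) \<in> upper_central G 1"
  then obtain k where "C [^] (h * j) = A [^] (2 * h\<^sup>2 * k)" unfolding upper_central_1 by blast
  then have "nf 0 (h * j) 0 = nf (2 * h\<^sup>2 * k) 0 0" by (simp add: nf_def)
  then have "[h * j = 0] (mod 2 * h\<^sup>2)" by (rule nf_eqD)
  then have "h * (2 * h) dvd h * j" by (simp add: cong_0_iff power2_eq_square mult_ac)
  then show "2 * h dvd j" using h_pos by simp
next
  assume "2 * h dvd j"
  then obtain r where "j = 2 * h * r" ..
  then have "C [^] (h * j) = A [^] (2 * h\<^sup>2 * (h * r))"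
    using C_2h2[of r] by (simp add: power2_eq_square power3_eq_cube mult_ac)
  then show "C [^] (h * j) \<in> upper_central G 1" using A_2h2_upper_central by simp
qed

text \<open>Here and in \<open>upper_central_factor_1\<close> the factor is cyclic of order
  \<open>2 * h\<close>, whatever \<open>l\<close> is. It is coordinatised by the integers, ready for
  \<open>iso_by_index\<close>.\<close>

lemma upper_central_factor_0:
  "\<exists>p. range p = carrier (upper_central_factor G 0) \<and> (\<forall>x y. p x = p y \<longleftrightarrow> 2 * h dvd x - y) \<and>
    (\<forall>x y. p x \<otimes>\<^bsub>upper_central_factor G 0\<^esub> p y = p (x + y :: int))"
proof (rule exI[of _ "\<lambda>k. {A [^] (2 * h\<^sup>2 * k)}"], intro conjI allI)
  let ?p = "\<lambda>k. {A [^] (2 * h\<^sup>2 * k)}"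
  have c: "{\<one>} #>\<^bsub>G\<lparr>carrier := U\<rparr>\<^esub> g = {g}" if "g \<in> carrier G" for g U using that by (simp add: r_coset_def)
  show "range ?p = carrier (upper_central_factor G 0)"
  proof -
    have "carrier (upper_central_factor G 0) = (\<lambda>g. {\<one>} #>\<^bsub>G\<lparr>carrier := upper_central G 1\<rparr>\<^esub> g) ` upper_central G 1"
      by (simp add: upper_central_factor_def carrier_FactGroup)
    also have "\<dots> = range ?p" unfolding upper_central_1 image_image by (simp add: r_coset_def)
    finally show ?thesis ..
  qed
  show "?p x = ?p y \<longleftrightarrow> 2 * h dvd x - y" for x y
  proof -
    have M: "4 * h ^ 3 = 2 * h\<^sup>2 * (2 * h)" by (simp add: power2_eq_square power3_eq_cube)
    have "?p x = ?p y \<longleftrightarrow> 2 * h\<^sup>2 * (2 * h) dvd 2 * h\<^sup>2 * (x - y)"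
      using A_pow_eq_iff[of "2 * h\<^sup>2 * x" "2 * h\<^sup>2 * y"] unfolding cong_iff_dvd_diff right_diff_distrib M by blast
    also have "\<dots> \<longleftrightarrow> 2 * h dvd x - y" unfolding dvd_mult_cancel_left using h_pos by simp
    finally show ?thesis .
  qed
  show "?p x \<otimes>\<^bsub>upper_central_factor G 0\<^esub> ?p y = ?p (x + y)" for x y
    by (simp add: upper_central_factor_def set_mult_def distrib_left int_pow_mult)
qed

lemma upper_central_factor_1:
  "\<exists>p. range p = carrier (upper_central_factor G 1) \<and> (\<forall>x y. p x = p y \<longleftrightarrow> 2 * h dvd x - y) \<and>
    (\<forall>x y. p x \<otimes>\<^bsub>upper_central_factor G 1\<^esub> p y = p (x + y :: int))"
proof (rule exI[of _ "\<lambda>k. upper_central G 1 #> C [^] (h * k)"], intro conjI allI)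
  let ?Z = "upper_central G 1"
  let ?p = "\<lambda>k. ?Z #> C [^] (h * k)"
  interpret Z: normal ?Z G by (rule upper_central_normal)
  have c: "?Z #>\<^bsub>G\<lparr>carrier := U\<rparr>\<^esub> g = ?Z #> g" for g U by (simp add: r_coset_def)
  have abs: "?Z #> (A [^] (2 * h\<^sup>2 * i) \<otimes> C [^] (h * j)) = ?p j" for i j
  proof -
    have "A [^] (2 * h\<^sup>2 * i) \<otimes> C [^] (h * j) \<otimes> inv (C [^] (h * j)) \<in> ?Z"
      using A_2h2_upper_central by (simp add: m_assoc)
    then show ?thesis
      by (rule r_coset_eq_iff[OF upper_central_normal _ _, THEN iffD2, rotated 2]) simp_all
  qed
  show "range ?p = carrier (upper_central_factor G 1)"
  proof -
    have "carrier (upper_central_factor G 1) = (\<lambda>g. ?Z #> g) ` upper_central G 2"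
      by (simp add: upper_central_factor_def carrier_FactGroup c numeral_2_eq_2)
    also have "\<dots> = range (\<lambda>x :: int \<times> int. ?p (snd x))"
      unfolding upper_central_2 by (simp only: image_image split_beta abs)
    also have "\<dots> = ?p ` range (snd :: int \<times> int \<Rightarrow> int)" by (simp only: image_image)
    also have "\<dots> = range ?p" by simp
    finally show ?thesis ..
  qed
  show "?p x = ?p y \<longleftrightarrow> 2 * h dvd x - y" for x y
  proof -
    have "?p x = ?p y \<longleftrightarrow> C [^] (h * x) \<otimes> inv (C [^] (h * y)) \<in> ?Z"
      by (rule r_coset_eq_iff[OF upper_central_normal]) simp_all
    also have "C [^] (h * x) \<otimes> inv (C [^] (h * y)) = C [^] (h * (x - y))"
      by (simp add: int_pow_diff right_diff_distrib)
    finally show ?thesis unfolding C_h_central_iff .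
  qed
  show "?p x \<otimes>\<^bsub>upper_central_factor G 1\<^esub> ?p y = ?p (x + y)" for x y
  proof -
    have "set_mult (G\<lparr>carrier := U\<rparr>) H K = H <#> K" for U H K by (simp add: set_mult_def)
    then show ?thesis
      using Z.rcos_sum[of "C [^] (h * x)" "C [^] (h * y)"]
      by (simp add: upper_central_factor_def distrib_left int_pow_mult)
  qed
qed

end

lemma upper_central_factor_01_iso:
  assumes "macdonald_faithful m l G A B" "macdonald_faithful m l' G' A' B'" "i < 2"
  shows "upper_central_factor G i \<cong> upper_central_factor G' i"
proof -
  interpret G: macdonald_faithful m l G A B by (rule assms)
  interpret G': macdonald_faithful m l' G' A' B' by (rule assms)
  consider "i = 0" | "i = 1" using assms(3) by linarith
  then show ?thesis
  proof cases
    case 1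
    obtain p where p: "range p = carrier (upper_central_factor G 0)" "\<And>x y. p x = p y \<longleftrightarrow> 2 * G.h dvd x - y"
      "\<And>x y. p x \<otimes>\<^bsub>upper_central_factor G 0\<^esub> p y = p (x + y :: int)"
      using G.upper_central_factor_0 by blast
    obtain q where q: "range q = carrier (upper_central_factor G' 0)" "\<And>x y. q x = q y \<longleftrightarrow> 2 * G.h dvd x - y"
      "\<And>x y. q x \<otimes>\<^bsub>upper_central_factor G' 0\<^esub> q y = q (x + y :: int)"
      using G'.upper_central_factor_0 by blast
    show ?thesis
      unfolding 1 by (rule iso_by_index[OF p(1) q(1) _ p(3) q(3)]) (simp only: p(2) q(2))
  next
    case 2
    obtain p where p: "range p = carrier (upper_central_factor G 1)" "\<And>x y. p x = p y \<longleftrightarrow> 2 * G.h dvd x - y"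
      "\<And>x y. p x \<otimes>\<^bsub>upper_central_factor G 1\<^esub> p y = p (x + y :: int)"
      using G.upper_central_factor_1 by blast
    obtain q where q: "range q = carrier (upper_central_factor G' 1)" "\<And>x y. q x = q y \<longleftrightarrow> 2 * G.h dvd x - y"
      "\<And>x y. q x \<otimes>\<^bsub>upper_central_factor G' 1\<^esub> q y = q (x + y :: int)"
      using G'.upper_central_factor_1 by blast
    show ?thesis
      unfolding 2 by (rule iso_by_index[OF p(1) q(1) _ p(3) q(3)]) (simp only: p(2) q(2))
  qed
qed

section \<open>The derived subgroup and its independence of the parameter\<close>

context macdonald_param
begin

lemma an_mod: "[an b n = n] (mod 2 * h)"
proof (rule congI)
  show "an b n = n + 2 * h * (l * b * t2 n
      + 2 * h * l\<^sup>2 * (t3 n * (t2 (b + 1) + b\<^sup>2) + t2 n * (t2 (b + 1) - b)))"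
    unfolding an_def u_def by Groebner_Basis.algebra
qed

lemma bn_mod: "[bn b n = b] (mod 2 * h)"
proof (rule congI)
  show "bn b n = b + 2 * h * (n * l * t2 (b + 1) + 2 * n * h * l\<^sup>2 * t3 (b + 1)
     + h * l\<^sup>2 * t2 n * t2 (b + 1) * (2 * b + 1) + h\<^sup>2 * t3 n * t2 (b + 1))"
    unfolding bn_def u_def by Groebner_Basis.algebra
qed

lemma ap_mod: "[ap k = 1] (mod 2 * h)"
proof (rule congI)
  show "ap k = 1 + 2 * h * (l * k + 2 * h * l\<^sup>2 * t2 k)"
    unfolding ap_def u_def by Groebner_Basis.algebra
qed

lemma h_dvd_t3: "\<exists>z. t3 (2 * h * i) = h * z"
  using t3_shift[of 0 i] by (auto simp: t3_def)

text \<open>All correction terms in the product of a \<open>2 * h\<close>-th power of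
  \<open>B\<close> with one of \<open>A\<close> carry the full modulus, so such powers commute
  (\<open>B_A_commute\<close>).\<close>

lemma coset_commute:
  "[an (2 * h * j) (2 * h * i) = 2 * h * i] (mod 4 * h ^ 3)"
  "[Sn (2 * h * j) (2 * h * i) = 0] (mod 4 * h\<^sup>2)"
  "[bn (2 * h * j) (2 * h * i) = 2 * h * j] (mod 4 * h ^ 3)"
proof -
  obtain z where z: "t3 (2 * h * i) = h * z" using h_dvd_t3 by blast
  have t: "t2 (2 * h * i) = h * (i * (2 * h * i - 1))" using t2[of "2 * h * i"] by Groebner_Basis.algebra
  obtain T where T: "t2 (2 * h * j + 1) = h * T" using t2_shift[of 1 j] by (auto simp: t2_def add.commute)
  obtain S where S: "t3 (2 * h * j + 1) = h * S" using t3_shift[of 1 j] by (auto simp: t3_def add.commute)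
  obtain g where g: "h = 2 * g" using even_h by blast
  show "[an (2 * h * j) (2 * h * i) = 2 * h * i] (mod 4 * h ^ 3)"
  proof (rule congI)
    show "an (2 * h * j) (2 * h * i) = 2 * h * i + 4 * h ^ 3 * (l * j * (i * (2 * h * i - 1))
      + l\<^sup>2 * (z * (h * T + 4 * h\<^sup>2 * j\<^sup>2) + i * (2 * h * i - 1) * (h * T - 2 * h * j)))"
      unfolding an_def z t T u_def by Groebner_Basis.algebra
  qed
  show "[Sn (2 * h * j) (2 * h * i) = 0] (mod 4 * h\<^sup>2)"
  proof (rule congI)
    show "Sn (2 * h * j) (2 * h * i) = 0 + 4 * h\<^sup>2 * (i * j + g * l * T * (i * (2 * h * i - 1)) + g * z * h * T)"
      unfolding Sn_def z t T u_def using g by Groebner_Basis.algebra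
  qed
  show "[bn (2 * h * j) (2 * h * i) = 2 * h * j] (mod 4 * h ^ 3)"
  proof (rule congI)
    show "bn (2 * h * j) (2 * h * i) = 2 * h * j + 4 * h ^ 3 * (i * l * T + 2 * h * i * l\<^sup>2 * S
      + g * l\<^sup>2 * (i * (2 * h * i - 1)) * T * (2 * (2 * h * j) + 1) + g * z * h * T)"
      unfolding bn_def z t T S u_def using g by Groebner_Basis.algebra
  qed
qed

lemma odd_inverse:
  assumes "odd n" shows "\<exists>n'. [n * n' = 1] (mod 4 * h ^ 3)"
proof -
  have "4 * h ^ 3 = 2 ^ (2 + (m - 1) * 3)" unfolding h_def by (simp add: power_add power_mult)
  then have "coprime n (4 * h ^ 3)" using coprime_two_power_odd[OF assms] by (metis coprime_commute)
  then show ?thesis by (rule cong_solve_coprime_int)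
qed

lemma l_inverse': "\<exists>i. [l * i = 1] (mod 4 * h ^ 3)"
  using l by (rule odd_inverse)

end

context macdonald
begin

text \<open>Unlike in \<open>nf\<close>, \<open>C\<close> stands last: the powers of
  \<open>A\<close> and \<open>B\<close> in front form an abelian group on which \<open>C\<close>
  acts, so the product rule \<open>df_mult\<close> is that of a semidirect product.\<close>

definition df :: "int \<Rightarrow> int \<Rightarrow> int \<Rightarrow> 'a" where
  "df i j k = A [^] (2 * h * i) \<otimes> B [^] (2 * h * j) \<otimes> C [^] k"

lemma df_closed [simp]: "df i j k \<in> carrier G" by (simp add: df_def)

lemma df_nf: "df i j k = nf (2 * h * i) k (2 * h * j * ap (- k))"
  by (simp add: df_def nf_def m_assoc B_C)

lemma B_A_commute: "B [^] (2 * h * j) \<otimes> A [^] (2 * h * i) = A [^] (2 * h * i) \<otimes> B [^] (2 * h * j)"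
proof -
  have "B [^] (2 * h * j) \<otimes> A [^] (2 * h * i) = nf (2 * h * i) 0 (2 * h * j)"
    unfolding B_A_pow
    by (intro nf_cong coset_commute) (use coset_commute(2)[of j i] in \<open>simp add: cong_minus_minus_iff[of _ 0, simplified]\<close>)
  then show ?thesis by (simp add: nf_def)
qed

lemma df_mult: "df i j k \<otimes> df i' j' k' = df (i + i' * ap (- k)) (j + j' * ap k) (k + k')"
proof -
  have "df i j k \<otimes> df i' j' k' = A [^] (2 * h * i) \<otimes> (B [^] (2 * h * j) \<otimes> (C [^] k \<otimes> A [^] (2 * h * i')) \<otimes> B [^] (2 * h * j') \<otimes> C [^] k')"
    by (simp add: df_def m_assoc)
  also have "C [^] k \<otimes> A [^] (2 * h * i') = A [^] (2 * h * (i' * ap (- k))) \<otimes> C [^] k"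
    unfolding C_A by (simp add: mult.assoc)
  also have "B [^] (2 * h * j) \<otimes> (A [^] (2 * h * (i' * ap (- k))) \<otimes> C [^] k) \<otimes> B [^] (2 * h * j') \<otimes> C [^] k'
    = (B [^] (2 * h * j) \<otimes> A [^] (2 * h * (i' * ap (- k)))) \<otimes> (C [^] k \<otimes> B [^] (2 * h * j')) \<otimes> C [^] k'"
    by (simp add: m_assoc)
  also have "C [^] k \<otimes> B [^] (2 * h * j') = B [^] (2 * h * (j' * ap k)) \<otimes> C [^] k"
    unfolding C_B by (simp add: mult.assoc)
  also have "A [^] (2 * h * i) \<otimes> (B [^] (2 * h * j) \<otimes> A [^] (2 * h * (i' * ap (- k))) \<otimes> (B [^] (2 * h * (j' * ap k)) \<otimes> C [^] k) \<otimes> C [^] k')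
    = df (i + i' * ap (- k)) (j + j' * ap k) (k + k')"
    unfolding B_A_commute df_def by (simp add: m_assoc int_pow_mult_left int_pow_mult[symmetric] distrib_left)
  finally show ?thesis .
qed

lemma nf_mult_mod: "\<exists>x y z. nf a c b \<otimes> nf a' c' b' = nf x y z \<and> [x = a + a'] (mod 2 * h) \<and> [z = b + b'] (mod 2 * h)"
proof (intro exI conjI)
  show "nf a c b \<otimes> nf a' c' b' = nf (a + an b a' * ap (- c)) (c - Sn b a' + c') (bn b a' * ap (- c') + b')"
    by (rule nf_mult)
  have "[an b a' * ap (- c) = a' * 1] (mod 2 * h)" by (intro cong_mult an_mod ap_mod)
  then show "[a + an b a' * ap (- c) = a + a'] (mod 2 * h)" by (simp add: cong_add_lcancel)
  have "[bn b a' * ap (- c') = b * 1] (mod 2 * h)" by (intro cong_mult bn_mod ap_mod)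
  then show "[bn b a' * ap (- c') + b' = b + b'] (mod 2 * h)" by (simp add: cong_add_rcancel)
qed

text \<open>The commutator of \<open>A\<close> and \<open>C\<close> is \<open>A ^ u\<close> with
  \<open>u = 2 * h * l\<close>, and \<open>l\<close> is invertible modulo the order bound of
  \<open>A\<close>.\<close>

lemma A_2h_derived: "A [^] (2 * h * i) \<in> derived G (carrier G)" and C_derived: "C [^] (k::int) \<in> derived G (carrier G)"
proof -
  have sub: "subgroup (derived G (carrier G)) G" using derived_is_subgroup[of "carrier G"] by simp
  have comm: "grp_comm G x y \<in> derived G (carrier G)" if "x \<in> carrier G" "y \<in> carrier G" for x y
  proof -
    have "grp_comm G x y = inv x \<otimes> inv y \<otimes> inv (inv x) \<otimes> inv (inv y)" using that by (simp add: grp_comm_def)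
    then have "grp_comm G x y \<in> derived_set G (carrier G)"
      by (intro UN_I[of "inv x"] UN_I[of "inv y"]) (simp_all add: that)
    then show ?thesis unfolding derived_def by (rule generate.incl)
  qed
  show "C [^] k \<in> derived G (carrier G)"
    using subgroup_int_pow_closed[OF sub] comm[of A B] by (simp add: C_def)
  have "grp_comm G A C = A [^] u"
  proof (rule comm_unique)
    show "C \<otimes> A \<otimes> A [^] u = A \<otimes> C" using int_pow_mult[of A 1 u] by (simp add: AC m_assoc)
  qed simp_all
  then have u: "A [^] u \<in> derived G (carrier G)" using comm[of A C] by simp
  obtain r where r: "[l * r = 1] (mod 4 * h ^ 3)" using l_inverse' by blast
  have "(A [^] u) [^] (r * i) = A [^] (2 * h * i)"
    unfolding int_pow_pow[OF A_closed]
  proof (rule A_cong)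
    have "[l * r * (2 * h * i) = 1 * (2 * h * i)] (mod 4 * h ^ 3)" by (rule cong_scalar_right[OF r])
    then show "[u * (r * i) = 2 * h * i] (mod 4 * h ^ 3)" by (simp add: u_def mult_ac)
  qed
  then show "A [^] (2 * h * i) \<in> derived G (carrier G)"
    using subgroup_int_pow_closed[OF sub u, of "r * i"] by simp
qed

lemma range_df_subset: "df i j k \<in> derived G (carrier G)"
proof -
  have sub: "subgroup (derived G (carrier G)) G" using derived_is_subgroup[of "carrier G"] by simp
  show ?thesis unfolding df_def
    by (intro subgroup.m_closed[OF sub] A_2h_derived C_derived macdonald.A_2h_derived[OF swap])
qed

end

context macdonald_faithful
begin

lemma nf_eq_mod:
  assumes "nf a c b = nf a' c' b'"
  shows "[a = a'] (mod 2 * h)" "[b = b'] (mod 2 * h)"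
proof -
  obtain r where r: "b = b' + 2 * h\<^sup>2 * r" using nf_eqD(1)[OF assms] by (metis cong_iff_lin cong_sym)
  obtain s where s: "c = c' + 2 * h\<^sup>2 * s" using nf_eqD(2)[OF assms] by (metis cong_iff_lin cong_sym)
  obtain t where t: "a - b + h * c = a' - b' + h * c' + 4 * h ^ 3 * t" using nf_eqD(3)[OF assms] by (metis cong_iff_lin cong_sym)
  show "[b = b'] (mod 2 * h)" unfolding r by (rule congI[where k = "h * r"]) Groebner_Basis.algebra
  show "[a = a'] (mod 2 * h)"
    by (rule congI[where k = "h * r - h\<^sup>2 * s + 2 * h\<^sup>2 * t"]) (use r s t in Groebner_Basis.algebra)
qed

text \<open>Modulo \<open>2 * h\<close> the exponents of \<open>A\<close> and \<open>B\<close> are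
  well defined and additive (\<open>nf_eq_mod\<close>, \<open>nf_mult_mod\<close>), so they vanish
  on commutators.\<close>

lemma commutator_in_range_df:
  assumes "g \<in> carrier G" "k \<in> carrier G"
  shows "\<exists>i j n. g \<otimes> k \<otimes> inv g \<otimes> inv k = df i j n"
proof -
  let ?c = "g \<otimes> k \<otimes> inv g \<otimes> inv k"
  obtain a c b where g: "g = nf a c b" using nf_surj[OF assms(1)] .
  obtain a' c' b' where k: "k = nf a' c' b'" using nf_surj[OF assms(2)] .
  obtain x y z where xyz: "?c = nf x y z" using nf_surj[of ?c] assms by blast
  obtain p q r where kg: "k \<otimes> g = nf p q r" "[p = a' + a] (mod 2 * h)" "[r = b' + b] (mod 2 * h)"
    using nf_mult_mod unfolding g k by metis
  obtain p' q' r' where gk: "g \<otimes> k = nf p' q' r'" "[p' = a + a'] (mod 2 * h)" "[r' = b + b'] (mod 2 * h)"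
    using nf_mult_mod unfolding g k by metis
  obtain s t v where ckg: "?c \<otimes> (k \<otimes> g) = nf s t v" "[s = x + p] (mod 2 * h)" "[v = z + r] (mod 2 * h)"
    using nf_mult_mod unfolding xyz kg by metis
  have "?c \<otimes> (k \<otimes> g) = g \<otimes> k"
    using assms by (simp add: m_assoc) (simp flip: m_assoc)
  then have e: "nf s t v = nf p' q' r'" using ckg gk by simp
  have "[x + p = 0 + p] (mod 2 * h)"
    using nf_eq_mod(1)[OF e] ckg(2) kg(2) gk(2) by (metis add.commute add_0 cong_sym cong_trans)
  then have "2 * h dvd x" by (simp only: cong_add_rcancel cong_0_iff)
  moreover have "[z + r = 0 + r] (mod 2 * h)"
    using nf_eq_mod(2)[OF e] ckg(3) kg(3) gk(3) by (metis add.commute add_0 cong_sym cong_trans)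
  then have "2 * h dvd z" by (simp only: cong_add_rcancel cong_0_iff)
  ultimately obtain i j where "x = 2 * h * i" "z = 2 * h * j" by (metis dvdE)
  then have "?c = A [^] (2 * h * i) \<otimes> (C [^] y \<otimes> B [^] (2 * h * j))" by (simp add: xyz nf_def m_assoc)
  also have "\<dots> = df i (j * ap y) y" unfolding C_B df_def by (simp add: m_assoc mult.assoc)
  finally show ?thesis by blast
qed

lemma derived_eq: "derived G (carrier G) = range (\<lambda>(i, j, k). df i j k)"
proof
  show "range (\<lambda>(i, j, k). df i j k) \<subseteq> derived G (carrier G)" using range_df_subset by auto
  show "derived G (carrier G) \<subseteq> range (\<lambda>(i, j, k). df i j k)"
  proof
    fix g assume "g \<in> derived G (carrier G)"
    then have "\<exists>i j k. g = df i j k"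
      unfolding derived_def
    proof induction
      case one
      have "\<one> = df 0 0 0" by (simp add: df_def)
      then show ?case by blast
    next
      case (incl x)
      then obtain g k where gk: "g \<in> carrier G" "k \<in> carrier G" "x = g \<otimes> k \<otimes> inv g \<otimes> inv k" by blast
      show ?case unfolding gk(3) by (rule commutator_in_range_df[OF gk(1,2)])
    next
      case (inv x)
      then obtain g k where gk: "g \<in> carrier G" "k \<in> carrier G" "x = g \<otimes> k \<otimes> inv g \<otimes> inv k" by blast
      then have "inv x = k \<otimes> g \<otimes> inv k \<otimes> inv g" by (simp add: inv_mult_group m_assoc)
      then show ?case using commutator_in_range_df[OF gk(2,1)] by simp
    next
      case (eng x y)
      then obtain i j k i' j' k' where "x = df i j k" "y = df i' j' k'" by blast
      then show ?case using df_mult[of i j k i' j' k'] by blast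
    qed
    then obtain i j k where "g = df i j k" by blast
    then have "g = (\<lambda>(i, j, k). df i j k) (i, j, k)" by simp
    then show "g \<in> range (\<lambda>(i, j, k). df i j k)" by (rule range_eqI)
  qed
qed

lemma df_one_iff: "df i j k = \<one> \<longleftrightarrow> 2 * h\<^sup>2 dvd k \<and> h dvd j \<and> 4 * h\<^sup>2 dvd 2 * i - 2 * j + k"
proof -
  have e: "[2 * h * i - 2 * h * j * ap (- k) + h * k = h * (2 * i - 2 * j + k)] (mod 4 * h ^ 3)" if "2 * h\<^sup>2 dvd k"
  proof -
    have "[ap (- k) = 1] (mod 4 * h ^ 3)" using ap_cong[of "- k" 0] that by (simp add: cong_0_iff)
    then have "[2 * h * i - 2 * h * j * ap (- k) + h * k = 2 * h * i - 2 * h * j * 1 + h * k] (mod 4 * h ^ 3)"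
      by (intro cong_add cong_diff cong_mult cong_refl)
    then show ?thesis by (simp add: algebra_simps)
  qed
  have M: "4 * h ^ 3 = h * (4 * h\<^sup>2)" "2 * h\<^sup>2 = 2 * h * h" by (simp_all add: power2_eq_square power3_eq_cube)
  have d: "4 * h ^ 3 dvd h * x \<longleftrightarrow> 4 * h\<^sup>2 dvd x" for x
    unfolding M(1) dvd_mult_cancel_left using h_pos by simp
  have odd: "odd (ap (- k))" using ap_mod_two_h2[of "- k"] by auto
  have hj: "2 * h\<^sup>2 dvd 2 * h * j * ap (- k) \<longleftrightarrow> h dvd j"
    using h_pos h_dvd_odd[OF odd, of j] by (simp add: M(2) mult.assoc)
  show ?thesis
  proof
    assume "df i j k = \<one>"
    then have "nf (2 * h * i) k (2 * h * j * ap (- k)) = nf 0 0 0" by (simp add: df_nf)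
    note eq = nf_eqD[OF this]
    have k: "2 * h\<^sup>2 dvd k" using eq(2) by (simp add: cong_0_iff)
    have "[h * (2 * i - 2 * j + k) = 0] (mod 4 * h ^ 3)"
      using cong_trans[OF cong_sym[OF e[OF k]] eq(3)] by simp
    then show "2 * h\<^sup>2 dvd k \<and> h dvd j \<and> 4 * h\<^sup>2 dvd 2 * i - 2 * j + k"
      using k eq(1) hj d by (simp add: cong_0_iff)
  next
    assume *: "2 * h\<^sup>2 dvd k \<and> h dvd j \<and> 4 * h\<^sup>2 dvd 2 * i - 2 * j + k"
    have "nf (2 * h * i) k (2 * h * j * ap (- k)) = nf 0 0 0"
    proof (rule nf_eqI)
      have "[h * (2 * i - 2 * j + k) = 0] (mod 4 * h ^ 3)" using * d by (simp add: cong_0_iff)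
      then show "[2 * h * i - 2 * h * j * ap (- k) + h * k = 0 - 0 + h * 0] (mod 4 * h ^ 3)"
        using cong_trans[OF e] * by simp
    qed (use * hj in \<open>simp_all add: cong_0_iff\<close>)
    then show "df i j k = \<one>" by (simp add: df_nf)
  qed
qed

lemma df_eq_iff: "df i j k = df i' j' k' \<longleftrightarrow>
    2 * h\<^sup>2 dvd k - k' \<and> h dvd j - j' \<and> 4 * h\<^sup>2 dvd 2 * (i - i') - 2 * (j - j') + (k - k')"
proof -
  have "df (i - i') (j - j') (k - k') = A [^] (- (2 * h * i')) \<otimes> (B [^] (- (2 * h * j')) \<otimes> A [^] (2 * h * i)) \<otimes> (B [^] (2 * h * j) \<otimes> C [^] k) \<otimes> C [^] (- k')"
  proof -
    have "B [^] (- (2 * h * j')) \<otimes> A [^] (2 * h * i) = A [^] (2 * h * i) \<otimes> B [^] (- (2 * h * j'))"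
      using B_A_commute[of "- j'" i] by simp
    then show ?thesis
      by (simp add: df_def m_assoc int_pow_mult_left int_pow_mult[symmetric] right_diff_distrib add.commute)
  qed
  also have "\<dots> = A [^] (- (2 * h * i')) \<otimes> B [^] (- (2 * h * j')) \<otimes> df i j k \<otimes> C [^] (- k')"
    by (simp add: df_def m_assoc)
  finally have e: "df (i - i') (j - j') (k - k') = A [^] (- (2 * h * i')) \<otimes> B [^] (- (2 * h * j')) \<otimes> df i j k \<otimes> C [^] (- k')" .
  have one: "A [^] (- (2 * h * i')) \<otimes> B [^] (- (2 * h * j')) \<otimes> df i' j' k' \<otimes> C [^] (- k') = \<one>"
  proof -
    have "B [^] (- (2 * h * j')) \<otimes> A [^] (2 * h * i') = A [^] (2 * h * i') \<otimes> B [^] (- (2 * h * j'))"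
      using B_A_commute[of "- j'" i'] by simp
    then have "A [^] (- (2 * h * i')) \<otimes> (B [^] (- (2 * h * j')) \<otimes> A [^] (2 * h * i')) \<otimes> B [^] (2 * h * j') = \<one>"
      by (simp add: m_assoc int_pow_mult_left int_pow_mult[symmetric])
    then have "A [^] (- (2 * h * i')) \<otimes> (B [^] (- (2 * h * j')) \<otimes> A [^] (2 * h * i')) \<otimes> B [^] (2 * h * j') \<otimes> (C [^] k' \<otimes> C [^] (- k')) = \<one>"
      by (simp add: int_pow_mult[symmetric])
    then show ?thesis by (simp add: df_def m_assoc)
  qed
  have "df i j k = df i' j' k' \<longleftrightarrow> A [^] (- (2 * h * i')) \<otimes> B [^] (- (2 * h * j')) \<otimes> df i j k \<otimes> C [^] (- k') =
      A [^] (- (2 * h * i')) \<otimes> B [^] (- (2 * h * j')) \<otimes> df i' j' k' \<otimes> C [^] (- k')"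
    by simp
  also have "\<dots> \<longleftrightarrow> df (i - i') (j - j') (k - k') = \<one>" unfolding e one ..
  finally show ?thesis unfolding df_one_iff .
qed

lemma A_2h_cong: "[i = i'] (mod 2 * h\<^sup>2) \<Longrightarrow> [j = j'] (mod 2 * h\<^sup>2) \<Longrightarrow> df i j k = df i' j' k"
proof -
  assume a: "[i = i'] (mod 2 * h\<^sup>2)" "[j = j'] (mod 2 * h\<^sup>2)"
  obtain r where r: "i = i' + 2 * h\<^sup>2 * r" using a(1) by (metis cong_iff_lin cong_sym)
  obtain s where s: "j = j' + 2 * h\<^sup>2 * s" using a(2) by (metis cong_iff_lin cong_sym)
  have "2 * (i - i') - 2 * (j - j') + (k - k) = 4 * h\<^sup>2 * (r - s)" "j - j' = h * (2 * h * s)"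
    unfolding r s by Groebner_Basis.algebra+
  then show ?thesis unfolding df_eq_iff by (metis dvd_0_right cancel_comm_monoid_add_class.diff_cancel dvd_triv_left)
qed

end

text \<open>The element \<open>C\<close> of \<open>G\<close> corresponds to the \<open>n\<close>-th
  power of that of \<open>G'\<close>, where \<open>l' * n\<close> is congruent to \<open>l\<close>.
  The two actions then agree modulo \<open>2 * h\<^sup>2\<close>, which suffices on
  \<open>2 * h\<close>-th powers of elements whose order divides \<open>4 * h ^ 3\<close>.\<close>

lemma derived_iso_param:
  assumes "macdonald_faithful m l G A B" "macdonald_faithful m l' G' A' B'"
  shows "derived_subgroup G \<cong> derived_subgroup G'"
proof -
  interpret G: macdonald_faithful m l G A B by (rule assms)
  interpret G': macdonald_faithful m l' G' A' B' by (rule assms)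
  obtain r where r: "[l' * r = 1] (mod 4 * G.h ^ 3)" using G'.l_inverse' by blast
  define n where "n = l * r"
  have nl: "[l' * n = l] (mod 4 * G.h ^ 3)"
    using cong_scalar_right[OF r, of l] by (simp add: n_def mult_ac)
  have "2 * G.h dvd 4 * G.h ^ 3" by (simp add: power3_eq_cube)
  then have nl': "[l' * n = l] (mod 2 * G.h)" using nl cong_dvd_modulus by blast
  then have "[l' * n = l] (mod 2)" using cong_dvd_modulus[of "l' * n" l "2 * G.h" 2] by simp
  then have odd_n: "odd n" using G.l by (auto simp: cong_def)
  have ap: "[G'.ap (n * k) = G.ap k] (mod 2 * G.h\<^sup>2)" for k
  proof -
    obtain s where s: "l' * n = l + 2 * G.h * s" using nl' by (metis cong_iff_lin cong_sym)
    show ?thesis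
    proof (rule congI)
      show "G'.ap (n * k) = G.ap k + 2 * G.h\<^sup>2 * (2 * s * k + 2 * l'\<^sup>2 * t2 (n * k) - 2 * l\<^sup>2 * t2 k)"
        unfolding G.ap_def G'.ap_def G.u_def G'.u_def using s by Groebner_Basis.algebra
    qed
  qed
  let ?p = "\<lambda>(i, j, k). G.df i j k" and ?q = "\<lambda>(i, j, k). G'.df i j (n * k)"
  let ?f = "\<lambda>(i, j, k) (i', j', k'). (i + i' * G.ap (- k), j + j' * G.ap k, k + k')"
  have eq: "G.df i j k = G.df i' j' k' \<longleftrightarrow> G'.df i j (n * k) = G'.df i' j' (n * k')" for i j k i' j' k'
  proof -
    have 1: "2 * G.h\<^sup>2 dvd n * k - n * k' \<longleftrightarrow> 2 * G.h\<^sup>2 dvd k - k'"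
      using G.two_h2_dvd_odd[OF odd_n, of "k - k'"] by (simp add: right_diff_distrib mult.commute)
    \<comment> \<open>Replacing \<open>k\<close> by \<open>n * k\<close> does not disturb the last
      condition of \<open>df_eq_iff\<close>: an odd factor changes a multiple of
      \<open>2 * h\<^sup>2\<close> only by a multiple of \<open>4 * h\<^sup>2\<close>.\<close>
    have 2: "4 * G.h\<^sup>2 dvd x + (n * k - n * k') \<longleftrightarrow> 4 * G.h\<^sup>2 dvd x + (k - k')" if d: "2 * G.h\<^sup>2 dvd k - k'" for x
    proof -
      obtain t where t: "k - k' = 2 * G.h\<^sup>2 * t" using d ..
      obtain s where s: "n = 2 * s + 1" using odd_n by (metis oddE)
      have "x + (n * k - n * k') = x + (k - k') + 4 * G.h\<^sup>2 * (s * t)" using s t by Groebner_Basis.algebra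
      then show ?thesis by (simp only: dvd_add_left_iff dvd_triv_left)
    qed
    show ?thesis unfolding G.df_eq_iff G'.df_eq_iff 1 using 2 by blast
  qed
  have "range ?q = range (\<lambda>(i, j, k). G'.df i j k)"
  proof -
    obtain n' where "[n * n' = 1] (mod 4 * G.h ^ 3)" using G.odd_inverse[OF odd_n] by blast
    moreover have "4 * G.h\<^sup>2 dvd 4 * G.h ^ 3" by (simp add: le_imp_power_dvd)
    ultimately have n': "[n * n' = 1] (mod 4 * G.h\<^sup>2)" by (rule cong_dvd_modulus)
    have "G'.df i j k = ?q (i, j, n' * k)" for i j k
    proof -
      have "[n * (n' * k) = k] (mod 4 * G.h\<^sup>2)" using cong_scalar_right[OF n', of k] by (simp add: mult_ac)
      then show ?thesis unfolding G'.df_def using G'.C_cong by simp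
    qed
    then show ?thesis by (auto simp: image_iff) metis+
  qed
  then have q: "range ?q = carrier (derived_subgroup G')"
    by (simp add: derived_subgroup_def G'.derived_eq)
  have p: "range ?p = carrier (derived_subgroup G)"
    by (simp add: derived_subgroup_def G.derived_eq)
  show ?thesis
  proof (rule iso_by_index[OF p q, where f = ?f])
    fix x y :: "int \<times> int \<times> int"
    obtain i j k i' j' k' where xy: "x = (i, j, k)" "y = (i', j', k')" by (metis prod_cases3)
    show "?p x = ?p y \<longleftrightarrow> ?q x = ?q y" unfolding xy prod.case by (rule eq)
    show "?p x \<otimes>\<^bsub>derived_subgroup G\<^esub> ?p y = ?p (?f x y)"
      unfolding xy prod.case by (simp add: derived_subgroup_def G.df_mult)
    have "G'.df (i + i' * G'.ap (- (n * k))) (j + j' * G'.ap (n * k)) (n * k + n * k') =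
        G'.df (i + i' * G.ap (- k)) (j + j' * G.ap k) (n * k + n * k')"
      by (rule G'.A_2h_cong[OF cong_add[OF cong_refl cong_scalar_left[OF ap[of "- k", unfolded mult_minus_right]]]
          cong_add[OF cong_refl cong_scalar_left[OF ap[of k]]]])
    then show "?q x \<otimes>\<^bsub>derived_subgroup G'\<^esub> ?q y = ?q (?f x y)"
      unfolding xy prod.case by (simp add: derived_subgroup_def G'.df_mult distrib_left)
  qed
qed

section \<open>Isomorphisms\<close>

lemma (in group) macdonald_pairI:
  assumes "x \<in> carrier G" "y \<in> carrier G" "w \<in> carrier G" "y \<otimes> x \<otimes> w = x \<otimes> y"
    and "x \<otimes> w = w \<otimes> x [^] \<alpha>" "w \<otimes> y = y [^] \<alpha> \<otimes> w"
    and "x [^] (2 ^ (3 * m - 1) :: nat) = \<one>" "y [^] (2 ^ (3 * m - 1) :: nat) = \<one>"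
  shows "macdonald_pair G m \<alpha> x y"
proof -
  have w: "grp_comm G x y = w" using assms by (intro comm_unique)
  have w': "grp_comm G y x = inv w" using comm_swap[of x y] assms(1,2) w by simp
  have "y \<otimes> inv w = inv w \<otimes> y [^] \<alpha>" by (rule mult_inv_swap[OF assms(3,2) int_pow_closed[OF assms(2)] assms(6)])
  then have "grp_conj G y (inv w) = y [^] \<alpha>"
    using grp_conj_eq_iff[of "inv w" y "y [^] \<alpha>"] assms(2,3) by blast
  moreover have "grp_conj G x w = x [^] \<alpha>" using assms(1,3,5) grp_conj_eq_iff[of w x "x [^] \<alpha>"] by blast
  ultimately show ?thesis unfolding macdonald_pair_def w w' using assms(1,2,7,8) by blast
qed

section \<open>Pairs consisting of a power of \<open>A\<close> and \<open>B\<close>, in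
  \<open>J2\<close> and modulo the second centre\<close>

context macdonald
begin

text \<open>The commutator of \<open>A ^ n\<close> and \<open>B\<close>, by
  \<open>comm_A_pow_B\<close>.\<close>

definition cw :: "int \<Rightarrow> 'a" where "cw n = C [^] n \<otimes> A [^] (sg n - n * ap n)"

lemma cw_closed [simp]: "cw n \<in> carrier G" by (simp add: cw_def)

lemma cw_comm: "B \<otimes> A [^] n \<otimes> cw n = A [^] n \<otimes> B"
  by (simp add: cw_def AC_mult_A_B)

lemma A_cw: "A [^] n \<otimes> cw n = cw n \<otimes> A [^] (n * ap n)"
proof -
  have "A [^] n \<otimes> cw n = C [^] n \<otimes> (A [^] (n * ap n) \<otimes> A [^] (sg n - n * ap n))"
    unfolding cw_def by (simp add: A_C flip: m_assoc)
  also have "\<dots> = C [^] n \<otimes> (A [^] (sg n - n * ap n) \<otimes> A [^] (n * ap n))"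
    unfolding int_pow_mult[OF A_closed, symmetric] by (simp add: add.commute)
  finally show ?thesis by (simp add: cw_def m_assoc)
qed

lemma A_pow_order: "(A [^] (n::int)) [^] (2 ^ (3 * m - 1) :: nat) = \<one>"
  and B_pow_order: "(B [^] (n::int)) [^] (2 ^ (3 * m - 1) :: nat) = \<one>"
proof -
  have *: "(x [^] (n::int)) [^] (2 ^ (3 * m - 1) :: nat) = \<one>" if "x \<in> carrier G" "x [^] (4 * h ^ 3) = \<one>" for x n
  proof -
    have "(x [^] n) [^] (2 ^ (3 * m - 1) :: nat) = (x [^] n) [^] (4 * h ^ 3)" unfolding four_h3 int_pow_int ..
    also have "\<dots> = (x [^] (4 * h ^ 3)) [^] n" using that(1) by (simp add: int_pow_pow mult.commute)
    finally show ?thesis using that by simp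
  qed
  show "(A [^] (n::int)) [^] (2 ^ (3 * m - 1) :: nat) = \<one>" by (rule *) (simp_all add: A_order)
  show "(B [^] (n::int)) [^] (2 ^ (3 * m - 1) :: nat) = \<one>" by (rule *) (simp_all add: macdonald.A_order[OF swap])
qed

text \<open>For \<open>n\<close> congruent to 1 modulo \<open>2 * h\<close>, \<open>t2 n\<close> is
  a multiple of \<open>h\<close>, so \<open>ap n\<close> reduces to \<open>1 + 2 * h * l'\<close>.
  Moreover \<open>cw n\<close> differs from \<open>C ^ n\<close> by a central factor and therefore
  acts on \<open>B\<close> as \<open>C ^ n\<close> does.\<close>

lemma central_pair:
  assumes n: "n = 1 + 2 * h * j" and l': "[l * n = l'] (mod 4 * h ^ 3)"
  shows "macdonald_pair G m (1 + 2 * h * l') (A [^] n) B"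
proof -
  have t: "t2 n = h * (j * (1 + 2 * h * j))" using t2[of n] unfolding n by Groebner_Basis.algebra
  obtain r where r: "l * n = l' + 4 * h ^ 3 * r" using l' by (metis cong_iff_lin cong_sym)
  have ap: "[ap n = 1 + 2 * h * l'] (mod 4 * h ^ 3)"
  proof (rule congI)
    show "ap n = 1 + 2 * h * l' + 4 * h ^ 3 * (2 * h * r + l\<^sup>2 * (j * (1 + 2 * h * j)))"
      unfolding ap_def t u_def using r by Groebner_Basis.algebra
  qed
  define z where "z = 2 * l\<^sup>2 * (t3 (n + 1) - n * t2 n) - l * n * j"
  have "sg n - n * ap n = 2 * h\<^sup>2 * z"
    unfolding sg_minus z_def using n by Groebner_Basis.algebra
  then have w: "cw n = C [^] n \<otimes> A [^] (2 * h\<^sup>2 * z)" by (simp add: cw_def)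
  show ?thesis
  proof (rule macdonald_pairI[where w = "cw n"])
    show "B \<otimes> A [^] n \<otimes> cw n = A [^] n \<otimes> B" by (rule cw_comm)
    have "[n * ap n = n * (1 + 2 * h * l')] (mod 4 * h ^ 3)" by (rule cong_scalar_left[OF ap])
    then show "A [^] n \<otimes> cw n = cw n \<otimes> (A [^] n) [^] (1 + 2 * h * l')"
      unfolding A_cw int_pow_pow[OF A_closed] using A_cong by simp
    have "cw n \<otimes> B = C [^] n \<otimes> (A [^] (2 * h\<^sup>2 * z) \<otimes> B)" by (simp add: w m_assoc)
    also have "\<dots> = C [^] n \<otimes> B [^] (1::int) \<otimes> A [^] (2 * h\<^sup>2 * z)"
      using A_2h2_central[of B z] by (simp add: m_assoc)
    also have "C [^] n \<otimes> B [^] (1::int) = B [^] (1 + 2 * h * l') \<otimes> C [^] n"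
      unfolding C_B using B_cong[OF ap] by simp
    finally show "cw n \<otimes> B = B [^] (1 + 2 * h * l') \<otimes> cw n" by (simp add: w m_assoc)
    show "(A [^] n) [^] (2 ^ (3 * m - 1) :: nat) = \<one>" by (rule A_pow_order)
    show "B [^] (2 ^ (3 * m - 1) :: nat) = \<one>" using B_pow_order[of 1] by simp
  qed simp_all
qed

text \<open>\<open>C ^ n\<close> multiplies exponents of \<open>A\<close> by a number congruent to 1
  modulo \<open>2 * h\<close>, so reordering a power costs only multiples of
  \<open>2 * h\<^sup>2\<close>. These vanish modulo the second centre.\<close>

lemma cw_pow:
  assumes "cw n = C [^] n \<otimes> A [^] (2 * h * r)"
  shows "\<exists>y. cw n [^] (k::int) = C [^] (n * k) \<otimes> A [^] (2 * h * r * k + 2 * h\<^sup>2 * y)"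
proof (induction k rule: int_induct[where k = 0])
  case base
  show ?case by (rule exI[of _ 0]) simp
next
  case (step1 k)
  then obtain y where y: "cw n [^] k = C [^] (n * k) \<otimes> A [^] (2 * h * r * k + 2 * h\<^sup>2 * y)" by blast
  obtain t where t: "ap n = 1 + 2 * h * t" using ap_mod[of n] by (metis cong_iff_lin cong_sym)
  have "cw n [^] (k + 1) = C [^] (n * k) \<otimes> (A [^] (2 * h * r * k + 2 * h\<^sup>2 * y) \<otimes> C [^] n) \<otimes> A [^] (2 * h * r)"
    by (simp add: int_pow_mult y) (simp add: assms m_assoc int_pow_mult)
  also have "\<dots> = C [^] (n * k + n) \<otimes> A [^] ((2 * h * r * k + 2 * h\<^sup>2 * y) * ap n + 2 * h * r)"
    unfolding A_C by (simp add: int_pow_mult m_assoc)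
  also have "(2 * h * r * k + 2 * h\<^sup>2 * y) * ap n + 2 * h * r = 2 * h * r * (k + 1) + 2 * h\<^sup>2 * (y + 2 * r * k * t + 2 * h * y * t)"
    unfolding t by Groebner_Basis.algebra
  finally have "cw n [^] (k + 1) = C [^] (n * (k + 1)) \<otimes> A [^] (2 * h * r * (k + 1) + 2 * h\<^sup>2 * (y + 2 * r * k * t + 2 * h * y * t))"
    by (simp only: distrib_left[of n k 1] mult_1_right)
  then show ?case by blast
next
  case (step2 k)
  then obtain y where y: "cw n [^] k = C [^] (n * k) \<otimes> A [^] (2 * h * r * k + 2 * h\<^sup>2 * y)" by blast
  obtain t where t: "ap (- n) = 1 + 2 * h * t" using ap_mod[of "- n"] by (metis cong_iff_lin cong_sym)
  have "cw n [^] (k - 1) = cw n [^] k \<otimes> inv (cw n)" by (simp add: int_pow_diff)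
  also have "inv (cw n) = A [^] (- (2 * h * r)) \<otimes> C [^] (- n)" by (simp add: assms inv_mult_group int_pow_neg)
  also have "cw n [^] k \<otimes> (A [^] (- (2 * h * r)) \<otimes> C [^] (- n)) = C [^] (n * k) \<otimes> (A [^] (2 * h * r * k + 2 * h\<^sup>2 * y - 2 * h * r) \<otimes> C [^] (- n))"
    unfolding y by (simp add: m_assoc int_pow_mult_left)
  also have "\<dots> = C [^] (n * k + - n) \<otimes> A [^] ((2 * h * r * k + 2 * h\<^sup>2 * y - 2 * h * r) * ap (- n))"
    unfolding A_C by (simp add: int_pow_mult_left del: add_uminus_conv_diff)
  also have "(2 * h * r * k + 2 * h\<^sup>2 * y - 2 * h * r) * ap (- n) = 2 * h * r * (k - 1) + 2 * h\<^sup>2 * (y + 2 * r * (k - 1) * t + 2 * h * y * t)"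
    unfolding t by Groebner_Basis.algebra
  finally have "cw n [^] (k - 1) = C [^] (n * (k - 1)) \<otimes> A [^] (2 * h * r * (k - 1) + 2 * h\<^sup>2 * (y + 2 * r * (k - 1) * t + 2 * h * y * t))"
    by (simp only: right_diff_distrib[of n k 1] mult_1_right add_uminus_conv_diff)
  then show ?case by blast
qed

end

context macdonald_faithful
begin

abbreviation "Z2 \<equiv> upper_central G 2"
abbreviation "KG \<equiv> G Mod upper_central G 2"
abbreviation "kq x \<equiv> upper_central G 2 #> x"

lemma kq_hom: "group_hom G KG (\<lambda>x. kq x)"
proof -
  interpret normal Z2 G by (rule upper_central_normal)
  interpret K: group KG by (rule factorgroup_is_group)
  show ?thesis using r_coset_hom_Mod by unfold_locales
qed

lemma Z2_mem: "A [^] (2 * h\<^sup>2 * i) \<otimes> C [^] (h * j) \<in> Z2"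
  unfolding upper_central_2 by auto

lemma kq_eqI:
  assumes "z \<in> Z2" "x = y \<otimes> z" "y \<in> carrier G" shows "kq x = kq y"
proof -
  interpret normal Z2 G by (rule upper_central_normal)
  have "z \<in> carrier G" using assms(1) by (rule mem_carrier)
  then have "x \<otimes> inv y \<in> Z2" using assms inv_op_closed2[of y z] by simp
  moreover have "x \<in> carrier G" using assms \<open>z \<in> carrier G\<close> by simp
  ultimately show ?thesis using r_coset_eq_iff[OF upper_central_normal] assms(3) by blast
qed

text \<open>Modulo the second centre it is enough that \<open>n\<close> is odd: the quadratic term
  of \<open>ap n\<close> is a multiple of \<open>2 * h\<^sup>2\<close>, and the factor
  \<open>A ^ (2 * h * r)\<close> of \<open>cw n\<close> commutes with \<open>B\<close> up to
  \<open>Z2\<close>.\<close>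

lemma kq_pair:
  assumes n: "odd n" and l': "[l * n = l'] (mod 4 * h ^ 3)"
  shows "macdonald_pair KG m (1 + 2 * h * l') (kq (A [^] n)) (kq B)"
    and "\<exists>r. cw n = C [^] n \<otimes> A [^] (2 * h * r)"
proof -
  interpret q: group_hom G KG "\<lambda>x. kq x" by (rule kq_hom)
  interpret Z: normal Z2 G by (rule upper_central_normal)
  obtain s where s: "n = 2 * s + 1" using n by (metis oddE)
  define r where "r = h * (2 * l\<^sup>2 * (t3 (n + 1) - n * t2 n)) - l * n * s"
  have "sg n - n * ap n = 2 * h * r" unfolding sg_minus r_def using s by Groebner_Basis.algebra
  then have w: "cw n = C [^] n \<otimes> A [^] (2 * h * r)" by (simp add: cw_def)
  then show "\<exists>r. cw n = C [^] n \<otimes> A [^] (2 * h * r)" by blast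
  obtain p where p: "l * n = l' + 4 * h ^ 3 * p" using l' by (metis cong_iff_lin cong_sym)
  obtain k where k: "ap n = 1 + 2 * h * l' + 2 * h\<^sup>2 * k"
  proof -
    obtain k where "ap n = 1 + 2 * h * l * n + 2 * h\<^sup>2 * k" using ap_mod_two_h2 by blast
    then have "ap n = 1 + 2 * h * l' + 2 * h\<^sup>2 * (k + 4 * h\<^sup>2 * p)" using p by Groebner_Basis.algebra
    then show thesis by (rule that)
  qed
  show "macdonald_pair KG m (1 + 2 * h * l') (kq (A [^] n)) (kq B)"
  proof (rule q.H.macdonald_pairI[where w = "kq (cw n)"])
    show "kq B \<otimes>\<^bsub>KG\<^esub> kq (A [^] n) \<otimes>\<^bsub>KG\<^esub> kq (cw n) = kq (A [^] n) \<otimes>\<^bsub>KG\<^esub> kq B"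
      by (simp only: q.hom_mult[symmetric] m_closed A_closed B_closed cw_closed int_pow_closed cw_comm)
    have "kq (A [^] n \<otimes> cw n) = kq (cw n \<otimes> (A [^] n) [^] (1 + 2 * h * l'))"
    proof (rule kq_eqI)
      show "A [^] (2 * h\<^sup>2 * (k * n)) \<in> Z2" using Z2_mem[of "k * n" 0] by simp
      have "n * ap n = n * (1 + 2 * h * l') + 2 * h\<^sup>2 * (k * n)" unfolding k by (simp add: algebra_simps)
      then show "A [^] n \<otimes> cw n = cw n \<otimes> (A [^] n) [^] (1 + 2 * h * l') \<otimes> A [^] (2 * h\<^sup>2 * (k * n))"
        unfolding A_cw int_pow_pow[OF A_closed] by (simp only: int_pow_mult[OF A_closed] m_assoc cw_closed int_pow_closed A_closed)
    qed simp
    then show "kq (A [^] n) \<otimes>\<^bsub>KG\<^esub> kq (cw n) = kq (cw n) \<otimes>\<^bsub>KG\<^esub> kq (A [^] n) [^]\<^bsub>KG\<^esub> (1 + 2 * h * l')"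
      by (simp only: q.hom_mult q.hom_int_pow cw_closed int_pow_closed A_closed)
    have "kq (cw n \<otimes> B) = kq (B [^] (1 + 2 * h * l') \<otimes> cw n)"
    proof -
      \<comment> \<open>From \<open>sg_minus\<close> at \<open>2 * h * r\<close>: the commutator of
        \<open>A ^ (2 * h * r)\<close> and \<open>B\<close> is a power of \<open>C ^ h\<close> times
        a central power of \<open>A\<close>.\<close>
      define v where "v = l * r * (1 - 2 * h * r) + 2 * l\<^sup>2 * (t3 (2 * h * r + 1) - 2 * h * r * t2 (2 * h * r))"
      have v: "sg (2 * h * r) - 2 * h * r * ap (2 * h * r) = 2 * h\<^sup>2 * v"
        unfolding sg_minus v_def by Groebner_Basis.algebra
      have "cw n \<otimes> B = C [^] n \<otimes> (A [^] (2 * h * r) \<otimes> B)" by (simp add: w m_assoc)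
      also have "\<dots> = (C [^] n \<otimes> B [^] (1::int)) \<otimes> A [^] (2 * h * r) \<otimes> (C [^] (2 * h * r) \<otimes> A [^] (2 * h\<^sup>2 * v))"
        unfolding AC_mult_A_B v by (simp add: m_assoc)
      also have "C [^] n \<otimes> B [^] (1::int) = B [^] (1 + 2 * h * l') \<otimes> B [^] (2 * h\<^sup>2 * k) \<otimes> C [^] n"
        unfolding C_B k by (simp add: int_pow_mult)
      also have "B [^] (1 + 2 * h * l') \<otimes> B [^] (2 * h\<^sup>2 * k) \<otimes> C [^] n \<otimes> A [^] (2 * h * r) \<otimes> (C [^] (2 * h * r) \<otimes> A [^] (2 * h\<^sup>2 * v))
        = B [^] (1 + 2 * h * l') \<otimes> (B [^] (2 * h\<^sup>2 * k) \<otimes> cw n) \<otimes> (C [^] (2 * h * r) \<otimes> A [^] (2 * h\<^sup>2 * v))"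
        by (simp add: w m_assoc)
      also have "B [^] (2 * h\<^sup>2 * k) \<otimes> cw n = cw n \<otimes> B [^] (2 * h\<^sup>2 * k)" by (simp add: B_central)
      finally have e: "cw n \<otimes> B = B [^] (1 + 2 * h * l') \<otimes> cw n \<otimes> (B [^] (2 * h\<^sup>2 * k) \<otimes> (C [^] (2 * h * r) \<otimes> A [^] (2 * h\<^sup>2 * v)))"
        by (simp add: m_assoc)
      show ?thesis
      proof (rule kq_eqI[OF _ e])
        have "B [^] (2 * h\<^sup>2 * k) \<in> Z2" using Z2_mem[of "- k" 0] by (simp add: B_2h2)
        moreover have "C [^] (2 * h * r) \<in> Z2" using Z2_mem[of 0 "2 * r"] by (simp add: mult_ac)
        moreover have "A [^] (2 * h\<^sup>2 * v) \<in> Z2" using Z2_mem[of v 0] by simp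
        ultimately show "B [^] (2 * h\<^sup>2 * k) \<otimes> (C [^] (2 * h * r) \<otimes> A [^] (2 * h\<^sup>2 * v)) \<in> Z2" by (intro Z.m_closed)
      qed simp
    qed
    then show "kq (cw n) \<otimes>\<^bsub>KG\<^esub> kq B = kq B [^]\<^bsub>KG\<^esub> (1 + 2 * h * l') \<otimes>\<^bsub>KG\<^esub> kq (cw n)"
      by (simp only: q.hom_mult q.hom_int_pow cw_closed int_pow_closed B_closed)
    show "kq (A [^] n) [^]\<^bsub>KG\<^esub> (2 ^ (3 * m - 1) :: nat) = \<one>\<^bsub>KG\<^esub>"
      using A_pow_order[of n] q.hom_nat_pow[of "A [^] n" "2 ^ (3 * m - 1)"] q.hom_one by simp
    show "kq B [^]\<^bsub>KG\<^esub> (2 ^ (3 * m - 1) :: nat) = \<one>\<^bsub>KG\<^esub>"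
      using B_pow_order[of 1] q.hom_nat_pow[of B "2 ^ (3 * m - 1)"] q.hom_one by simp
  qed (simp_all only: q.hom_closed A_closed B_closed cw_closed int_pow_closed)
qed

end

lemma K_iso_param:
  assumes "macdonald_faithful m l G A B" "macdonald_faithful m l' G' A' B'"
    and n: "odd n" and l': "[l * n = l'] (mod 4 * macdonald_param.h m ^ 3)"
    and \<phi>: "\<phi> \<in> hom G' (G Mod upper_central G 2)"
      "\<phi> A' = upper_central G 2 #>\<^bsub>G\<^esub> (A [^]\<^bsub>G\<^esub> n)" "\<phi> B' = upper_central G 2 #>\<^bsub>G\<^esub> B"
  shows "G' Mod upper_central G' 2 \<cong> G Mod upper_central G 2"
proof -
  interpret G: macdonald_faithful m l G A B by (rule assms)
  interpret G': macdonald_faithful m l' G' A' B' by (rule assms)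
  interpret q: group_hom G G.KG "\<lambda>x. G.kq x" by (rule G.kq_hom)
  interpret f: group_hom G' G.KG \<phi> using \<phi>(1) by unfold_locales
  interpret Z: normal G.Z2 G by (rule G.upper_central_normal)
  interpret Z': normal G'.Z2 G' by (rule G'.upper_central_normal)
  obtain r where r: "G.cw n = G.C [^]\<^bsub>G\<^esub> n \<otimes>\<^bsub>G\<^esub> A [^]\<^bsub>G\<^esub> (2 * G.h * r)" using G.kq_pair(2)[OF n l'] by blast
  have C': "\<phi> G'.C = G.kq (G.cw n)"
  proof -
    have "\<phi> G'.C = grp_comm G.KG (G.kq (A [^]\<^bsub>G\<^esub> n)) (G.kq B)"
      unfolding G'.C_def \<phi>(2,3)[symmetric] by (rule f.hom_grp_comm) simp_all
    also have "\<dots> = G.kq (grp_comm G (A [^]\<^bsub>G\<^esub> n) B)" by (rule q.hom_grp_comm[symmetric]) simp_all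
    finally show ?thesis by (simp add: G.comm_A_pow_B G.cw_def)
  qed
  have nf': "\<exists>t. \<phi> (G'.nf x c y) = G.kq (G.nf (n * x + (2 * G.h * r * c + 2 * G.h\<^sup>2 * t) * G.ap (- (n * c))) (n * c) y)" for x c y
  proof -
    obtain t where t: "G.cw n [^]\<^bsub>G\<^esub> c = G.C [^]\<^bsub>G\<^esub> (n * c) \<otimes>\<^bsub>G\<^esub> A [^]\<^bsub>G\<^esub> (2 * G.h * r * c + 2 * G.h\<^sup>2 * t)"
      using G.cw_pow[OF r] by blast
    have "\<phi> (G'.nf x c y) = G.kq ((A [^]\<^bsub>G\<^esub> n) [^]\<^bsub>G\<^esub> x \<otimes>\<^bsub>G\<^esub> G.cw n [^]\<^bsub>G\<^esub> c \<otimes>\<^bsub>G\<^esub> B [^]\<^bsub>G\<^esub> y)"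
      unfolding G'.nf_def
      by (simp only: f.hom_mult f.hom_int_pow \<phi> C' q.hom_mult q.hom_int_pow G'.A_closed G'.B_closed G'.C_closed
          G'.int_pow_closed G'.m_closed G.A_closed G.B_closed G.cw_closed G.int_pow_closed G.m_closed)
    also have "(A [^]\<^bsub>G\<^esub> n) [^]\<^bsub>G\<^esub> x \<otimes>\<^bsub>G\<^esub> G.cw n [^]\<^bsub>G\<^esub> c \<otimes>\<^bsub>G\<^esub> B [^]\<^bsub>G\<^esub> y
      = G.nf (n * x + (2 * G.h * r * c + 2 * G.h\<^sup>2 * t) * G.ap (- (n * c))) (n * c) y"
      unfolding t G.C_A G.nf_def by (simp add: G.int_pow_pow G.int_pow_mult G.m_assoc)
    finally show ?thesis by blast
  qed
  have surj: "\<phi> ` carrier G' = carrier G.KG"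
  proof
    show "carrier G.KG \<subseteq> \<phi> ` carrier G'"
    proof
      fix y assume "y \<in> carrier G.KG"
      then obtain g where g: "g \<in> carrier G" "y = G.kq g" by (auto simp: carrier_FactGroup)
      have sub: "subgroup (\<phi> ` carrier G') G.KG" by (rule f.img_is_subgroup)
      obtain n' where n': "[n * n' = 1] (mod 4 * G.h ^ 3)" using G.odd_inverse[OF n] by blast
      have "(A [^]\<^bsub>G\<^esub> n) [^]\<^bsub>G\<^esub> n' = A" using G.A_cong[OF n'] by (simp add: G.int_pow_pow)
      then have "G.kq A = \<phi> (A' [^]\<^bsub>G'\<^esub> n')"
        using q.hom_int_pow[of "A [^]\<^bsub>G\<^esub> n" n'] f.hom_int_pow[of A' n'] \<phi>(2) by simp
      then have gens: "G.kq A \<in> \<phi> ` carrier G'" "G.kq B \<in> \<phi> ` carrier G'" using \<phi>(3) by (auto simp: image_iff)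
      have "g \<in> generate G {A, B}" using g G.gen by simp
      then have "G.kq g \<in> \<phi> ` carrier G'"
      proof induction
        case one
        then show ?case using subgroup.one_closed[OF sub] q.hom_one by (simp only:)
      next
        case (incl x)
        then show ?case using gens by blast
      next
        case (inv x)
        then have "x \<in> carrier G" "G.kq x \<in> \<phi> ` carrier G'" using gens by auto
        then show ?case using subgroup.m_inv_closed[OF sub] q.hom_inv[of x] by (simp only:)
      next
        case (eng x y)
        then have "x \<in> carrier G" "y \<in> carrier G" using G.gen by auto
        then show ?case using subgroup.m_closed[OF sub] eng q.hom_mult[of x y] by (simp only:)
      qed
      then show "y \<in> \<phi> ` carrier G'" using g by simp
    qed
  qed auto
  have "kernel G' G.KG \<phi> = G'.Z2"
  proof
    show "G'.Z2 \<subseteq> kernel G' G.KG \<phi>"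
    proof
      fix g assume g: "g \<in> G'.Z2"
      then obtain i j where ij: "g = A' [^]\<^bsub>G'\<^esub> (2 * G.h\<^sup>2 * i) \<otimes>\<^bsub>G'\<^esub> G'.C [^]\<^bsub>G'\<^esub> (G.h * j)"
        unfolding G'.upper_central_2 by auto
      then have "g = G'.nf (2 * G.h\<^sup>2 * i) (G.h * j) 0" by (simp add: G'.nf_def)
      then obtain t where t: "\<phi> g = G.kq (G.nf (n * (2 * G.h\<^sup>2 * i) + (2 * G.h * r * (G.h * j) + 2 * G.h\<^sup>2 * t) * G.ap (- (n * (G.h * j)))) (n * (G.h * j)) 0)"
        using nf'[of "2 * G.h\<^sup>2 * i" "G.h * j" 0] by auto
      have "n * (2 * G.h\<^sup>2 * i) + (2 * G.h * r * (G.h * j) + 2 * G.h\<^sup>2 * t) * G.ap (- (n * (G.h * j))) =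
          2 * G.h\<^sup>2 * (n * i + (r * j + t) * G.ap (- (n * (G.h * j))))"
        by Groebner_Basis.algebra
      then have "\<phi> g = G.kq (A [^]\<^bsub>G\<^esub> (2 * G.h\<^sup>2 * (n * i + (r * j + t) * G.ap (- (n * (G.h * j))))) \<otimes>\<^bsub>G\<^esub> G.C [^]\<^bsub>G\<^esub> (G.h * (n * j)))"
        unfolding t by (simp add: G.nf_def mult.left_commute)
      also have "\<dots> = G.Z2" using G.Z2_mem Z.subset by (intro G.coset_join2[OF _ Z.subgroup_axioms]) auto
      finally show "g \<in> kernel G' G.KG \<phi>" using Z'.mem_carrier[OF g] by (simp add: kernel_def)
    qed
    show "kernel G' G.KG \<phi> \<subseteq> G'.Z2"
    proof
      fix g assume "g \<in> kernel G' G.KG \<phi>"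
      then have g: "g \<in> carrier G'" "\<phi> g = G.Z2" by (auto simp: kernel_def)
      obtain x c y where nf: "g = G'.nf x c y" using G'.nf_surj[OF g(1)] .
      obtain t where "\<phi> g = G.kq (G.nf (n * x + (2 * G.h * r * c + 2 * G.h\<^sup>2 * t) * G.ap (- (n * c))) (n * c) y)"
        using nf' nf by blast
      then have "G.nf (n * x + (2 * G.h * r * c + 2 * G.h\<^sup>2 * t) * G.ap (- (n * c))) (n * c) y \<in> G.Z2"
        using g(2) by (intro G.coset_join1[OF _ _ Z.subgroup_axioms]) auto
      then obtain i j where "G.nf (n * x + (2 * G.h * r * c + 2 * G.h\<^sup>2 * t) * G.ap (- (n * c))) (n * c) y = A [^]\<^bsub>G\<^esub> (2 * G.h\<^sup>2 * i) \<otimes>\<^bsub>G\<^esub> G.C [^]\<^bsub>G\<^esub> (G.h * j)"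
        unfolding G.upper_central_2 by auto
      then have e: "G.nf (n * x + (2 * G.h * r * c + 2 * G.h\<^sup>2 * t) * G.ap (- (n * c))) (n * c) y = G.nf (2 * G.h\<^sup>2 * i) (G.h * j) 0"
        by (simp add: G.nf_def)
      obtain y1 where y1: "y = 2 * G.h\<^sup>2 * y1" using G.nf_eqD(1)[OF e] by (auto simp: cong_0_iff dvd_def)
      obtain p where p: "n * c = G.h * j + 2 * G.h\<^sup>2 * p" using G.nf_eqD(2)[OF e] by (metis cong_iff_lin cong_sym)
      then have "c * n = G.h * (j + 2 * G.h * p)" by Groebner_Basis.algebra
      then have "G.h dvd c" using G.h_dvd_odd[OF n] by (metis dvd_triv_left)
      then obtain c1 where c1: "c = G.h * c1" ..
      obtain s where s: "n * x + (2 * G.h * r * c + 2 * G.h\<^sup>2 * t) * G.ap (- (n * c)) - y + G.h * (n * c)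
          = 2 * G.h\<^sup>2 * i - 0 + G.h * (G.h * j) + 4 * G.h ^ 3 * s"
        using G.nf_eqD(3)[OF e] by (metis cong_iff_lin cong_sym)
      have "x * n = 2 * G.h\<^sup>2 * (i + 2 * G.h * s + y1 - G.h * p - (r * c1 + t) * G.ap (- (n * c)))"
        using s p y1 c1 by Groebner_Basis.algebra
      then have "2 * G.h\<^sup>2 dvd x" using G.two_h2_dvd_odd[OF n] by (metis dvd_triv_left)
      then obtain x1 where x1: "x = 2 * G.h\<^sup>2 * x1" ..
      have "g = (A' [^]\<^bsub>G'\<^esub> (2 * G.h\<^sup>2 * x1) \<otimes>\<^bsub>G'\<^esub> G'.C [^]\<^bsub>G'\<^esub> (G.h * c1)) \<otimes>\<^bsub>G'\<^esub> (A' [^]\<^bsub>G'\<^esub> (2 * G.h\<^sup>2 * - y1) \<otimes>\<^bsub>G'\<^esub> G'.C [^]\<^bsub>G'\<^esub> (G.h * 0))"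
        unfolding nf G'.nf_def x1 c1 y1 G'.B_2h2 by simp
      then show "g \<in> G'.Z2" using G'.Z2_mem by (simp only: Z'.m_closed)
    qed
  qed
  then show ?thesis using f.FactGroup_iso_set[OF surj] by (auto simp: is_iso_def)
qed

section \<open>The two groups for \<open>m = 2\<close>, by explicit products of normal forms\<close>

lemma (in macdonald) nf_mult_eqI:
  assumes "[bn b a' * ap (- c') + b' = z] (mod 2 * h\<^sup>2)" "[c - Sn b a' + c' = y] (mod 2 * h\<^sup>2)"
    "[(a + an b a' * ap (- c)) - (bn b a' * ap (- c') + b') + h * (c - Sn b a' + c') = x - z + h * y] (mod 4 * h ^ 3)"
  shows "nf a c b \<otimes> nf a' c' b' = nf x y z"
  unfolding nf_mult using assms by (rule nf_eqI)


text \<open>With \<open>h = 2\<close> every product of normal forms is a check on numerals. The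
  element \<open>nf 24 7 4\<close> is the commutator of the two proposed generators, and their
  powers are found by repeated doubling.\<close>

lemma (in macdonald) pair_5_13:
  assumes "m = 2" "l = 1"
  shows "macdonald_pair G m 13 (A \<otimes> B [^] (2::int)) (B [^] (7::int))"
proof -
  note num = an_def Sn_def bn_def ap_def t2_def t3_def u_def h_def cong_def
  have x: "A \<otimes> B [^] (2::int) = nf 1 0 2" and y: "B [^] (7::int) = nf 0 0 7" by (simp_all add: nf_def)
  have e1: "nf 1 0 2 \<otimes> nf 0 0 7 = nf 25 0 1"
    by (rule nf_mult_eqI; simp only: num; simp add: assms)
  have e2: "nf 0 0 7 \<otimes> nf 1 0 2 = nf 25 1 1"
    by (rule nf_mult_eqI; simp only: num; simp add: assms)
  have e3: "nf 25 1 1 \<otimes> nf 24 7 4 = nf 25 0 1"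
    by (rule nf_mult_eqI; simp only: num; simp add: assms)
  have e4: "nf 1 0 2 \<otimes> nf 24 7 4 = nf 17 7 6"
    by (rule nf_mult_eqI; simp only: num; simp add: assms)
  have e5: "nf 1 0 2 \<otimes> nf 1 0 2 = nf 18 6 0"
    by (rule nf_mult_eqI; simp only: num; simp add: assms)
  have e6: "nf 18 6 0 \<otimes> nf 18 6 0 = nf 4 4 0"
    by (rule nf_mult_eqI; simp only: num; simp add: assms)
  have e7: "nf 4 4 0 \<otimes> nf 4 4 0 = nf 24 0 0"
    by (rule nf_mult_eqI; simp only: num; simp add: assms)
  have e8: "nf 24 0 0 \<otimes> nf 24 0 0 = nf 16 0 0"
    by (rule nf_mult_eqI; simp only: num; simp add: assms)
  have e9: "nf 16 0 0 \<otimes> nf 16 0 0 = nf 0 0 0"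
    by (rule nf_mult_eqI; simp only: num; simp add: assms)
  have e10: "nf 24 0 0 \<otimes> nf 4 4 0 = nf 28 4 0"
    by (rule nf_mult_eqI; simp only: num; simp add: assms)
  have e11: "nf 28 4 0 \<otimes> nf 1 0 2 = nf 13 4 2"
    by (rule nf_mult_eqI; simp only: num; simp add: assms)
  have e12: "nf 24 7 4 \<otimes> nf 13 4 2 = nf 17 7 6"
    by (rule nf_mult_eqI; simp only: num; simp add: assms)
  have e13: "nf 24 7 4 \<otimes> nf 0 0 7 = nf 16 7 3"
    by (rule nf_mult_eqI; simp only: num; simp add: assms)
  have e14: "nf 0 0 91 \<otimes> nf 24 7 4 = nf 16 7 3"
    by (rule nf_mult_eqI; simp only: num; simp add: assms)
  have dbl: "nf 1 0 2 [^] (2 * k) = nf 1 0 2 [^] k \<otimes> nf 1 0 2 [^] k" for k :: int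
    by (simp add: int_pow_mult[symmetric])
  have p2: "nf 1 0 2 [^] (2::int) = nf 1 0 2 \<otimes> nf 1 0 2" using dbl[of 1] by simp
  have p4: "nf 1 0 2 [^] (4::int) = nf 4 4 0" using dbl[of 2] by (simp add: p2 e5 e6)
  have p8: "nf 1 0 2 [^] (8::int) = nf 24 0 0" using dbl[of 4] by (simp add: p4 e7)
  have p16: "nf 1 0 2 [^] (16::int) = nf 16 0 0" using dbl[of 8] by (simp add: p8 e8)
  have p32: "nf 1 0 2 [^] (32::int) = \<one>" using dbl[of 16] by (simp add: p16 e9)
  have "nf 1 0 2 [^] (13::int) = nf 1 0 2 [^] (8::int) \<otimes> nf 1 0 2 [^] (4::int) \<otimes> nf 1 0 2"
    using int_pow_mult[of "nf 1 0 2" 8 4] int_pow_mult[of "nf 1 0 2" 12 1] by simp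
  then have p: "nf 24 7 4 \<otimes> nf 1 0 2 [^] (13::int) = nf 1 0 2 \<otimes> nf 24 7 4" by (simp only: p4 p8 e10 e11 e12 e4)
  show ?thesis
    unfolding x y
  proof (rule macdonald_pairI[where w = "nf 24 7 4"])
    show "nf 0 0 7 \<otimes> nf 1 0 2 \<otimes> nf 24 7 4 = nf 1 0 2 \<otimes> nf 0 0 7" by (simp only: e1 e2 e3)
    show "nf 1 0 2 \<otimes> nf 24 7 4 = nf 24 7 4 \<otimes> nf 1 0 2 [^] (13::int)" by (rule p[symmetric])
    have "nf 0 0 7 [^] (13::int) = nf 0 0 91" by (simp add: nf_def int_pow_pow)
    then show "nf 24 7 4 \<otimes> nf 0 0 7 = nf 0 0 7 [^] (13::int) \<otimes> nf 24 7 4" by (simp only: e13 e14)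
    show "nf 1 0 2 [^] (2 ^ (3 * m - 1) :: nat) = \<one>" using p32 by (simp add: assms flip: int_pow_int)
    show "nf 0 0 7 [^] (2 ^ (3 * m - 1) :: nat) = \<one>" using B_pow_order[of 7] by (simp add: nf_def)
  qed simp_all
qed

text \<open>The exponents 18 and 23 make this substitution inverse to that of
  \<open>pair_5_13\<close>: modulo 32, \<open>7 * 23\<close> is 1, while \<open>2 + 7 * 18\<close>
  and \<open>18 + 23 * 2\<close> are 0.\<close>

lemma (in macdonald) pair_13_5:
  assumes "m = 2" "l = 3"
  shows "macdonald_pair G m 5 (A \<otimes> B [^] (18::int)) (B [^] (23::int))"
proof -
  note num = an_def Sn_def bn_def ap_def t2_def t3_def u_def h_def cong_def
  have x: "A \<otimes> B [^] (18::int) = nf 1 0 18" and y: "B [^] (23::int) = nf 0 0 23" by (simp_all add: nf_def)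
  have e1: "nf 1 0 18 \<otimes> nf 0 0 23 = nf 25 0 1"
    by (rule nf_mult_eqI; simp only: num; simp add: assms)
  have e2: "nf 0 0 23 \<otimes> nf 1 0 18 = nf 25 1 1"
    by (rule nf_mult_eqI; simp only: num; simp add: assms)
  have e3: "nf 25 1 1 \<otimes> nf 0 7 4 = nf 25 0 1"
    by (rule nf_mult_eqI; simp only: num; simp add: assms)
  have e4: "nf 1 0 18 \<otimes> nf 0 7 4 = nf 25 7 6"
    by (rule nf_mult_eqI; simp only: num; simp add: assms)
  have e5: "nf 1 0 18 \<otimes> nf 1 0 18 = nf 26 6 0"
    by (rule nf_mult_eqI; simp only: num; simp add: assms)
  have e6: "nf 26 6 0 \<otimes> nf 26 6 0 = nf 20 4 0"
    by (rule nf_mult_eqI; simp only: num; simp add: assms)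
  have e7: "nf 20 4 0 \<otimes> nf 20 4 0 = nf 24 0 0"
    by (rule nf_mult_eqI; simp only: num; simp add: assms)
  have e8: "nf 24 0 0 \<otimes> nf 24 0 0 = nf 16 0 0"
    by (rule nf_mult_eqI; simp only: num; simp add: assms)
  have e9: "nf 16 0 0 \<otimes> nf 16 0 0 = nf 0 0 0"
    by (rule nf_mult_eqI; simp only: num; simp add: assms)
  have e10: "nf 20 4 0 \<otimes> nf 1 0 18 = nf 21 4 2"
    by (rule nf_mult_eqI; simp only: num; simp add: assms)
  have e11: "nf 0 7 4 \<otimes> nf 21 4 2 = nf 25 7 6"
    by (rule nf_mult_eqI; simp only: num; simp add: assms)
  have e12: "nf 0 7 4 \<otimes> nf 0 0 23 = nf 8 7 3"
    by (rule nf_mult_eqI; simp only: num; simp add: assms)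
  have e13: "nf 0 0 115 \<otimes> nf 0 7 4 = nf 8 7 3"
    by (rule nf_mult_eqI; simp only: num; simp add: assms)
  have dbl: "nf 1 0 18 [^] (2 * k) = nf 1 0 18 [^] k \<otimes> nf 1 0 18 [^] k" for k :: int
    by (simp add: int_pow_mult[symmetric])
  have p2: "nf 1 0 18 [^] (2::int) = nf 1 0 18 \<otimes> nf 1 0 18" using dbl[of 1] by simp
  have p4: "nf 1 0 18 [^] (4::int) = nf 20 4 0" using dbl[of 2] by (simp add: p2 e5 e6)
  have p8: "nf 1 0 18 [^] (8::int) = nf 24 0 0" using dbl[of 4] by (simp add: p4 e7)
  have p16: "nf 1 0 18 [^] (16::int) = nf 16 0 0" using dbl[of 8] by (simp add: p8 e8)
  have p32: "nf 1 0 18 [^] (32::int) = \<one>" using dbl[of 16] by (simp add: p16 e9)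
  have "nf 1 0 18 [^] (5::int) = nf 1 0 18 [^] (4::int) \<otimes> nf 1 0 18"
    using int_pow_mult[of "nf 1 0 18" 4 1] by simp
  then have p: "nf 0 7 4 \<otimes> nf 1 0 18 [^] (5::int) = nf 1 0 18 \<otimes> nf 0 7 4" by (simp only: p4 e10 e11 e4)
  show ?thesis
    unfolding x y
  proof (rule macdonald_pairI[where w = "nf 0 7 4"])
    show "nf 0 0 23 \<otimes> nf 1 0 18 \<otimes> nf 0 7 4 = nf 1 0 18 \<otimes> nf 0 0 23" by (simp only: e1 e2 e3)
    show "nf 1 0 18 \<otimes> nf 0 7 4 = nf 0 7 4 \<otimes> nf 1 0 18 [^] (5::int)" by (rule p[symmetric])
    have "nf 0 0 23 [^] (5::int) = nf 0 0 115" by (simp add: nf_def int_pow_pow)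
    then show "nf 0 7 4 \<otimes> nf 0 0 23 = nf 0 0 23 [^] (5::int) \<otimes> nf 0 7 4" by (simp only: e12 e13)
    show "nf 1 0 18 [^] (2 ^ (3 * m - 1) :: nat) = \<one>" using p32 by (simp add: assms flip: int_pow_int)
    show "nf 0 0 23 [^] (2 ^ (3 * m - 1) :: nat) = \<one>" using B_pow_order[of 23] by (simp add: nf_def)
  qed simp_all
qed

section \<open>Isomorphisms between the groups \<open>J2\<close>, between the groups
  \<open>K2\<close>, and between the central factors\<close>

lemma J2_iso_of_cong:
  assumes m: "2 \<le> m" and l: "odd l" "odd l'" and cong: "[l = l'] (mod 2 ^ m)"
  shows "J2 (1 + 2 ^ m * l) \<cong> J2 (1 + 2 ^ m * l')"
proof -
  interpret p: macdonald_param m l using m l by unfold_locales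
  interpret p': macdonald_param m l' using m l by unfold_locales
  let ?J = "J2 (1 + 2 ^ m * l)" and ?J' = "J2 (1 + 2 ^ m * l')"
  let ?x = "J2_x (1 + 2 ^ m * l)" and ?x' = "J2_x (1 + 2 ^ m * l')"
  let ?y = "J2_y (1 + 2 ^ m * l)" and ?y' = "J2_y (1 + 2 ^ m * l')"
  interpret G: macdonald_faithful m l ?J ?x ?y by (rule p.J2_macdonald)
  interpret G': macdonald_faithful m l' ?J' ?x' ?y' by (rule p'.J2_macdonald)
  have h: "2 * p.h = 2 ^ m" using m unfolding p.h_def by (simp flip: power_Suc)
  have d: "2 * p.h dvd 4 * p.h ^ 3" by (simp add: power3_eq_cube)
  obtain i where i: "[l * i = 1] (mod 4 * p.h ^ 3)" using p.l_inverse' by blast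
  obtain i' where i': "[l' * i' = 1] (mod 4 * p.h ^ 3)" using p'.l_inverse' by blast
  define n where "n = i * l'"
  define n' where "n' = i' * l"
  have nl: "[l * n = l'] (mod 4 * p.h ^ 3)" "[l' * n' = l] (mod 4 * p.h ^ 3)"
    using cong_scalar_right[OF i, of l'] cong_scalar_right[OF i', of l] by (simp_all add: n_def n'_def mult_ac)
  have "[i * l' * (i' * l) = 1 * 1] (mod 4 * p.h ^ 3)"
    using cong_mult[OF i i'] by (simp add: mult_ac)
  then have nn': "[n * n' = 1] (mod 4 * p.h ^ 3)" by (simp add: n_def n'_def)
  have n'n: "[n' * n = 1] (mod 4 * p.h ^ 3)" using nn' by (simp only: mult.commute)
  have n1: "[n = 1] (mod 2 * p.h)"
  proof -
    have "[i * l' = i * l] (mod 2 * p.h)" using cong_sym[OF cong] unfolding h by (rule cong_scalar_left)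
    also have "[i * l = 1] (mod 2 * p.h)" using cong_dvd_modulus[OF i d] by (simp add: mult.commute)
    finally show ?thesis unfolding n_def .
  qed
  have n'1: "[n' = 1] (mod 2 * p.h)"
  proof -
    have "[i' * l = i' * l'] (mod 2 * p.h)" using cong unfolding h by (rule cong_scalar_left)
    also have "[i' * l' = 1] (mod 2 * p.h)" using cong_dvd_modulus[OF i' d] by (simp add: mult.commute)
    finally show ?thesis unfolding n'_def .
  qed
  obtain j where j: "n = 1 + 2 * p.h * j" using n1 by (metis cong_iff_lin cong_sym)
  obtain j' where j': "n' = 1 + 2 * p.h * j'" using n'1 by (metis cong_iff_lin cong_sym)
  have mult: "multiplicity 2 ((1 + 2 ^ m * k) - 1) = m" if "odd k" for k :: int
    using multiplicity_alpha[OF that] .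
  obtain \<phi> where \<phi>: "\<phi> \<in> hom ?J' ?J" "\<phi> ?x' = ?x [^]\<^bsub>?J\<^esub> n" "\<phi> ?y' = ?y"
    using G.J2_universal[of "1 + 2 ^ m * l'"] G.central_pair[OF j nl(1)] mult[OF l(2)] unfolding h by metis
  obtain \<psi> where \<psi>: "\<psi> \<in> hom ?J ?J'" "\<psi> ?x = ?x' [^]\<^bsub>?J'\<^esub> n'" "\<psi> ?y = ?y'"
    using G'.J2_universal[of "1 + 2 ^ m * l"] G'.central_pair[OF j' nl(2)] mult[OF l(1)] unfolding h by metis
  have "\<phi> (\<psi> ?x) = ?x"
    using hom_int_pow[OF \<phi>(1) _ G'.is_group G.is_group, of ?x' n'] G.A_cong[OF nn']
    by (simp add: \<phi> \<psi> G.int_pow_pow)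
  moreover have "\<psi> (\<phi> ?x') = ?x'"
    using hom_int_pow[OF \<psi>(1) _ G.is_group G'.is_group, of ?x n] G'.A_cong[OF n'n]
    by (simp add: \<phi> \<psi> G'.int_pow_pow)
  ultimately show ?thesis
    by (intro J2_iso_inverse[OF \<psi>(1) \<phi>(1)]) (simp_all add: \<phi> \<psi>)
qed

lemma J2_5_iso_J2_13: "J2 5 \<cong> J2 13"
proof -
  interpret p: macdonald_param 2 1 by unfold_locales simp_all
  interpret p': macdonald_param 2 3 by unfold_locales simp_all
  have J: "macdonald_faithful 2 1 (J2 5) (J2_x 5) (J2_y 5)" "macdonald_faithful 2 3 (J2 13) (J2_x 13) (J2_y 13)"
    using p.J2_macdonald p'.J2_macdonald by simp_all
  interpret G: macdonald_faithful 2 1 "J2 5" "J2_x 5" "J2_y 5" by (rule J)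
  interpret G': macdonald_faithful 2 3 "J2 13" "J2_x 13" "J2_y 13" by (rule J)
  have h: "p.h = 2" by (simp add: p.h_def)
  have mult: "multiplicity 2 (5 - 1 :: int) = 2" "multiplicity 2 (13 - 1 :: int) = 2"
    using multiplicity_alpha[of 1 2] multiplicity_alpha[of 3 2] by simp_all
  obtain \<phi> where \<phi>: "\<phi> \<in> hom (J2 13) (J2 5)"
    "\<phi> (J2_x 13) = J2_x 5 \<otimes>\<^bsub>J2 5\<^esub> J2_y 5 [^]\<^bsub>J2 5\<^esub> (2::int)" "\<phi> (J2_y 13) = J2_y 5 [^]\<^bsub>J2 5\<^esub> (7::int)"
    using G.J2_universal[of 13] G.pair_5_13 mult by metis
  obtain \<psi> where \<psi>: "\<psi> \<in> hom (J2 5) (J2 13)"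
    "\<psi> (J2_x 5) = J2_x 13 \<otimes>\<^bsub>J2 13\<^esub> J2_y 13 [^]\<^bsub>J2 13\<^esub> (18::int)" "\<psi> (J2_y 5) = J2_y 13 [^]\<^bsub>J2 13\<^esub> (23::int)"
    using G'.J2_universal[of 5] G'.pair_13_5 mult by metis
  interpret f: group_hom "J2 13" "J2 5" \<phi> using \<phi>(1) by unfold_locales
  interpret g: group_hom "J2 5" "J2 13" \<psi> using \<psi>(1) by unfold_locales
  have B: "J2_y 5 [^]\<^bsub>J2 5\<^esub> (161::int) = J2_y 5" "J2_y 5 [^]\<^bsub>J2 5\<^esub> (128::int) = \<one>\<^bsub>J2 5\<^esub>"
    using G.B_cong[of 161 1] G.B_cong[of 128 0] by (simp_all add: h cong_def)
  have B': "J2_y 13 [^]\<^bsub>J2 13\<^esub> (161::int) = J2_y 13" "J2_y 13 [^]\<^bsub>J2 13\<^esub> (64::int) = \<one>\<^bsub>J2 13\<^esub>"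
    using G'.B_cong[of 161 1] G'.B_cong[of 64 0] by (simp_all add: h cong_def)
  show ?thesis
  proof (rule J2_iso_inverse[OF \<psi>(1) \<phi>(1)])
    show "\<phi> (\<psi> (J2_y 5)) = J2_y 5" using B by (simp add: \<psi> \<phi> f.hom_int_pow G.int_pow_pow)
    show "\<psi> (\<phi> (J2_y 13)) = J2_y 13" using B' by (simp add: \<psi> \<phi> g.hom_int_pow G'.int_pow_pow)
    show "\<phi> (\<psi> (J2_x 5)) = J2_x 5"
      using B by (simp add: \<psi> \<phi> f.hom_int_pow G.int_pow_pow G.m_assoc G.int_pow_mult[symmetric])
    show "\<psi> (\<phi> (J2_x 13)) = J2_x 13"
      using B' by (simp add: \<psi> \<phi> g.hom_int_pow G'.int_pow_pow G'.m_assoc G'.int_pow_mult[symmetric])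
  qed
qed

lemma (in group) int_pow_odd_mod_4:
  fixes l :: int
  assumes x: "x \<in> carrier G" "x [^] (2 ^ (3 * 1 - 1) :: nat) = \<one>" and l: "odd l"
  shows "x [^] (1 + 2 * l) = x [^] (3::int)"
proof -
  obtain k where k: "l = 2 * k + 1" using l oddE by blast
  have "x [^] (4::int) = x [^] (int (2 ^ (3 * 1 - 1)))" by simp
  then have 4: "x [^] (4::int) = \<one>" unfolding int_pow_int using x(2) by simp
  have "1 + 2 * l = 3 + 4 * k" using k by simp
  then have "x [^] (1 + 2 * l) = x [^] (3::int) \<otimes> (x [^] (4::int)) [^] k"
    using x(1) by (simp only: int_pow_mult int_pow_pow)
  then show ?thesis using x(1) by (simp add: 4)
qed

lemma J2_iso_m1:
  fixes l :: int
  assumes l: "odd l" shows "J2 (1 + 2 * l) \<cong> J2 3"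
proof -
  have mult: "multiplicity 2 ((1 + 2 * l) - 1) = 1" "multiplicity 2 (3 - 1 :: int) = 1"
    using multiplicity_alpha[OF l, of 1] multiplicity_alpha[of 1 1] by simp_all
  have pair: "macdonald_pair G 1 (1 + 2 * l) x y \<longleftrightarrow> macdonald_pair G 1 3 x y"
    if G: "group G" for G :: "gen word set set monoid" and x y
    unfolding macdonald_pair_def using group.int_pow_odd_mod_4[OF G _ _ l] by auto
  have p1: "macdonald_pair (J2 (1 + 2 * l)) (multiplicity 2 (3 - 1 :: int)) 3 (J2_x (1 + 2 * l)) (J2_y (1 + 2 * l))"
    using J2_pair[of "1 + 2 * l"] unfolding mult pair[OF group_J2] .
  have p2: "macdonald_pair (J2 3) (multiplicity 2 ((1 + 2 * l) - 1)) (1 + 2 * l) (J2_x 3) (J2_y 3)"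
    using J2_pair[of 3] unfolding mult pair[OF group_J2] .
  obtain \<phi> where "\<phi> \<in> hom (J2 3) (J2 (1 + 2 * l))" "\<phi> (J2_x 3) = J2_x (1 + 2 * l)" "\<phi> (J2_y 3) = J2_y (1 + 2 * l)"
    by (rule group.J2_universal[OF group_J2 p1])
  moreover obtain \<psi> where "\<psi> \<in> hom (J2 (1 + 2 * l)) (J2 3)" "\<psi> (J2_x (1 + 2 * l)) = J2_x 3" "\<psi> (J2_y (1 + 2 * l)) = J2_y 3"
    by (rule group.J2_universal[OF group_J2 p2])
  ultimately show ?thesis by (intro J2_iso_inverse[of \<psi> _ _ \<phi>]) simp_all
qed

lemma K2_iso:
  assumes m: "2 \<le> m" and l: "odd l" "odd l'"
  shows "K2 (1 + 2 ^ m * l') \<cong> K2 (1 + 2 ^ m * l)"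
proof -
  interpret p: macdonald_param m l using m l by unfold_locales
  interpret p': macdonald_param m l' using m l by unfold_locales
  let ?J = "J2 (1 + 2 ^ m * l)"
  interpret G: macdonald_faithful m l ?J "J2_x (1 + 2 ^ m * l)" "J2_y (1 + 2 ^ m * l)" by (rule p.J2_macdonald)
  have h: "2 * p.h = 2 ^ m" using m unfolding p.h_def by (simp flip: power_Suc)
  obtain i where i: "[l * i = 1] (mod 4 * p.h ^ 3)" using p.l_inverse' by blast
  define n where "n = i * l'"
  have nl: "[l * n = l'] (mod 4 * p.h ^ 3)"
    using cong_scalar_right[OF i, of l'] by (simp add: n_def mult_ac)
  then have "[l * n = l'] (mod 2)" by (rule cong_dvd_modulus) simp
  then have n: "odd n" using l by (auto simp: cong_def)
  have mult: "multiplicity 2 ((1 + 2 ^ m * l') - 1) = m" using multiplicity_alpha[OF l(2)] .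
  interpret K: group G.KG by (rule normal.factorgroup_is_group[OF G.upper_central_normal])
  obtain \<phi> where "\<phi> \<in> hom (J2 (1 + 2 ^ m * l')) G.KG"
    "\<phi> (J2_x (1 + 2 ^ m * l')) = G.kq (J2_x (1 + 2 ^ m * l) [^]\<^bsub>?J\<^esub> n)"
    "\<phi> (J2_y (1 + 2 ^ m * l')) = G.kq (J2_y (1 + 2 ^ m * l))"
    using K.J2_universal[of "1 + 2 ^ m * l'"] G.kq_pair(1)[OF n nl] mult unfolding h by metis
  then show ?thesis
    unfolding K2_def by (rule K_iso_param[OF p.J2_macdonald p'.J2_macdonald n nl])
qed

text \<open>The first two factors are known explicitly. All later ones are factors of
  \<open>K2\<close>, which does not depend on \<open>l\<close> up to isomorphism.\<close>

lemma upper_central_factor_J2_iso: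
  assumes m: "2 \<le> m" and l: "odd l" "odd l'"
  shows "upper_central_factor (J2 (1 + 2 ^ m * l)) i \<cong> upper_central_factor (J2 (1 + 2 ^ m * l')) i"
proof (cases "i < 2")
  case True
  interpret p: macdonald_param m l using m l by unfold_locales
  interpret p': macdonald_param m l' using m l by unfold_locales
  show ?thesis by (rule upper_central_factor_01_iso[OF p.J2_macdonald p'.J2_macdonald True])
next
  case False
  then obtain j where i: "i = j + 2" by (metis add.commute le_Suc_ex not_less)
  have K: "upper_central_factor (J2 \<alpha>) (j + 2) \<cong> upper_central_factor (K2 \<alpha>) j" "group (K2 \<alpha>)"
    "upper_central_factor (K2 \<alpha>) j \<cong> upper_central_factor (J2 \<alpha>) (j + 2)" for \<alpha>
  proof -
    interpret J: group "J2 \<alpha>" by (rule group_J2)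
    interpret N: normal "upper_central (J2 \<alpha>) 2" "J2 \<alpha>" by (rule J.upper_central_normal)
    interpret Q: group "K2 \<alpha>" unfolding K2_def by (rule N.factorgroup_is_group)
    interpret q: group_hom "J2 \<alpha>" "K2 \<alpha>" "\<lambda>x. upper_central (J2 \<alpha>) 2 #>\<^bsub>J2 \<alpha>\<^esub> x"
      using N.r_coset_hom_Mod by unfold_locales (simp add: K2_def)
    show "group (K2 \<alpha>)" by (rule Q.is_group)
    have "kernel (J2 \<alpha>) (K2 \<alpha>) (\<lambda>x. upper_central (J2 \<alpha>) 2 #>\<^bsub>J2 \<alpha>\<^esub> x) = upper_central (J2 \<alpha>) 2"
      using J.coset_join1[OF _ _ N.subgroup_axioms] J.coset_join2[OF _ N.subgroup_axioms] N.subset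
      by (auto simp: kernel_def K2_def)
    then show iso: "upper_central_factor (J2 \<alpha>) (j + 2) \<cong> upper_central_factor (K2 \<alpha>) j"
      by (intro q.upper_central_factor_epi) (auto simp: K2_def carrier_FactGroup)
    have "group (upper_central_factor (J2 \<alpha>) (j + 2))"
    proof -
      interpret U: normal "upper_central (J2 \<alpha>) (Suc (j + 2))" "J2 \<alpha>" by (rule J.upper_central_normal)
      interpret V: normal "upper_central (J2 \<alpha>) (j + 2)" "J2 \<alpha>" by (rule J.upper_central_normal)
      have "upper_central (J2 \<alpha>) (j + 2) \<subseteq> upper_central (J2 \<alpha>) (Suc (j + 2))"
        by (rule J.upper_central_subset_Suc)
      then show ?thesis unfolding upper_central_factor_def
        by (intro normal.factorgroup_is_group J.normal_restrict_supergroup U.subgroup_axioms J.upper_central_normal)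
    qed
    then show "upper_central_factor (K2 \<alpha>) j \<cong> upper_central_factor (J2 \<alpha>) (j + 2)"
      using iso group.iso_sym by blast
  qed
  have "upper_central_factor (K2 (1 + 2 ^ m * l)) j \<cong> upper_central_factor (K2 (1 + 2 ^ m * l')) j"
    by (rule upper_central_factor_iso[OF K2_iso[OF m l(2,1)] K(2) K(2)])
  then show ?thesis unfolding i by (rule iso_trans[OF iso_trans[OF K(1)] K(3)])
qed

section \<open>Non-isomorphism\<close>

text \<open>Extracts a factor \<open>n\<close> from an exponent and keeps a congruence for the
  cofactor, the shape in which the power formulas below are iterated.\<close>

lemma dvd_lift_cong:
  fixes n k x y :: int
  assumes "n * k dvd x - n * y"
  shows "\<exists>y'. x = n * y' \<and> [y' = y] (mod k)"
proof -
  obtain w where "x - n * y = n * k * w" using assms by blast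
  then show ?thesis by (intro exI[of _ "y + k * w"]) (auto simp: algebra_simps cong_iff_dvd_diff)
qed

context macdonald_param
begin

text \<open>For \<open>3 \<le> m\<close>, the only case in which it is used,
  \<open>h = 4 * e\<close>, so the fractions \<open>h / 2\<close> and \<open>h / 4\<close> that
  occur below are the integers \<open>2 * e\<close> and \<open>e\<close>.\<close>

definition e :: int where "e = 2 ^ (m - 3)"

end

text \<open>The quotient by the powers of \<open>A\<close> to the \<open>8h\<^sup>2 = 128e\<^sup>2\<close>, where \<open>h = 4e\<close>.\<close>

locale macdonald_trunc = macdonald +
  assumes m3: "3 \<le> m"
    and A_128: "A [^] (128 * e\<^sup>2) = \<one>"
    and nf_eq_trunc: "nf a c b = nf a' c' b' \<Longrightarrow>
      [b = b'] (mod 32 * e\<^sup>2) \<and> [c = c'] (mod 32 * e\<^sup>2) \<and> [a - b = a' - b'] (mod 128 * e\<^sup>2)"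
begin

lemma h: "h = 4 * e"
proof -
  have "m - 1 = Suc (Suc (m - 3))" using m3 by simp
  then show ?thesis unfolding h_def e_def by simp
qed

lemma e_pos: "e > 0" by (simp add: e_def)

lemma two_m: "2 ^ m = 8 * e"
proof -
  have "m = Suc (Suc (Suc (m - 3)))" using m3 by simp
  then show ?thesis unfolding e_def by (metis (no_types) mult.assoc power_Suc mult_numeral_1 numeral_times_numeral semiring_norm(13) semiring_norm(11))
qed

lemma B_128: "B [^] (128 * e\<^sup>2) = \<one>"
proof -
  have "B [^] (2 * h\<^sup>2 * 4) = A [^] (128 * e\<^sup>2 * (- 1))" unfolding B_2h2 by (simp add: h power2_eq_square)
  also have "\<dots> = \<one>" by (subst int_pow_pow[symmetric]) (simp_all add: A_128)
  finally show ?thesis by (simp add: h power2_eq_square)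
qed

lemma C_32: "C [^] (32 * e\<^sup>2) = \<one>"
proof -
  have "C [^] (2 * h\<^sup>2 * 1) = A [^] (128 * e\<^sup>2 * e)" unfolding C_2h2 by (simp add: h power2_eq_square power3_eq_cube algebra_simps)
  also have "\<dots> = \<one>" by (subst int_pow_pow[symmetric]) (simp_all add: A_128)
  finally show ?thesis by (simp add: h power2_eq_square)
qed

lemma pow_cong_of_order:
  assumes "x \<in> carrier G" "x [^] (n::int) = \<one>" "[i = j] (mod n)"
  shows "x [^] i = x [^] j"
proof -
  obtain k where "i = j + n * k" using assms(3) by (metis cong_iff_lin cong_sym)
  then show ?thesis using assms(1,2) by (simp add: int_pow_mult flip: int_pow_pow)
qed

lemma nf_cong_trunc:
  assumes "[a = a'] (mod 128 * e\<^sup>2)" "[c = c'] (mod 32 * e\<^sup>2)" "[b = b'] (mod 128 * e\<^sup>2)"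
  shows "nf a c b = nf a' c' b'"
  unfolding nf_def
  using pow_cong_of_order[OF A_closed A_128 assms(1)] pow_cong_of_order[OF C_closed C_32 assms(2)]
    pow_cong_of_order[OF B_closed B_128 assms(3)] by simp

lemma nf_multI:
  assumes "128 * e\<^sup>2 dvd a + an b a' * ap (- c) - x" "32 * e\<^sup>2 dvd c - Sn b a' + c' - y"
    "128 * e\<^sup>2 dvd bn b a' * ap (- c') + b' - z"
  shows "nf a c b \<otimes> nf a' c' b' = nf x y z"
  unfolding nf_mult by (rule nf_cong_trunc) (use assms in \<open>simp_all only: cong_iff_dvd_diff\<close>)

lemma nf_mult_lift:
  assumes "i * r dvd a + an b a' * ap (- c) - i * x" "j * s dvd c - Sn b a' + c' - j * y"
    "n * t dvd bn b a' * ap (- c') + b' - n * z"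
  shows "\<exists>x' y' z'. nf a c b \<otimes> nf a' c' b' = nf (i * x') (j * y') (n * z') \<and>
    [x' = x] (mod r) \<and> [y' = y] (mod s) \<and> [z' = z] (mod t)"
proof -
  obtain x' where "a + an b a' * ap (- c) = i * x'" "[x' = x] (mod r)" using dvd_lift_cong[OF assms(1)] by blast
  moreover obtain y' where "c - Sn b a' + c' = j * y'" "[y' = y] (mod s)" using dvd_lift_cong[OF assms(2)] by blast
  moreover obtain z' where "bn b a' * ap (- c') + b' = n * z'" "[z' = z] (mod t)" using dvd_lift_cong[OF assms(3)] by blast
  ultimately show ?thesis unfolding nf_mult by (intro exI[of _ x'] exI[of _ y'] exI[of _ z']) simp
qed

lemma h_dvd_t: "\<exists>z. t3 (8 * e * p) = 4 * e * z" "\<exists>z. t3 (8 * e * p + 1) = 4 * e * z"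
  "t2 (8 * e * p) = 4 * e * p * (8 * e * p - 1)" "t2 (8 * e * p + 1) = 4 * e * p * (8 * e * p + 1)"
  using t3_shift[of 0 p] t3_shift[of 1 p] t2_shift[of 0 p] t2_shift[of 1 p]
  by (simp_all add: h t2_def t3_def algebra_simps)

lemma t2_neg: "t2 (- x) = t2 (x + 1)"
  using t2[of "- x"] t2[of "x + 1"] by (simp add: algebra_simps)

text \<open>At precision \<open>128 * e\<^sup>2\<close> the square of \<open>u = 8 * e * l\<close>
  is half of the modulus. Quadratic terms therefore count only by parity: their signs and the factor
  \<open>l\<^sup>2\<close> disappear.\<close>

lemma nf_mult_right:
  "nf a c b \<otimes> nf (8 * e * p) d b' = nf (a + 8 * e * p - 32 * e\<^sup>2 * l * b * p + 64 * e\<^sup>2 * p * c)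
     (c + d - 8 * e * p * b) (b - 8 * e * l * b * d + 64 * e\<^sup>2 * (b * t2 (d + 1) + p * t2 (b + 1)) + b')"
proof -
  obtain k where k: "l = 2 * k + 1" using l by (auto elim: oddE)
  obtain z where z: "t3 (8 * e * p) = 4 * e * z" using h_dvd_t(1) by blast
  show ?thesis
  proof (rule nf_multI)
    show "128 * e\<^sup>2 dvd a + an b (8 * e * p) * ap (- c) -
      (a + 8 * e * p - 32 * e\<^sup>2 * l * b * p + 64 * e\<^sup>2 * p * c)"
      unfolding an_def ap_def z h_dvd_t(3) unfolding u_def unfolding h unfolding k by Groebner_Basis.algebra
    show "32 * e\<^sup>2 dvd c - Sn b (8 * e * p) + d - (c + d - 8 * e * p * b)"
      unfolding Sn_def z h_dvd_t(3) unfolding u_def unfolding h unfolding k by Groebner_Basis.algebra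
    show "128 * e\<^sup>2 dvd bn b (8 * e * p) * ap (- d) + b' -
      (b - 8 * e * l * b * d + 64 * e\<^sup>2 * (b * t2 (d + 1) + p * t2 (b + 1)) + b')"
      unfolding bn_def ap_def z h_dvd_t(3) t2_neg unfolding u_def unfolding h unfolding k by Groebner_Basis.algebra
  qed
qed

lemma nf_mult_left:
  "nf (8 * e * p) d (8 * e * q) \<otimes> nf a c b = nf (8 * e * p + a - 8 * e * l * a * d + 64 * e\<^sup>2 * (a * t2 (d + 1) + q * t2 a))
     (c + d - 8 * e * q * a) (8 * e * q + 32 * e\<^sup>2 * l * a * q + 64 * e\<^sup>2 * q * c + b)"
proof -
  obtain k where k: "l = 2 * k + 1" using l by (auto elim: oddE)
  obtain z where z: "t3 (8 * e * q + 1) = 4 * e * z" using h_dvd_t(2) by blast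
  note t = z h_dvd_t(4)
  show ?thesis
  proof (rule nf_multI)
    show "128 * e\<^sup>2 dvd 8 * e * p + an (8 * e * q) a * ap (- d) -
      (8 * e * p + a - 8 * e * l * a * d + 64 * e\<^sup>2 * (a * t2 (d + 1) + q * t2 a))"
      unfolding an_def ap_def t t2_neg unfolding u_def unfolding h unfolding k by Groebner_Basis.algebra
    show "32 * e\<^sup>2 dvd d - Sn (8 * e * q) a + c - (c + d - 8 * e * q * a)"
      unfolding Sn_def t unfolding u_def unfolding h unfolding k by Groebner_Basis.algebra
    show "128 * e\<^sup>2 dvd bn (8 * e * q) a * ap (- c) + b -
      (8 * e * q + 32 * e\<^sup>2 * l * a * q + 64 * e\<^sup>2 * q * c + b)"
      unfolding bn_def ap_def t unfolding u_def unfolding h unfolding k by Groebner_Basis.algebra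
  qed
qed

text \<open>The exponent of \<open>B\<close> is taken divisible by \<open>2 * e\<close>, as
  \<open>odd_exponents\<close> will force. The first two squarings produce correction terms (here
  and in \<open>nf_square2\<close>); from the third on there are none at this precision
  (\<open>nf_square3\<close>).\<close>

lemma nf_square:
  "\<exists>x y z. nf a c (2 * e * b) \<otimes> nf a c (2 * e * b) = nf (2 * x) (2 * y) (4 * e * z) \<and>
    [x = a - 4 * e * l * a * c + 8 * e\<^sup>2 * b * t2 a] (mod 16 * e) \<and> [y = c - e * a * b] (mod 4 * e) \<and>
    [z = b + 2 * e * l * a * b * (2 * e * b + 1) - 4 * e * l * b * c] (mod 8)"
proof -
  obtain k where k: "l = 2 * k + 1" using l by (auto elim: oddE)
  have t: "t2 (2 * e * b + 1) = e * b * (2 * e * b + 1)" using t2[of "2 * e * b + 1"] by Groebner_Basis.algebra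
  show ?thesis
  proof (rule nf_mult_lift)
    show "2 * (16 * e) dvd a + an (2 * e * b) a * ap (- c) - 2 * (a - 4 * e * l * a * c + 8 * e\<^sup>2 * b * t2 a)"
      unfolding an_def ap_def t unfolding u_def unfolding h unfolding k by Groebner_Basis.algebra
    show "2 * (4 * e) dvd c - Sn (2 * e * b) a + c - 2 * (c - e * a * b)"
      unfolding Sn_def t unfolding u_def unfolding h unfolding k by Groebner_Basis.algebra
    show "4 * e * 8 dvd bn (2 * e * b) a * ap (- c) + 2 * e * b -
      4 * e * (b + 2 * e * l * a * b * (2 * e * b + 1) - 4 * e * l * b * c)"
      unfolding bn_def ap_def t unfolding u_def unfolding h unfolding k by Groebner_Basis.algebra
  qed
qed

lemma nf_square2:
  "\<exists>x' y' z'. nf (2 * x) (2 * y) (4 * e * z) \<otimes> nf (2 * x) (2 * y) (4 * e * z) = nf (4 * x') (4 * y') (8 * e * z') \<and>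
    [x' = x + 8 * e\<^sup>2 * x * z - 8 * e * x * y] (mod 16 * e) \<and> [y' = y - 2 * e * x * z] (mod 4 * e) \<and>
    [z' = z + 4 * e * x * z] (mod 8)"
proof -
  obtain k where k: "l = 2 * k + 1" using l by (auto elim: oddE)
  have t: "t2 (4 * e * z + 1) = 2 * e * z * (4 * e * z + 1)" "t2 (2 * x) = x * (2 * x - 1)"
    using t2[of "4 * e * z + 1"] t2[of "2 * x"] by Groebner_Basis.algebra+
  show ?thesis
  proof (rule nf_mult_lift)
    show "4 * (16 * e) dvd 2 * x + an (4 * e * z) (2 * x) * ap (- (2 * y)) - 4 * (x + 8 * e\<^sup>2 * x * z - 8 * e * x * y)"
      unfolding an_def ap_def t unfolding u_def unfolding h unfolding k by Groebner_Basis.algebra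
    show "4 * (4 * e) dvd 2 * y - Sn (4 * e * z) (2 * x) + 2 * y - 4 * (y - 2 * e * x * z)"
      unfolding Sn_def t unfolding u_def unfolding h unfolding k by Groebner_Basis.algebra
    show "8 * e * 8 dvd bn (4 * e * z) (2 * x) * ap (- (2 * y)) + 4 * e * z - 8 * e * (z + 4 * e * x * z)"
      unfolding bn_def ap_def t unfolding u_def unfolding h unfolding k by Groebner_Basis.algebra
  qed
qed

lemma nf_square3:
  "\<exists>x' y' z'. nf (4 * s * x) (4 * s * y) (8 * e * s * z) \<otimes> nf (4 * s * x) (4 * s * y) (8 * e * s * z) =
      nf (8 * s * x') (8 * s * y') (16 * e * s * z') \<and>
    [x' = x] (mod 16 * e) \<and> [y' = y] (mod 4 * e) \<and> [z' = z] (mod 8)"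
proof -
  obtain k where k: "l = 2 * k + 1" using l by (auto elim: oddE)
  have t: "t2 (8 * e * s * z + 1) = 4 * e * s * z * (8 * e * s * z + 1)" "t2 (4 * s * x) = 2 * s * x * (4 * s * x - 1)"
    using t2[of "8 * e * s * z + 1"] t2[of "4 * s * x"] by Groebner_Basis.algebra+
  show ?thesis
  proof (rule nf_mult_lift)
    show "8 * s * (16 * e) dvd 4 * s * x + an (8 * e * s * z) (4 * s * x) * ap (- (4 * s * y)) - 8 * s * x"
      unfolding an_def ap_def t unfolding u_def unfolding h unfolding k by Groebner_Basis.algebra
    show "8 * s * (4 * e) dvd 4 * s * y - Sn (8 * e * s * z) (4 * s * x) + 4 * s * y - 8 * s * y"
      unfolding Sn_def t unfolding u_def unfolding h unfolding k by Groebner_Basis.algebra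
    show "16 * e * s * 8 dvd bn (8 * e * s * z) (4 * s * x) * ap (- (4 * s * y)) + 8 * e * s * z - 16 * e * s * z"
      unfolding bn_def ap_def t unfolding u_def unfolding h unfolding k by Groebner_Basis.algebra
  qed
qed

end

section \<open>Power formulas in the truncated group\<close>

lemma dvd_even_mult: "even (y::int) \<Longrightarrow> 2 * x dvd x * y"
  using mult_dvd_mono[of x x 2 y] by (simp add: mult.commute)

context macdonald_trunc
begin

text \<open>For \<open>i = m\<close> the factor \<open>2 ^ m = 8 * e\<close> turns the moduli
  \<open>16 * e\<close>, \<open>4 * e\<close> and \<open>8\<close> into
  \<open>128 * e\<^sup>2\<close>, \<open>32 * e\<^sup>2\<close> and, for the exponent
  \<open>2 * e * z\<close>, again \<open>128 * e\<^sup>2\<close>. This is exactly the precision at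
  which normal forms are determined.\<close>

lemma nf_pow_two_power:
  assumes a: "odd a" and i: "2 \<le> i"
  shows "\<exists>x y z. nf a c (2 * e * b) [^] (2 ^ i :: nat) = nf (2 ^ i * x) (2 ^ i * y) (2 ^ i * (2 * e * z)) \<and>
    [x = a - 4 * e * l * a * c + 8 * e * (c + e * b * t2 a)] (mod 16 * e) \<and>
    [y = c - e * a * b - 2 * e * b] (mod 4 * e) \<and>
    [z = b + 2 * e * l * a * b * (2 * e * b + 1) - 4 * e * l * b * c + 4 * e * b] (mod 8)"
  using i
proof (induction i rule: dec_induct)
  case base
  let ?x = "nf a c (2 * e * b)"
  obtain x y z where 1: "?x \<otimes> ?x = nf (2 * x) (2 * y) (4 * e * z)"
    "[x = a - 4 * e * l * a * c + 8 * e\<^sup>2 * b * t2 a] (mod 16 * e)" "[y = c - e * a * b] (mod 4 * e)"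
    "[z = b + 2 * e * l * a * b * (2 * e * b + 1) - 4 * e * l * b * c] (mod 8)"
    using nf_square by blast
  obtain x' y' z' where 2: "nf (2 * x) (2 * y) (4 * e * z) \<otimes> nf (2 * x) (2 * y) (4 * e * z) = nf (4 * x') (4 * y') (8 * e * z')"
    "[x' = x + 8 * e\<^sup>2 * x * z - 8 * e * x * y] (mod 16 * e)" "[y' = y - 2 * e * x * z] (mod 4 * e)"
    "[z' = z + 4 * e * x * z] (mod 8)"
    using nf_square2 by blast
  have "?x [^] (4::nat) = (?x \<otimes> ?x) \<otimes> (?x \<otimes> ?x)" by (simp add: numeral_eq_Suc m_assoc)
  then have "?x [^] (4::nat) = nf (4 * x') (4 * y') (8 * e * z')" by (simp only: 1(1) 2(1))
  then have pow: "?x [^] (2\<^sup>2 :: nat) = nf (2\<^sup>2 * x') (2\<^sup>2 * y') (2\<^sup>2 * (2 * e * z'))"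
    by (simp add: mult.assoc)
  obtain r where r: "x = a - 4 * e * l * a * c + 8 * e\<^sup>2 * b * t2 a + 16 * e * r"
    using 1(2) by (metis cong_iff_lin cong_sym)
  obtain s where s: "y = c - e * a * b + 4 * e * s" using 1(3) by (metis cong_iff_lin cong_sym)
  obtain t where t: "z = b + 2 * e * l * a * b * (2 * e * b + 1) - 4 * e * l * b * c + 8 * t"
    using 1(4) by (metis cong_iff_lin cong_sym)
  have odd: "odd x" unfolding r using a by simp
  \<comment> \<open>The corrections of the second squaring carry half of their modulus, so they can
    be replaced by any expressions of the same parity; \<open>x\<close> is odd because
    \<open>a\<close> is.\<close>
  have parity: "even (x * z - b)" "even (e * x * z - x * y - c)"
    using a odd unfolding t s by auto
  show ?case
  proof (intro exI conjI)
    show "?x [^] (2\<^sup>2 :: nat) = nf (2\<^sup>2 * x') (2\<^sup>2 * y') (2\<^sup>2 * (2 * e * z'))" by (rule pow)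
    have "[x + 8 * e\<^sup>2 * x * z - 8 * e * x * y = x + 8 * e * c] (mod 16 * e)"
      using dvd_even_mult[OF parity(2), of "8 * e"] by (simp add: cong_iff_dvd_diff algebra_simps power2_eq_square)
    also have "[x + 8 * e * c = a - 4 * e * l * a * c + 8 * e * (c + e * b * t2 a)] (mod 16 * e)"
      by (rule congI[of _ _ _ r]) (simp add: r algebra_simps power2_eq_square)
    finally show "[x' = a - 4 * e * l * a * c + 8 * e * (c + e * b * t2 a)] (mod 16 * e)"
      using 2(2) cong_trans by blast
    have "[y - 2 * e * x * z = y - 2 * e * b] (mod 4 * e)"
      using dvd_even_mult[OF parity(1), of "- 2 * e"] by (simp add: cong_iff_dvd_diff algebra_simps)
    also have "[y - 2 * e * b = c - e * a * b - 2 * e * b] (mod 4 * e)" by (rule congI[of _ _ _ s]) (simp add: s)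
    finally show "[y' = c - e * a * b - 2 * e * b] (mod 4 * e)" using 2(3) cong_trans by blast
    have "[z + 4 * e * x * z = z + 4 * e * b] (mod 8)"
      using dvd_even_mult[of "e * (x * z - b)" 4] parity(1) by (simp add: cong_iff_dvd_diff algebra_simps)
    also have "[z + 4 * e * b = b + 2 * e * l * a * b * (2 * e * b + 1) - 4 * e * l * b * c + 4 * e * b] (mod 8)"
      by (rule congI[of _ _ _ t]) (simp add: t)
    finally show "[z' = b + 2 * e * l * a * b * (2 * e * b + 1) - 4 * e * l * b * c + 4 * e * b] (mod 8)"
      using 2(4) cong_trans by blast
  qed
next
  case (step i)
  let ?x = "nf a c (2 * e * b)"
  obtain x y z where 1: "?x [^] (2 ^ i :: nat) = nf (2 ^ i * x) (2 ^ i * y) (2 ^ i * (2 * e * z))"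
    "[x = a - 4 * e * l * a * c + 8 * e * (c + e * b * t2 a)] (mod 16 * e)"
    "[y = c - e * a * b - 2 * e * b] (mod 4 * e)"
    "[z = b + 2 * e * l * a * b * (2 * e * b + 1) - 4 * e * l * b * c + 4 * e * b] (mod 8)"
    using step.IH by blast
  obtain j where j: "i = j + 2" using step.hyps by (metis add.commute le_Suc_ex)
  obtain x' y' z' where 2: "nf (4 * 2 ^ j * x) (4 * 2 ^ j * y) (8 * e * 2 ^ j * z) \<otimes> nf (4 * 2 ^ j * x) (4 * 2 ^ j * y) (8 * e * 2 ^ j * z)
     = nf (8 * 2 ^ j * x') (8 * 2 ^ j * y') (16 * e * 2 ^ j * z')"
    "[x' = x] (mod 16 * e)" "[y' = y] (mod 4 * e)" "[z' = z] (mod 8)"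
    using nf_square3 by blast
  have pow: "(2::int) ^ i = 4 * 2 ^ j" "(2::int) ^ Suc i = 8 * 2 ^ j" by (simp_all add: j)
  have "?x [^] (2 ^ Suc i :: nat) = ?x [^] (2 ^ i :: nat) \<otimes> ?x [^] (2 ^ i :: nat)"
    using nat_pow_mult[OF nf_closed, of a c "2 * e * b" "2 ^ i" "2 ^ i"] by (simp only: power_Suc mult_2)
  moreover have "?x [^] (2 ^ i :: nat) = nf (4 * 2 ^ j * x) (4 * 2 ^ j * y) (8 * e * 2 ^ j * z)"
    unfolding 1(1) pow by (simp add: mult_ac)
  ultimately have "?x [^] (2 ^ Suc i :: nat) = nf (8 * 2 ^ j * x') (8 * 2 ^ j * y') (16 * e * 2 ^ j * z')"
    by (simp only: 2(1))
  then have "?x [^] (2 ^ Suc i :: nat) = nf (2 ^ Suc i * x') (2 ^ Suc i * y') (2 ^ Suc i * (2 * e * z'))"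
    unfolding pow by (simp add: mult_ac)
  then show ?case using cong_trans[OF 2(2) 1(2)] cong_trans[OF 2(3) 1(3)] cong_trans[OF 2(4) 1(4)] by blast
qed

lemma nf_pow_multiple:
  "nf (8 * e * x) (8 * e * y) (16 * e\<^sup>2 * z) [^] (n::nat) = nf (8 * e * (int n * x)) (8 * e * (int n * y)) (16 * e\<^sup>2 * (int n * z))"
proof (induction n)
  case (Suc n)
  let ?n = "int n"
  obtain k where k: "l = 2 * k + 1" using l by (auto elim: oddE)
  have t: "t2 (16 * e\<^sup>2 * (?n * z) + 1) = 8 * e\<^sup>2 * (?n * z) * (16 * e\<^sup>2 * (?n * z) + 1)"
    using t2[of "16 * e\<^sup>2 * (?n * z) + 1"] by Groebner_Basis.algebra
  show ?case
    unfolding nat_pow_Suc Suc.IH nf_mult_right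
  proof (rule nf_cong_trunc; unfold cong_iff_dvd_diff of_nat_Suc t h_dvd_t(4))
    show "128 * e\<^sup>2 dvd 8 * e * (?n * x) + 8 * e * x - 32 * e\<^sup>2 * l * (16 * e\<^sup>2 * (?n * z)) * x + 64 * e\<^sup>2 * x * (8 * e * (?n * y)) -
        8 * e * ((1 + ?n) * x)" by Groebner_Basis.algebra
    show "32 * e\<^sup>2 dvd 8 * e * (?n * y) + 8 * e * y - 8 * e * x * (16 * e\<^sup>2 * (?n * z)) - 8 * e * ((1 + ?n) * y)"
      by Groebner_Basis.algebra
    show "128 * e\<^sup>2 dvd 16 * e\<^sup>2 * (?n * z) - 8 * e * l * (16 * e\<^sup>2 * (?n * z)) * (8 * e * y) + 64 * e\<^sup>2 * (16 * e\<^sup>2 * (?n * z) *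
        (4 * e * y * (8 * e * y + 1)) + x * (8 * e\<^sup>2 * (?n * z) * (16 * e\<^sup>2 * (?n * z) + 1))) + 16 * e\<^sup>2 * z -
        16 * e\<^sup>2 * ((1 + ?n) * z)" by Groebner_Basis.algebra
  qed
qed simp

text \<open>For exponents without known divisibility, as needed before \<open>odd_exponents\<close>.
  Precision is lower, and the exponent of \<open>C\<close> loses one factor 2.\<close>

lemma nf_pow_two_power_rough:
  "\<exists>x y z. nf a c b [^] (2 ^ Suc i :: nat) = nf (2 ^ Suc i * x) (2 ^ i * y) (2 ^ Suc i * z) \<and>
    [x = a] (mod 4 * e) \<and> [z = b] (mod 4 * e)"
proof (induction i)
  case 0
  have "\<exists>x' y' z'. nf a c b \<otimes> nf a c b = nf (2 * x') (1 * y') (2 * z') \<and>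
    [x' = a] (mod 4 * e) \<and> [y' = 0] (mod 1) \<and> [z' = b] (mod 4 * e)"
  proof (rule nf_mult_lift)
    show "2 * (4 * e) dvd a + an b a * ap (- c) - 2 * a"
      unfolding an_def ap_def unfolding u_def unfolding h by Groebner_Basis.algebra
    show "2 * (4 * e) dvd bn b a * ap (- c) + b - 2 * b"
      unfolding bn_def ap_def unfolding u_def unfolding h by Groebner_Basis.algebra
  qed simp
  then show ?case by (auto simp: numeral_2_eq_2)
next
  case (Suc i)
  then obtain x y z where 1: "nf a c b [^] (2 ^ Suc i :: nat) = nf (2 ^ Suc i * x) (2 ^ i * y) (2 ^ Suc i * z)"
    "[x = a] (mod 4 * e)" "[z = b] (mod 4 * e)" by blast
  define s :: int where "s = 2 ^ i"
  have t: "t2 (2 * s * z + 1) = s * z * (2 * s * z + 1)" "t2 (2 * s * x) = s * x * (2 * s * x - 1)"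
    using t2[of "2 * s * z + 1"] t2[of "2 * s * x"] by Groebner_Basis.algebra+
  have "\<exists>x' y' z'. nf (2 * s * x) (s * y) (2 * s * z) \<otimes> nf (2 * s * x) (s * y) (2 * s * z) =
      nf (4 * s * x') (2 * s * y') (4 * s * z') \<and>
    [x' = x] (mod 4 * e) \<and> [y' = 0] (mod 1) \<and> [z' = z] (mod 4 * e)"
  proof (rule nf_mult_lift)
    show "4 * s * (4 * e) dvd 2 * s * x + an (2 * s * z) (2 * s * x) * ap (- (s * y)) - 4 * s * x"
      unfolding an_def ap_def t unfolding u_def unfolding h by Groebner_Basis.algebra
    show "2 * s * 1 dvd s * y - Sn (2 * s * z) (2 * s * x) + s * y - 2 * s * 0"
      unfolding Sn_def t unfolding u_def unfolding h by Groebner_Basis.algebra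
    show "4 * s * (4 * e) dvd bn (2 * s * z) (2 * s * x) * ap (- (s * y)) + 2 * s * z - 4 * s * z"
      unfolding bn_def ap_def t unfolding u_def unfolding h by Groebner_Basis.algebra
  qed
  then obtain x' y' z' where 2: "nf (2 * s * x) (s * y) (2 * s * z) \<otimes> nf (2 * s * x) (s * y) (2 * s * z) =
      nf (4 * s * x') (2 * s * y') (4 * s * z')"
    "[x' = x] (mod 4 * e)" "[z' = z] (mod 4 * e)" by blast
  have "nf a c b [^] (2 ^ Suc (Suc i) :: nat) = nf a c b [^] (2 ^ Suc i :: nat) \<otimes> nf a c b [^] (2 ^ Suc i :: nat)"
    by (simp add: nat_pow_mult mult_2)
  moreover have "nf a c b [^] (2 ^ Suc i :: nat) = nf (2 * s * x) (s * y) (2 * s * z)"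
    using 1(1) by (simp add: s_def)
  ultimately have "nf a c b [^] (2 ^ Suc (Suc i) :: nat) = nf (4 * s * x') (2 * s * y') (4 * s * z')"
    by (simp only: 2(1))
  then have "nf a c b [^] (2 ^ Suc (Suc i) :: nat) = nf (2 ^ Suc (Suc i) * x') (2 ^ Suc i * y') (2 ^ Suc (Suc i) * z')"
    by (simp add: s_def)
  then show ?case using cong_trans[OF 2(2) 1(2)] cong_trans[OF 2(3) 1(3)] by blast
qed

lemma nf_pow_multiple_rough:
  "\<exists>x' y' z'. nf (8 * e * x) (4 * e * y) (8 * e * z) [^] (n::nat) = nf (8 * e * x') (4 * e * y') (8 * e * z') \<and>
    [x' = int n * x] (mod 4 * e) \<and> [z' = int n * z] (mod 4 * e)"
proof (induction n)
  case 0
  show ?case by (rule exI[of _ 0], rule exI[of _ 0], rule exI[of _ 0]) simp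
next
  case (Suc n)
  then obtain x1 y1 z1 where 1: "nf (8 * e * x) (4 * e * y) (8 * e * z) [^] n = nf (8 * e * x1) (4 * e * y1) (8 * e * z1)"
    "[x1 = int n * x] (mod 4 * e)" "[z1 = int n * z] (mod 4 * e)" by blast
  have "\<exists>x' y' z'. nf (8 * e * x1) (4 * e * y1) (8 * e * z1) \<otimes> nf (8 * e * x) (4 * e * y) (8 * e * z) =
      nf (8 * e * x') (4 * e * y') (8 * e * z') \<and>
    [x' = x1 + x] (mod 4 * e) \<and> [y' = 0] (mod 1) \<and> [z' = z1 + z] (mod 4 * e)"
  proof (rule nf_mult_lift)
    obtain r where r: "t3 (8 * e * x) = 4 * e * r" using h_dvd_t(1) by blast
    show "8 * e * (4 * e) dvd 8 * e * x1 + an (8 * e * z1) (8 * e * x) * ap (- (4 * e * y1)) - 8 * e * (x1 + x)"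
      unfolding an_def ap_def h_dvd_t(3,4) r unfolding u_def unfolding h by Groebner_Basis.algebra
    show "4 * e * 1 dvd 4 * e * y1 - Sn (8 * e * z1) (8 * e * x) + 4 * e * y - 4 * e * 0"
      unfolding Sn_def h_dvd_t(3,4) r unfolding u_def unfolding h by Groebner_Basis.algebra
    show "8 * e * (4 * e) dvd bn (8 * e * z1) (8 * e * x) * ap (- (4 * e * y)) + 8 * e * z - 8 * e * (z1 + z)"
      unfolding bn_def ap_def h_dvd_t(3,4) r unfolding u_def unfolding h by Groebner_Basis.algebra
  qed
  then obtain x' y' z' where 2: "nf (8 * e * x1) (4 * e * y1) (8 * e * z1) \<otimes> nf (8 * e * x) (4 * e * y) (8 * e * z) =
      nf (8 * e * x') (4 * e * y') (8 * e * z')" "[x' = x1 + x] (mod 4 * e)" "[z' = z1 + z] (mod 4 * e)" by blast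
  have "[x1 + x = int (Suc n) * x] (mod 4 * e)" "[z1 + z = int (Suc n) * z] (mod 4 * e)"
    using cong_add[OF 1(2) cong_refl[of x]] cong_add[OF 1(3) cong_refl[of z]] by (simp_all add: algebra_simps)
  then have "[x' = int (Suc n) * x] (mod 4 * e)" "[z' = int (Suc n) * z] (mod 4 * e)"
    using 2(2,3) cong_trans by blast+
  then show ?case unfolding nat_pow_Suc 1(1) 2(1) by blast
qed

end

section \<open>Congruences forced by the conjugation relations\<close>

lemma dvd_transfer: "n dvd x - y \<Longrightarrow> n dvd x \<Longrightarrow> n dvd (y::int)"
  using dvd_diff[of n x "x - y"] by simp

context macdonald_trunc
begin

text \<open>The last factor stands for the power of \<open>X\<close> with exponent
  \<open>2 ^ m * n\<close> in the relation between \<open>X\<close> and \<open>W\<close>. The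
  conclusions compare the exponents of \<open>C\<close>, those of \<open>B\<close>, and the
  differences of those of \<open>A\<close> and \<open>B\<close>; \<open>b1\<close> is the exponent
  of \<open>B\<close> in \<open>W\<close> times \<open>X\<close>.\<close>

lemma relation_dvd:
  assumes "nf a c b \<otimes> nf (8 * e * p) d (8 * e * q) = nf (8 * e * p) d (8 * e * q) \<otimes> nf a c b \<otimes> nf (8 * e * r) s t"
  defines "b1 \<equiv> 8 * e * q + 32 * e\<^sup>2 * l * a * q + 64 * e\<^sup>2 * q * c + b"
  shows "32 * e\<^sup>2 dvd 8 * e * (a * q - p * b) - s + 8 * e * r * b"
    and "32 * e\<^sup>2 dvd 8 * e * l * b * (s - d) - t"
    and "128 * e\<^sup>2 dvd (a + 8 * e * p - 32 * e\<^sup>2 * l * b * p + 64 * e\<^sup>2 * p * c) -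
      (b - 8 * e * l * b * d + 64 * e\<^sup>2 * (b * t2 (d + 1) + p * t2 (b + 1)) + 8 * e * q) -
      ((8 * e * p + a - 8 * e * l * a * d + 64 * e\<^sup>2 * (a * t2 (d + 1) + q * t2 a)) + 8 * e * r
        - 32 * e\<^sup>2 * l * b1 * r + 64 * e\<^sup>2 * r * (c + d - 8 * e * q * a) -
      (b1 - 8 * e * l * b1 * s + 64 * e\<^sup>2 * (b1 * t2 (s + 1) + r * t2 (b1 + 1)) + t))"
proof -
  note eq = nf_eq_trunc[OF assms(1)[unfolded nf_mult_right nf_mult_left], folded b1_def, unfolded cong_iff_dvd_diff]
  show "128 * e\<^sup>2 dvd (a + 8 * e * p - 32 * e\<^sup>2 * l * b * p + 64 * e\<^sup>2 * p * c) -
      (b - 8 * e * l * b * d + 64 * e\<^sup>2 * (b * t2 (d + 1) + p * t2 (b + 1)) + 8 * e * q) -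
      ((8 * e * p + a - 8 * e * l * a * d + 64 * e\<^sup>2 * (a * t2 (d + 1) + q * t2 a)) + 8 * e * r
        - 32 * e\<^sup>2 * l * b1 * r + 64 * e\<^sup>2 * r * (c + d - 8 * e * q * a) -
      (b1 - 8 * e * l * b1 * s + 64 * e\<^sup>2 * (b1 * t2 (s + 1) + r * t2 (b1 + 1)) + t))"
    using eq by blast
  have 1: "32 * e\<^sup>2 dvd c + d - 8 * e * p * b - (c + d - 8 * e * q * a + s - 8 * e * r * b1)" using eq by blast
  show "32 * e\<^sup>2 dvd 8 * e * (a * q - p * b) - s + 8 * e * r * b"
    by (rule dvd_transfer[OF _ 1]) (unfold b1_def, Groebner_Basis.algebra)
  have 2: "32 * e\<^sup>2 dvd b - 8 * e * l * b * d + 64 * e\<^sup>2 * (b * t2 (d + 1) + p * t2 (b + 1)) + 8 * e * q -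
    (b1 - 8 * e * l * b1 * s + 64 * e\<^sup>2 * (b1 * t2 (s + 1) + r * t2 (b1 + 1)) + t)" using eq by blast
  show "32 * e\<^sup>2 dvd 8 * e * l * b * (s - d) - t"
  proof (rule dvd_transfer[OF _ 2])
    define T where "T = t2 (s + 1)"
    define T' where "T' = t2 (b1 + 1)"
    show "32 * e\<^sup>2 dvd b - 8 * e * l * b * d + 64 * e\<^sup>2 * (b * t2 (d + 1) + p * t2 (b + 1)) + 8 * e * q -
      (b1 - 8 * e * l * b1 * s + 64 * e\<^sup>2 * (b1 * t2 (s + 1) + r * t2 (b1 + 1)) + t) -
      (8 * e * l * b * (s - d) - t)"
      unfolding T_def[symmetric] T'_def[symmetric] unfolding b1_def by Groebner_Basis.algebra
  qed
qed

lemma dvd_cancel_8e: "8 * e * x dvd 8 * e * y \<Longrightarrow> x dvd y"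
  using e_pos dvd_mult_cancel_left[of "8 * e" x y] by simp

lemma relation_dvd_rough:
  assumes "nf a c b \<otimes> nf (8 * e * p) d (8 * e * q) = nf (8 * e * p) d (8 * e * q) \<otimes> nf a c b \<otimes> nf (8 * e * r) (4 * e * s) (8 * e * t)"
  shows "4 * e dvd l * a * d - r" "4 * e dvd l * b * d + t"
proof -
  note R = relation_dvd[OF assms]
  have e: "8 * e * (4 * e) = 32 * e\<^sup>2" by (simp add: power2_eq_square)
  have "32 * e\<^sup>2 dvd 8 * e * (- (l * b * d + t))"
    by (rule dvd_transfer[OF _ R(2)]) Groebner_Basis.algebra
  then have "8 * e * (4 * e) dvd 8 * e * (- (l * b * d + t))" unfolding e .
  then have "4 * e dvd - (l * b * d + t)" by (rule dvd_cancel_8e)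
  then show t: "4 * e dvd l * b * d + t" by (simp only: dvd_minus_iff)
  have R3: "32 * e\<^sup>2 dvd y" if "128 * e\<^sup>2 dvd y" for y
    using that by (rule dvd_trans[rotated]) (simp add: dvd_def)
  define b1 where "b1 = 8 * e * q + 32 * e\<^sup>2 * l * a * q + 64 * e\<^sup>2 * q * c + b"
  define T where "T = t2 (4 * e * s + 1)"
  define T' where "T' = t2 (b1 + 1)"
  have "32 * e\<^sup>2 dvd 8 * e * (l * (a + b) * d - r + t)"
    by (rule dvd_transfer[OF _ R3[OF R(3)]], unfold b1_def[symmetric] T_def[symmetric] T'_def[symmetric], unfold b1_def)
      Groebner_Basis.algebra
  then have "8 * e * (4 * e) dvd 8 * e * (l * (a + b) * d - r + t)" unfolding e .
  then have "4 * e dvd l * (a + b) * d - r + t" by (rule dvd_cancel_8e)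
  then have "4 * e dvd (l * (a + b) * d - r + t) - (l * b * d + t)" using t by (rule dvd_diff)
  then show "4 * e dvd l * a * d - r" by (simp add: algebra_simps)
qed

lemma relation_dvd_fine:
  assumes R: "nf a c (2 * e * b) \<otimes> nf (8 * e * p) d (8 * e * q) =
      nf (8 * e * p) d (8 * e * q) \<otimes> nf a c (2 * e * b) \<otimes> nf (8 * e * r) (8 * e * s) (16 * e\<^sup>2 * t)"
    and odd: "odd a" "odd d" "odd r"
  shows "4 * e dvd a * q - 2 * e * p * b - s + 2 * e * b"
    and "16 * e dvd l * (a + 2 * e * b) * d - r + 2 * e * t + 4 * e * l * a * q +
      8 * e * (p * c + t2 (d + 1) + q * t2 a + q * c + c + 1)"
proof -
  note R = relation_dvd[OF R]
  obtain k where k: "l = 2 * k + 1" using l by (auto elim: oddE)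
  obtain r1 where r: "r = 2 * r1 + 1" using odd by (auto elim: oddE)
  obtain d1 where d: "d = 2 * d1 + 1" using odd by (auto elim: oddE)
  obtain a1 where a: "a = 2 * a1 + 1" using odd by (auto elim: oddE)
  have "32 * e\<^sup>2 dvd 8 * e * (a * q - 2 * e * p * b - s + 2 * e * b)"
    by (rule dvd_transfer[OF _ R(1)], unfold r) Groebner_Basis.algebra
  then have "8 * e * (4 * e) dvd 8 * e * (a * q - 2 * e * p * b - s + 2 * e * b)" by (simp add: power2_eq_square)
  then show "4 * e dvd a * q - 2 * e * p * b - s + 2 * e * b" by (rule dvd_cancel_8e)
  define b1 where "b1 = 8 * e * q + 32 * e\<^sup>2 * l * a * q + 64 * e\<^sup>2 * q * c + 2 * e * b"
  define V where "V = q + 4 * e * l * a * q + 8 * e * q * c"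
  have V: "b1 = 2 * e * (b + 4 * V)" by (simp add: b1_def V_def algebra_simps power2_eq_square)
  have t: "t2 (2 * e * x + 1) = e * x * (2 * e * x + 1)" for x using t2[of "2 * e * x + 1"] by Groebner_Basis.algebra
  have "128 * e\<^sup>2 dvd 8 * e * (l * (a + 2 * e * b) * d - r + 2 * e * t + 4 * e * l * a * q +
      8 * e * (p * c + t2 (d + 1) + q * t2 a + q * c + c + 1))"
  proof (rule dvd_transfer[OF _ R(3)], unfold b1_def[symmetric], unfold V t h_dvd_t(4))
    define T where "T = t2 (d + 1)"
    define T' where "T' = t2 a"
    show "128 * e\<^sup>2 dvd (a + 8 * e * p - 32 * e\<^sup>2 * l * (2 * e * b) * p + 64 * e\<^sup>2 * p * c) -
      (2 * e * b - 8 * e * l * (2 * e * b) * d + 64 * e\<^sup>2 * (2 * e * b * t2 (d + 1) + p * (e * b * (2 * e * b + 1))) + 8 * e * q) -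
      ((8 * e * p + a - 8 * e * l * a * d + 64 * e\<^sup>2 * (a * t2 (d + 1) + q * t2 a)) + 8 * e * r
        - 32 * e\<^sup>2 * l * (2 * e * (b + 4 * V)) * r + 64 * e\<^sup>2 * r * (c + d - 8 * e * q * a) -
      (2 * e * (b + 4 * V) - 8 * e * l * (2 * e * (b + 4 * V)) * (8 * e * s) +
        64 * e\<^sup>2 * (2 * e * (b + 4 * V) * (4 * e * s * (8 * e * s + 1)) + r * (e * (b + 4 * V) * (2 * e * (b + 4 * V) + 1)))
        + 16 * e\<^sup>2 * t)) -
      8 * e * (l * (a + 2 * e * b) * d - r + 2 * e * t + 4 * e * l * a * q +
        8 * e * (p * c + t2 (d + 1) + q * t2 a + q * c + c + 1))"
      unfolding T_def[symmetric] T'_def[symmetric] unfolding V_def unfolding a unfolding d unfolding r unfolding k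
      by Groebner_Basis.algebra
  qed
  then have "8 * e * (16 * e) dvd 8 * e * (l * (a + 2 * e * b) * d - r + 2 * e * t + 4 * e * l * a * q +
      8 * e * (p * c + t2 (d + 1) + q * t2 a + q * c + c + 1))" by (simp add: power2_eq_square)
  then show "16 * e dvd l * (a + 2 * e * b) * d - r + 2 * e * t + 4 * e * l * a * q +
      8 * e * (p * c + t2 (d + 1) + q * t2 a + q * c + c + 1)" by (rule dvd_cancel_8e)
qed


lemma pow_8e: "x \<in> carrier G \<Longrightarrow> x [^] (8 * e * int n) = (x [^] (2 ^ m :: nat)) [^] n"
proof -
  assume x: "x \<in> carrier G"
  have "8 * e * int n = int (2 ^ m * n)" using two_m by simp
  then show ?thesis using x by (simp only: int_pow_int nat_pow_pow)
qed

text \<open>The signs differ because conjugation by \<open>C\<close> multiplies exponents of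
  \<open>A\<close> by \<open>1 + u\<close> and divides those of \<open>B\<close> by it. For odd
  \<open>n\<close> this prevents \<open>a\<close> and \<open>b\<close> from being both odd.\<close>

lemma conj_rough:
  assumes R: "nf a c b \<otimes> nf (8 * e * p) d (8 * e * q) = nf (8 * e * p) d (8 * e * q) \<otimes> nf a c b [^] (1 + 8 * e * int n)"
  shows "4 * e dvd a * (l * d - int n)" "4 * e dvd b * (l * d + int n)"
proof -
  define i where "i = m - 1"
  have i: "m = Suc i" "i = Suc (Suc (m - 3))" using m3 by (simp_all add: i_def)
  have i4: "2 ^ i = 4 * e" unfolding e_def by (subst i(2)) simp
  obtain x y z where 1: "nf a c b [^] (2 ^ m :: nat) = nf (8 * e * x) (4 * e * y) (8 * e * z)"
    "[x = a] (mod 4 * e)" "[z = b] (mod 4 * e)"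
    using nf_pow_two_power_rough[of a c b i] unfolding i(1)[symmetric] two_m i4 by blast
  obtain x' y' z' where 2: "nf (8 * e * x) (4 * e * y) (8 * e * z) [^] n = nf (8 * e * x') (4 * e * y') (8 * e * z')"
    "[x' = int n * x] (mod 4 * e)" "[z' = int n * z] (mod 4 * e)"
    using nf_pow_multiple_rough by blast
  have "nf a c b [^] (1 + 8 * e * int n) = nf a c b \<otimes> nf (8 * e * x') (4 * e * y') (8 * e * z')"
    by (simp only: int_pow_mult nf_closed pow_8e 1(1) 2(1) int_pow_1)
  then have "nf a c b \<otimes> nf (8 * e * p) d (8 * e * q) =
      nf (8 * e * p) d (8 * e * q) \<otimes> nf a c b \<otimes> nf (8 * e * x') (4 * e * y') (8 * e * z')"
    using R by (simp only: m_assoc nf_closed)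
  note D = relation_dvd_rough[OF this]
  have x: "4 * e dvd x' - int n * a" and z: "4 * e dvd z' - int n * b"
    using cong_trans[OF 2(2) cong_scalar_left[OF 1(2)]] cong_trans[OF 2(3) cong_scalar_left[OF 1(3)]]
    by (simp_all only: cong_iff_dvd_diff)
  have "a * (l * d - int n) = (l * a * d - x') + (x' - int n * a)" "b * (l * d + int n) = (l * b * d + z') - (z' - int n * b)"
    by Groebner_Basis.algebra+
  then show "4 * e dvd a * (l * d - int n)" "4 * e dvd b * (l * d + int n)"
    using dvd_add[OF D(1) x] dvd_diff[OF D(2) z] by simp_all
qed

text \<open>The term \<open>8 * e * (t2 (d + 1) + 1 + p * q)\<close> is the same for
  \<open>Y\<close> as for \<open>X\<close>, because the interchange replaces \<open>p\<close> and
  \<open>q\<close> by \<open>- q\<close> and \<open>- p\<close>. It will cancel when the two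
  congruences are subtracted.\<close>

lemma conj_fine:
  assumes R: "nf a c (2 * e * b) \<otimes> nf (8 * e * p) d (8 * e * q) =
      nf (8 * e * p) d (8 * e * q) \<otimes> nf a c (2 * e * b) [^] (1 + 8 * e * int n)"
    and odd: "odd a" "odd d" "odd n"
  shows "4 * e dvd a * q - 2 * e * p * b - int n * (c - e * a * b)"
    and "16 * e dvd l * (a + 2 * e * b) * d - int n * (a - 2 * e * b) - 8 * e * (t2 (d + 1) + 1 + p * q)"
proof -
  have m2: "2 \<le> m" using m3 by simp
  obtain x y z where 1: "nf a c (2 * e * b) [^] (2 ^ m :: nat) = nf (8 * e * x) (8 * e * y) (8 * e * (2 * e * z))"
    "[x = a - 4 * e * l * a * c + 8 * e * (c + e * b * t2 a)] (mod 16 * e)"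
    "[y = c - e * a * b - 2 * e * b] (mod 4 * e)"
    "[z = b + 2 * e * l * a * b * (2 * e * b + 1) - 4 * e * l * b * c + 4 * e * b] (mod 8)"
    using nf_pow_two_power[OF odd(1) m2, of c b] unfolding two_m by blast
  have e2: "8 * e * (2 * e * z) = 16 * e\<^sup>2 * z" by (simp add: power2_eq_square)
  define N where "N = int n"
  have N: "odd N" using odd by (simp add: N_def)
  have "nf a c (2 * e * b) [^] (1 + 8 * e * N) = nf a c (2 * e * b) \<otimes> nf (8 * e * (N * x)) (8 * e * (N * y)) (16 * e\<^sup>2 * (N * z))"
    by (simp only: N_def int_pow_mult nf_closed pow_8e 1(1) e2 nf_pow_multiple int_pow_1)
  then have R': "nf a c (2 * e * b) \<otimes> nf (8 * e * p) d (8 * e * q) =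
      nf (8 * e * p) d (8 * e * q) \<otimes> nf a c (2 * e * b) \<otimes> nf (8 * e * (N * x)) (8 * e * (N * y)) (16 * e\<^sup>2 * (N * z))"
    using R by (simp only: N_def[symmetric] m_assoc nf_closed)
  obtain w1 where x: "x = a - 4 * e * l * a * c + 8 * e * (c + e * b * t2 a) + 16 * e * w1"
    using 1(2) by (metis cong_iff_lin cong_sym)
  obtain w2 where y: "y = c - e * a * b - 2 * e * b + 4 * e * w2" using 1(3) by (metis cong_iff_lin cong_sym)
  obtain w3 where z: "z = b + 2 * e * l * a * b * (2 * e * b + 1) - 4 * e * l * b * c + 4 * e * b + 8 * w3"
    using 1(4) by (metis cong_iff_lin cong_sym)
  have "odd x" unfolding x using odd by simp
  then have Nx: "odd (N * x)" using N by simp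
  note D = relation_dvd_fine[OF R' odd(1,2) Nx]
  obtain n1 where n: "N = 2 * n1 + 1" using N by (auto elim: oddE)
  obtain k where k: "l = 2 * k + 1" using l by (auto elim: oddE)
  obtain d1 where d: "d = 2 * d1 + 1" using odd by (auto elim: oddE)
  obtain a1 where a: "a = 2 * a1 + 1" using odd by (auto elim: oddE)
  have ii: "4 * e dvd a * q - 2 * e * p * b - N * (c - e * a * b)"
  proof (rule dvd_transfer[OF _ D(1)])
    show "4 * e dvd a * q - 2 * e * p * b - N * y + 2 * e * b - (a * q - 2 * e * p * b - N * (c - e * a * b))"
      unfolding y n by Groebner_Basis.algebra
  qed
  then show "4 * e dvd a * q - 2 * e * p * b - int n * (c - e * a * b)" unfolding N_def .
  have "2 dvd a * q - 2 * e * p * b - N * (c - e * a * b)"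
    by (rule dvd_trans[OF _ ii]) simp
  then have "even (q - c - e * b)" using N odd by auto
  then obtain q1 where q: "q = c + e * b + 2 * q1" by (metis add.commute diff_diff_eq diff_eq_eq dvd_def)
  \<comment> \<open>Multiplied by \<open>4 * e * l\<close>, the first congruence becomes one modulo
    \<open>16 * e\<close> and removes the term \<open>4 * e * l * a * q\<close> from the
    second.\<close>
  have "4 * e * (4 * e) dvd 4 * e * l * (a * q - 2 * e * p * b - N * (c - e * a * b))"
    by (rule mult_dvd_mono[OF dvd_triv_left ii])
  then have "16 * e dvd 4 * e * l * (a * q - 2 * e * p * b - N * (c - e * a * b))"
    by (rule dvd_trans[rotated]) simp
  note D2 = dvd_diff[OF D(2) this]
  \<comment> \<open>With coefficient \<open>8 * e\<close> only parities matter, so squares may be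
    replaced by their bases. This removes the squares that arise from substituting for
    \<open>q\<close>.\<close>
  have "2 * (8 * e) dvd 8 * e * (c * c - c)" "2 * (8 * e) dvd 8 * e * ((e * b) * (e * b) - e * b)"
    by (intro dvd_even_mult; simp)+
  then have sq: "16 * e dvd 8 * e * (c * c - c) + 8 * e * ((e * b) * (e * b) - e * b)" by simp
  have t: "t2 a = a1 * (2 * a1 + 1)" using t2[of a] unfolding a by Groebner_Basis.algebra
  define T where "T = t2 (d + 1)"
  show "16 * e dvd l * (a + 2 * e * b) * d - int n * (a - 2 * e * b) - 8 * e * (t2 (d + 1) + 1 + p * q)"
    unfolding N_def[symmetric]
  proof (rule dvd_transfer[OF dvd_transfer[OF _ sq] D2], unfold T_def[symmetric])
    show "16 * e dvd 8 * e * (c * c - c) + 8 * e * ((e * b) * (e * b) - e * b) -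
      (l * (a + 2 * e * b) * d - N * x + 2 * e * (N * z) + 4 * e * l * a * q +
      8 * e * (p * c + T + q * t2 a + q * c + c + 1) -
      4 * e * l * (a * q - 2 * e * p * b - N * (c - e * a * b)) -
      (l * (a + 2 * e * b) * d - N * (a - 2 * e * b) - 8 * e * (T + 1 + p * q)))"
      unfolding x z t unfolding q unfolding a n k by Groebner_Basis.algebra
  qed
qed

end

lemma two_power_dvd_mult_odd:
  assumes "odd (x::int)" "2 ^ j dvd y * x" shows "2 ^ j dvd y"
proof -
  have "coprime (2 ^ j) x" using assms(1) by simp
  then show ?thesis using assms(2) coprime_dvd_mult_left_iff by blast
qed

context macdonald_trunc
begin

text \<open>\<open>Y\<close> is written with \<open>B\<close> first because this is its normal form
  for the interchanged generators. The lemma is thus also applicable with \<open>X\<close> and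
  \<open>Y\<close> exchanged.\<close>

lemma commutator_exponents:
  assumes R: "(B [^] b2 \<otimes> C [^] (- c2) \<otimes> A [^] a2) \<otimes> nf a c b \<otimes> nf (8 * e * p) d (8 * e * q) =
      nf a c b \<otimes> (B [^] b2 \<otimes> C [^] (- c2) \<otimes> A [^] a2)"
  defines "\<beta> \<equiv> b + b2" and "s \<equiv> a2 + a"
  shows "8 * e dvd a * b2 - a2 * b - d"
    and "4 * e dvd l * (\<beta> * t2 a2 - b2 * t2 s - c * a2 - a * c2) - p"
    and "4 * e dvd l * (a2 * t2 (\<beta> + 1) - s * t2 (b2 + 1) + b * c2 + b2 * c + \<beta> * d) - q"
proof -
  define b' where "b' = \<beta> * ap c2"
  define b2' where "b2' = b2 * ap c2"
  have Y: "B [^] b2 \<otimes> C [^] (- c2) = nf 0 (- c2) b2'"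
    using nf_C[of 0 0 b2 "- c2"] by (simp add: nf_def b2'_def)
  have "nf a c b \<otimes> (B [^] b2 \<otimes> C [^] (- c2) \<otimes> A [^] a2) = nf a c b \<otimes> B [^] b2 \<otimes> C [^] (- c2) \<otimes> A [^] a2"
    by (simp add: m_assoc)
  also have "\<dots> = nf a (c - c2) b' \<otimes> nf a2 0 0"
    unfolding nf_B nf_C by (simp add: b'_def \<beta>_def nf_def)
  finally have 1: "nf a c b \<otimes> (B [^] b2 \<otimes> C [^] (- c2) \<otimes> A [^] a2) = nf a (c - c2) b' \<otimes> nf a2 0 0" .
  have 2: "B [^] b2 \<otimes> C [^] (- c2) \<otimes> A [^] a2 \<otimes> nf a c b = nf 0 (- c2) b2' \<otimes> nf s c b"
    unfolding Y by (simp add: m_assoc A_nf s_def)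
  define b1 where "b1 = bn b2' s * ap (- c) + b"
  note eq = nf_eq_trunc[OF R[symmetric, unfolded 1 2 nf_mult[of 0] nf_mult[of a] nf_mult_right, folded b1_def], unfolded cong_iff_dvd_diff]
  \<comment> \<open>Passing a power of \<open>C\<close> changes the exponent \<open>\<beta>\<close>
    by a multiple of \<open>8 * e = 2 * h\<close>, so its binomial coefficient changes only by a
    multiple of \<open>4 * e\<close>; likewise for \<open>b2\<close> below.\<close>
  obtain V where "t2 (\<beta> + 1 + 2 * h * (\<beta> * (l * c2 + 8 * e * l\<^sup>2 * t2 c2))) = t2 (\<beta> + 1) + h * V"
    using t2_shift by blast
  moreover have b': "b' = \<beta> + 8 * e * (\<beta> * (l * c2 + 8 * e * l\<^sup>2 * t2 c2))"
    unfolding b'_def ap_def unfolding u_def unfolding h by Groebner_Basis.algebra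
  ultimately have V: "t2 (b' + 1) = t2 (\<beta> + 1) + 4 * e * V" by (simp add: h algebra_simps)
  obtain U where "t2 (b2 + 1 + 2 * h * (b2 * (l * c2 + 8 * e * l\<^sup>2 * t2 c2))) = t2 (b2 + 1) + h * U"
    using t2_shift by blast
  moreover have b2': "b2' = b2 + 8 * e * (b2 * (l * c2 + 8 * e * l\<^sup>2 * t2 c2))"
    unfolding b2'_def ap_def unfolding u_def unfolding h by Groebner_Basis.algebra
  ultimately have U: "t2 (b2' + 1) = t2 (b2 + 1) + 4 * e * U" by (simp add: h algebra_simps)
  define S where "S = t3 (b' + 1)"
  define S2 where "S2 = t3 (b2' + 1)"
  define T where "T = t2 (\<beta> + 1)"
  define T2 where "T2 = t2 (b2 + 1)"
  define T1 where "T1 = t2 (b1 + 1)"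
  define Td where "Td = t2 (d + 1)"
  define v where "v = l * c2 + 8 * e * l\<^sup>2 * t2 c2"
  note folds = S_def[symmetric] S2_def[symmetric] V U T_def[symmetric] T2_def[symmetric] T1_def[symmetric] Td_def[symmetric]
  have R3: "32 * e\<^sup>2 dvd y" if "128 * e\<^sup>2 dvd y" for y
    using that by (rule dvd_trans[rotated]) (simp add: dvd_def)
  have e: "8 * e * (4 * e) = 32 * e\<^sup>2" by (simp add: power2_eq_square)
  have db: "32 * e\<^sup>2 dvd bn b' a2 * ap (- 0) + 0 - (b1 - 8 * e * l * b1 * d + 64 * e\<^sup>2 * (b1 * t2 (d + 1) + p * t2 (b1 + 1)) + 8 * e * q)"
    and dc: "32 * e\<^sup>2 dvd c - c2 - Sn b' a2 + 0 - (- c2 - Sn b2' s + c + d - 8 * e * p * b1)"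
    and dab: "128 * e\<^sup>2 dvd (a + an b' a2 * ap (- (c - c2))) - (bn b' a2 * ap (- 0) + 0) -
      (0 + an b2' s * ap (- (- c2)) + 8 * e * p - 32 * e\<^sup>2 * l * b1 * p + 64 * e\<^sup>2 * p * (- c2 - Sn b2' s + c) -
      (b1 - 8 * e * l * b1 * d + 64 * e\<^sup>2 * (b1 * t2 (d + 1) + p * t2 (b1 + 1)) + 8 * e * q))"
    using eq by blast+
  have "8 * e dvd c - c2 - Sn b' a2 + 0 - (- c2 - Sn b2' s + c + d - 8 * e * p * b1)"
    using dvd_trans[OF _ dc, of "8 * e"] by (simp add: dvd_def power2_eq_square mult.assoc)
  then show "8 * e dvd a * b2 - a2 * b - d"
  proof (rule dvd_transfer[rotated])
    show "8 * e dvd c - c2 - Sn b' a2 + 0 - (- c2 - Sn b2' s + c + d - 8 * e * p * b1) - (a * b2 - a2 * b - d)"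
      unfolding Sn_def unfolding folds unfolding b' b2' unfolding u_def unfolding h unfolding s_def \<beta>_def by Groebner_Basis.algebra
  qed
  have "32 * e\<^sup>2 dvd (a + an b' a2 * ap (- (c - c2))) -
      (0 + an b2' s * ap (- (- c2)) + 8 * e * p - 32 * e\<^sup>2 * l * b1 * p + 64 * e\<^sup>2 * p * (- c2 - Sn b2' s + c))"
    using dvd_add[OF R3[OF dab] db] by (simp add: algebra_simps)
  then have "8 * e * (4 * e) dvd 8 * e * (l * (\<beta> * t2 a2 - b2 * t2 s - c * a2 - a * c2) - p)"
    unfolding e
  proof (rule dvd_transfer[rotated])
    show "32 * e\<^sup>2 dvd (a + an b' a2 * ap (- (c - c2))) -
      (0 + an b2' s * ap (- (- c2)) + 8 * e * p - 32 * e\<^sup>2 * l * b1 * p + 64 * e\<^sup>2 * p * (- c2 - Sn b2' s + c)) -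
      8 * e * (l * (\<beta> * t2 a2 - b2 * t2 s - c * a2 - a * c2) - p)"
      unfolding an_def ap_def unfolding folds unfolding b' b2' v_def[symmetric] unfolding u_def unfolding h
      unfolding v_def \<beta>_def s_def by Groebner_Basis.algebra
  qed
  then show "4 * e dvd l * (\<beta> * t2 a2 - b2 * t2 s - c * a2 - a * c2) - p" by (rule dvd_cancel_8e)
  have "8 * e * (4 * e) dvd 8 * e * (l * (a2 * t2 (\<beta> + 1) - s * t2 (b2 + 1) + b * c2 + b2 * c + \<beta> * d) - q)"
    unfolding e
  proof (rule dvd_transfer[OF _ db])
    show "32 * e\<^sup>2 dvd bn b' a2 * ap (- 0) + 0 - (b1 - 8 * e * l * b1 * d + 64 * e\<^sup>2 * (b1 * t2 (d + 1) + p * t2 (b1 + 1)) + 8 * e * q) -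
      8 * e * (l * (a2 * t2 (\<beta> + 1) - s * t2 (b2 + 1) + b * c2 + b2 * c + \<beta> * d) - q)"
      unfolding bn_def ap_def unfolding folds unfolding b1_def unfolding bn_def ap_def unfolding folds unfolding b' b2'
      unfolding u_def unfolding h unfolding \<beta>_def s_def by Groebner_Basis.algebra
  qed
  then show "4 * e dvd l * (a2 * t2 (\<beta> + 1) - s * t2 (b2 + 1) + b * c2 + b2 * c + \<beta> * d) - q" by (rule dvd_cancel_8e)
qed

end

lemma dvd_diff_ex: "n dvd x - y \<Longrightarrow> \<exists>k. x = y + n * k" "n dvd y - x \<Longrightarrow> \<exists>k. x = y + n * (k::int)"
proof -
  show "\<exists>k. x = y + n * k" if "n dvd x - y" using that by (auto simp: dvd_def algebra_simps)
  assume "n dvd y - x"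
  then obtain k where "y - x = n * k" by blast
  then have "x = y + n * (- k)" by simp
  then show "\<exists>k. x = y + n * k" by blast
qed

lemma t2_eqI: "x * (x - 1) = 2 * y \<Longrightarrow> t2 x = y"
  using t2[of x] by simp

text \<open>Substituting the expressions for \<open>n\<close>, \<open>d\<close>, \<open>p\<close>
  and \<open>q\<close> into the congruence \<open>pq\<close> eliminates \<open>c\<close> and
  \<open>c2\<close>. What remains, doubled, is the claim times the odd number
  \<open>l * a * b2\<close>.\<close>

lemma commutator_congruence:
  fixes a b b2 a2 c c2 p q d n l e :: int
  assumes e: "e = 2 ^ j"
    and odd: "odd a" "odd b2" "odd l"
    and nd: "4 * e dvd l * d - n"
    and d: "8 * e dvd a * b2 - 2 * e * a2 * (2 * e * b) - d"
    and p: "4 * e dvd l * ((2 * e * b + b2) * t2 (2 * e * a2) - b2 * t2 (2 * e * a2 + a) - c * (2 * e * a2) - a * c2) - p"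
    and q: "4 * e dvd l * (2 * e * a2 * t2 (2 * e * b + b2 + 1) - (2 * e * a2 + a) * t2 (b2 + 1) +
      2 * e * b * c2 + b2 * c + (2 * e * b + b2) * d) - q"
    and pq: "4 * e dvd a * q - 2 * e * p * b - n * (c - e * a * b)"
  shows "8 * e dvd a * (b2 - 1) - 2 * e * b * (1 - 2 * e * a2)"
proof -
  obtain a0 where a: "a = 2 * a0 + 1" using odd by (auto elim: oddE)
  obtain b0 where b2: "b2 = 2 * b0 + 1" using odd by (auto elim: oddE)
  have t: "t2 (2 * e * a2) = e * a2 * (2 * e * a2 - 1)" "t2 (2 * e * a2 + a) = (e * a2 + a0) * (2 * e * a2 + a)"
    "t2 (2 * e * b + b2 + 1) = (e * b + b0 + 1) * (2 * e * b + b2)" "t2 (b2 + 1) = (b0 + 1) * b2"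
    unfolding a b2 by (rule t2_eqI, Groebner_Basis.algebra)+
  obtain n' where n: "n = l * d + 4 * e * n'" using dvd_diff_ex(2)[OF nd] by blast
  obtain d' where d': "d = a * b2 - 2 * e * a2 * (2 * e * b) + 8 * e * d'" using dvd_diff_ex(2)[OF d] by blast
  obtain p' where p': "p = l * ((2 * e * b + b2) * t2 (2 * e * a2) - b2 * t2 (2 * e * a2 + a) - c * (2 * e * a2) - a * c2) + 4 * e * p'"
    using dvd_diff_ex(2)[OF p] by blast
  obtain q' where q': "q = l * (2 * e * a2 * t2 (2 * e * b + b2 + 1) - (2 * e * a2 + a) * t2 (b2 + 1) +
      2 * e * b * c2 + b2 * c + (2 * e * b + b2) * d) + 4 * e * q'"
    using dvd_diff_ex(2)[OF q] by blast
  have "2 * (4 * e) dvd 2 * (a * q - 2 * e * p * b - n * (c - e * a * b))" using pq by (intro mult_dvd_mono) simp_all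
  then have "8 * e dvd 2 * (a * q - 2 * e * p * b - n * (c - e * a * b))" by simp
  then have "8 * e dvd (a * (b2 - 1) - 2 * e * b * (1 - 2 * e * a2)) * (l * a * b2)"
  proof (rule dvd_transfer[rotated])
    show "8 * e dvd 2 * (a * q - 2 * e * p * b - n * (c - e * a * b)) - (a * (b2 - 1) - 2 * e * b * (1 - 2 * e * a2)) * (l * a * b2)"
      unfolding p' q' unfolding n t unfolding d' unfolding b2 a by Groebner_Basis.algebra
  qed
  moreover have pow: "8 * e = 2 ^ (j + 3)" by (simp add: e power_add)
  moreover have "odd (l * a * b2)" using odd by simp
  ultimately show ?thesis unfolding pow by (blast intro: two_power_dvd_mult_odd)
qed

text \<open>The hypotheses \<open>ab\<close> tie \<open>a\<close> to \<open>a2\<close> and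
  \<open>b2\<close> to \<open>b\<close>, and the difference of \<open>X\<close> and \<open>Y\<close>
  ties \<open>a2\<close> to \<open>b\<close>. Then \<open>d\<close> is known modulo
  \<open>8 * e\<close> in terms of \<open>b\<close> alone, and \<open>X\<close> becomes a congruence
  between \<open>l\<close> and \<open>n\<close>.\<close>

lemma parameter_congruence:
  fixes a b b2 a2 d n l e K :: int
  assumes e: "e = 2 ^ j"
    and odd: "odd a" "odd b2" "odd n" "odd l"
    and nd: "4 * e dvd l * d - n"
    and d: "8 * e dvd a * b2 - 2 * e * a2 * (2 * e * b) - d"
    and ab: "8 * e dvd a * (b2 - 1) - 2 * e * b * (1 - 2 * e * a2)" "8 * e dvd b2 * (a - 1) - 2 * e * a2 * (1 - 2 * e * b)"
    and X: "16 * e dvd l * (a + 2 * e * b) * d - n * (a - 2 * e * b) - K"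
    and Y: "16 * e dvd l * (b2 + 2 * e * a2) * d - n * (b2 - 2 * e * a2) - K"
    and K: "8 * e dvd K"
  shows "8 * e dvd l - n"
proof -
  have e0: "e \<noteq> 0" by (simp add: e)
  have pow: "2 * e = 2 ^ (j + 1)" "8 * e = 2 ^ (j + 3)" by (simp_all add: e power_add)
  have half: "\<exists>y. v = 1 + 2 * e * y" if "odd u" "8 * e dvd u * (v - 1) - 2 * e * w * z" for u v w z
  proof -
    have "2 * e dvd u * (v - 1) - 2 * e * w * z" by (rule dvd_trans[OF _ that(2)]) simp
    then have "2 * e dvd (v - 1) * u" by (simp add: mult.commute dvd_diff_left_iff)
    then have "2 * e dvd v - 1" using two_power_dvd_mult_odd[OF that(1)] unfolding pow(1) by blast
    then show ?thesis using dvd_diff_ex(1) by blast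
  qed
  obtain x where x: "a = 1 + 2 * e * x" using half[OF odd(2) ab(2)] by blast
  obtain y where y: "b2 = 1 + 2 * e * y" using half[OF odd(1) ab(1)] by blast
  have four: "4 dvd u" if "8 * e dvd 2 * e * u" for u
  proof -
    have "2 * e * 4 dvd 2 * e * u" using that by simp
    then show ?thesis using e0 dvd_mult_cancel_left[of "2 * e" 4 u] by simp
  qed
  have "4 dvd y - b + 2 * e * (x * y + a2 * b)"
    by (rule four, rule dvd_transfer[OF _ ab(1)]) (unfold x y, Groebner_Basis.algebra)
  moreover have "4 dvd x - a2 + 2 * e * (x * y + a2 * b)"
    by (rule four, rule dvd_transfer[OF _ ab(2)]) (unfold x y, Groebner_Basis.algebra)
  ultimately have xy: "4 dvd y - b + 2 * e * (x * y + a2 * b)" "4 dvd x - a2 + 2 * e * (x * y + a2 * b)" .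
  \<comment> \<open>Modulo 2 these say that \<open>y\<close> agrees with \<open>b\<close> and
    \<open>x\<close> with \<open>a2\<close>. Hence \<open>x * y + a2 * b\<close> is even, and the
    correction term is itself divisible by 4.\<close>
  have "even (y - b + 2 * e * (x * y + a2 * b))" "even (x - a2 + 2 * e * (x * y + a2 * b))"
    using dvd_trans[OF _ xy(1), of 2] dvd_trans[OF _ xy(2), of 2] by simp_all
  then have "even (x * y + a2 * b)" by auto
  then have "2 * (2 * e) dvd 2 * e * (x * y + a2 * b)" by (rule dvd_even_mult)
  then have "4 dvd 2 * e * (x * y + a2 * b)" by (rule dvd_trans[rotated]) simp
  then have "4 dvd y - b" "4 dvd x - a2" using xy by (simp_all add: dvd_add_left_iff)
  then obtain \<tau> \<sigma> where st: "y = b + 4 * \<tau>" "x = a2 + 4 * \<sigma>" using dvd_diff_ex(1) by metis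
  have "2 dvd l * d - n" by (rule dvd_trans[OF _ nd]) simp
  then obtain r where r: "l * d = n + 2 * r" using dvd_diff_ex(1) by blast
  \<comment> \<open>\<open>K\<close> cancels, and \<open>l * d\<close> has the parity of
    \<open>n\<close>; the only term not divisible by \<open>16 * e\<close> is
    \<open>4 * e * (a2 - b) * n\<close>.\<close>
  have "l * (b2 + 2 * e * a2) * d - n * (b2 - 2 * e * a2) - K - (l * (a + 2 * e * b) * d - n * (a - 2 * e * b) - K) -
      4 * e * ((a2 - b) * n) = 16 * e * (r * (\<tau> - \<sigma>))"
    unfolding x y st using r by Groebner_Basis.algebra
  then have "16 * e dvd l * (b2 + 2 * e * a2) * d - n * (b2 - 2 * e * a2) - K - (l * (a + 2 * e * b) * d - n * (a - 2 * e * b) - K) -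
      4 * e * ((a2 - b) * n)" by simp
  from dvd_transfer[OF this dvd_diff[OF Y X]] have "4 * e * 4 dvd 4 * e * ((a2 - b) * n)" by simp
  then have "2\<^sup>2 dvd (a2 - b) * n" using e0 dvd_mult_cancel_left[of "4 * e" 4] by simp
  then have "2\<^sup>2 dvd a2 - b" by (rule two_power_dvd_mult_odd[OF odd(3)])
  then obtain \<rho> where \<rho>: "a2 = b + 4 * \<rho>" using dvd_diff_ex(1)[of 4 a2 b] by auto
  obtain d' where d': "d = a * b2 - 2 * e * a2 * (2 * e * b) + 8 * e * d'" using dvd_diff_ex(2)[OF d] by blast
  have "8 * e dvd l * (a + 2 * e * b) * d - n * (a - 2 * e * b) - K" by (rule dvd_trans[OF _ X]) simp
  then have "8 * e dvd l * (a + 2 * e * b) * d - n * (a - 2 * e * b)" using K by (simp add: dvd_diff_left_iff)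
  \<comment> \<open>Modulo \<open>8 * e\<close>, both \<open>a + 2 * e * b\<close> and
    \<open>d\<close> are now \<open>1 + 4 * e * b\<close>, whose square is 1, and
    \<open>a - 2 * e * b\<close> is 1.\<close>
  then show ?thesis
  proof (rule dvd_transfer[rotated])
    show "8 * e dvd l * (a + 2 * e * b) * d - n * (a - 2 * e * b) - (l - n)"
      unfolding d' x y st unfolding \<rho> by Groebner_Basis.algebra
  qed
qed

context macdonald_trunc
begin

lemma nf_swap: "macdonald.nf G B A a c b = B [^] a \<otimes> C [^] (- c) \<otimes> A [^] b"
  unfolding macdonald.nf_def[OF swap] C_swap by (simp add: int_pow_inv int_pow_neg)

lemma inv_nf: "inv (nf a c b) = B [^] (- b) \<otimes> C [^] (- c) \<otimes> A [^] (- a)"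
  by (simp add: nf_def inv_mult_group int_pow_neg m_assoc)

lemma trunc_swap: "macdonald_trunc m l G B A"
proof -
  interpret S: macdonald m l G B A by (rule swap)
  show ?thesis
  proof
    show "3 \<le> m" by (rule m3)
    show "B [^] (128 * e\<^sup>2) = \<one>" by (rule B_128)
    fix a c b a' c' b'
    assume "S.nf a c b = S.nf a' c' b'"
    \<comment> \<open>Inversion restores the order \<open>A\<close>, \<open>C\<close>,
      \<open>B\<close>, so a swapped normal form becomes an ordinary one with negated outer
      exponents.\<close>
    then have "inv (S.nf a c b) = inv (S.nf a' c' b')" by simp
    moreover have "inv (S.nf a c b) = nf (- b) c (- a)" for a c b
      by (simp add: nf_swap nf_def inv_mult_group int_pow_neg m_assoc)
    ultimately have "nf (- b) c (- a) = nf (- b') c' (- a')" by simp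
    note eq = nf_eq_trunc[OF this, unfolded cong_iff_dvd_diff]
    obtain i where i: "- a - - a' = 32 * e\<^sup>2 * i" using eq by blast
    obtain j where j: "- b - - a - (- b' - - a') = 128 * e\<^sup>2 * j" using eq by blast
    have "b - b' = 32 * e\<^sup>2 * (- i - 4 * j)" "a - b - (a' - b') = 128 * e\<^sup>2 * j"
      using i j by Groebner_Basis.algebra+
    then show "[b = b'] (mod 32 * e\<^sup>2) \<and> [c = c'] (mod 32 * e\<^sup>2) \<and> [a - b = a' - b'] (mod 128 * e\<^sup>2)"
      using eq unfolding cong_iff_dvd_diff by (metis dvd_triv_left)
  qed
qed

lemma dvd_odd_cancel:
  assumes "odd x" shows "4 * e dvd y * x \<Longrightarrow> 4 * e dvd y" "2 * e dvd y * x \<Longrightarrow> 2 * e dvd y"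
proof -
  have pow: "4 * e = 2 ^ (m - 3 + 2)" "2 * e = 2 ^ (m - 3 + 1)" by (simp_all add: e_def power_add)
  show "4 * e dvd y * x \<Longrightarrow> 4 * e dvd y" "2 * e dvd y * x \<Longrightarrow> 2 * e dvd y"
    unfolding pow using two_power_dvd_mult_odd[OF assms] by blast+
qed

text \<open>Since \<open>a\<close> is odd, the first congruence of \<open>conj_rough\<close> gives
  \<open>l * d\<close> congruent to \<open>n\<close> modulo \<open>4 * e\<close>. Inserted into the
  second it leaves \<open>4 * e dvd 2 * b * n\<close>, so \<open>b\<close> is divisible by
  \<open>2 * e\<close>; parity of the commutator exponent then makes \<open>b2\<close> odd.\<close>

lemma odd_exponents:
  fixes b2 c2 a2 :: int
  assumes R: "(B [^] b2 \<otimes> C [^] (- c2) \<otimes> A [^] a2) \<otimes> nf a c b \<otimes> nf (8 * e * p) d (8 * e * q) =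
      nf a c b \<otimes> (B [^] b2 \<otimes> C [^] (- c2) \<otimes> A [^] a2)"
    and conj: "nf a c b \<otimes> nf (8 * e * p) d (8 * e * q) = nf (8 * e * p) d (8 * e * q) \<otimes> nf a c b [^] (1 + 8 * e * int n)"
    and odd: "odd a" "odd n"
  shows "\<exists>b'. b = 2 * e * b'" "odd d" "odd b2" "4 * e dvd l * d - int n"
proof -
  note D = conj_rough[OF conj]
  show nd: "4 * e dvd l * d - int n" by (rule dvd_odd_cancel(1)[OF odd(1)]) (rule D(1)[unfolded mult.commute[of a]])
  have "2 dvd l * d - int n" by (rule dvd_trans[OF _ nd]) simp
  then show d: "odd d" using l odd by auto
  have "4 * e dvd b * (l * d + int n) - b * (l * d - int n)" by (intro dvd_diff D(2) dvd_mult nd)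
  moreover have "b * (l * d + int n) - b * (l * d - int n) = 2 * (b * int n)" by Groebner_Basis.algebra
  ultimately have "2 * (2 * e) dvd 2 * (b * int n)" by simp
  then have "2 * e dvd b * int n" using dvd_mult_cancel_left[of 2 "2 * e"] by simp
  then have "2 * e dvd b" using dvd_odd_cancel(2)[of "int n" b] odd(2) by simp
  then show "\<exists>b'. b = 2 * e * b'" by (auto simp: dvd_def)
  then have b: "even b" by auto
  have "2 dvd a * b2 - a2 * b - d"
    by (rule dvd_trans[OF _ commutator_exponents(1)[OF R]]) simp
  then show "odd b2" using b d by auto
qed

text \<open>In the interchanged group, \<open>Y\<close>, \<open>X\<close> and the inverse of
  \<open>W\<close> take the places of \<open>X\<close>, \<open>Y\<close> and \<open>W\<close>. Every
  congruence is thus obtained twice, as \<open>parameter_congruence\<close> requires.\<close>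

lemma parameter_of_odd_exponent:
  fixes b2 c2 a2 :: int
  assumes X: "x = nf a c b" and Y: "y = B [^] b2 \<otimes> C [^] (- c2) \<otimes> A [^] a2"
    and W: "w = nf (8 * e * p) d (8 * e * q)"
    and R: "y \<otimes> x \<otimes> w = x \<otimes> y" "x \<otimes> w = w \<otimes> x [^] (1 + 8 * e * int n)"
      "w \<otimes> y = y [^] (1 + 8 * e * int n) \<otimes> w"
    and odd: "odd a" "odd n"
  shows "8 * e dvd l - int n"
proof -
  interpret S: macdonald_trunc m l G B A by (rule trunc_swap)
  have closed: "x \<in> carrier G" "y \<in> carrier G" "w \<in> carrier G" by (simp_all add: X Y W)
  have sX: "x = A [^] a \<otimes> S.C [^] (- c) \<otimes> B [^] b"
    unfolding X nf_def C_swap by (simp add: int_pow_inv int_pow_neg)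
  have sY: "y = S.nf b2 c2 a2" unfolding Y nf_swap ..
  have sW: "inv w = S.nf (8 * e * (- q)) d (8 * e * (- p))"
    unfolding W nf_swap inv_nf by simp
  have R1: "(A [^] a \<otimes> S.C [^] (- c) \<otimes> B [^] b) \<otimes> S.nf b2 c2 a2 \<otimes> S.nf (8 * e * (- q)) d (8 * e * (- p)) =
      S.nf b2 c2 a2 \<otimes> (A [^] a \<otimes> S.C [^] (- c) \<otimes> B [^] b)"
    unfolding sX[symmetric] sY[symmetric] sW[symmetric] R(1)[symmetric] using closed by (simp add: m_assoc)
  have "y \<otimes> inv w = inv w \<otimes> y [^] (1 + 8 * e * int n)"
    using mult_inv_swap[OF closed(3,2) int_pow_closed[OF closed(2)] R(3)] by simp
  note R2 = this[unfolded sY sW]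
  note R1' = R(1)[unfolded X Y W] and R2' = R(2)[unfolded X W]
  note o = odd_exponents[OF R1' R2' odd]
  note so = S.odd_exponents[OF R1 R2 o(3) odd(2)]
  obtain b' where b: "b = 2 * e * b'" using o(1) by blast
  obtain a2' where a2: "a2 = 2 * e * a2'" using so(1) by blast
  note f = conj_fine[OF R2'[unfolded b] odd(1) o(2) odd(2)]
  note sf = S.conj_fine[OF R2[unfolded a2] o(3) o(2) odd(2)]
  note x = commutator_exponents[OF R1'[unfolded b a2]]
  note sx = S.commutator_exponents[OF R1[unfolded b a2]]
  note ab = commutator_congruence[OF e_def odd(1) o(3) l o(4) x f(1)]
    commutator_congruence[OF e_def o(3) odd(1) l o(4) sx sf(1)]
  show ?thesis
  proof (rule parameter_congruence[OF e_def odd(1) o(3) _ l o(4) x(1) ab f(2)])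
    show "odd (int n)" using odd by simp
    show "16 * e dvd l * (b2 + 2 * e * a2') * d - int n * (b2 - 2 * e * a2') - 8 * e * (t2 (d + 1) + 1 + p * q)"
      using sf(2) by (simp add: mult.commute)
  qed simp
qed


section \<open>Parity of exponents and the choice of an odd generator\<close>

lemma nf_eq_parity: "nf a c b = nf a' c' b' \<Longrightarrow> [a = a'] (mod 8 * e) \<and> [b = b'] (mod 8 * e)"
proof -
  assume "nf a c b = nf a' c' b'"
  note eq = nf_eq_trunc[OF this, unfolded cong_iff_dvd_diff]
  have b: "8 * e dvd b - b'" by (rule dvd_trans[of _ "32 * e\<^sup>2"]) (use eq in \<open>auto simp: power2_eq_square\<close>)
  have "8 * e dvd a - b - (a' - b')" by (rule dvd_trans[of _ "128 * e\<^sup>2"]) (use eq in \<open>auto simp: power2_eq_square\<close>)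
  then have "8 * e dvd a - b - (a' - b') + (b - b')" using b by (rule dvd_add)
  then show ?thesis using b by (simp add: cong_iff_dvd_diff algebra_simps)
qed

lemma nf_mult_eq_parity:
  assumes "nf a c b \<otimes> nf a' c' b' = nf x y z"
  shows "[x = a + a'] (mod 8 * e)" "[z = b + b'] (mod 8 * e)"
proof -
  obtain x' y' z' where "nf a c b \<otimes> nf a' c' b' = nf x' y' z'" "[x' = a + a'] (mod 2 * h)" "[z' = b + b'] (mod 2 * h)"
    using nf_mult_mod by blast
  then show "[x = a + a'] (mod 8 * e)" "[z = b + b'] (mod 8 * e)"
    using nf_eq_parity[of x y z x' y' z'] assms cong_trans by (force simp: h)+
qed

lemma parity_of_swapped:
  fixes a c b :: int
  assumes "B [^] b \<otimes> C [^] c \<otimes> A [^] a = nf x y z"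
  shows "[x = a] (mod 8 * e)" "[z = b] (mod 8 * e)"
proof -
  have "B [^] b \<otimes> C [^] c = nf 0 c (b * ap (- c))" using nf_C[of 0 0 b c] by (simp add: nf_def)
  then have "nf 0 c (b * ap (- c)) \<otimes> nf a 0 0 = nf x y z" using assms by (simp add: nf_def)
  note p = nf_mult_eq_parity[OF this]
  have "[b * ap (- c) = b * 1] (mod 8 * e)" using cong_scalar_left[OF ap_mod[of "- c"], of b] by (simp add: h)
  then show "[x = a] (mod 8 * e)" "[z = b] (mod 8 * e)" using p cong_trans by auto
qed

lemma even_iff_of_cong: "[x = x'] (mod 8 * e) \<Longrightarrow> even x \<longleftrightarrow> even x'"
  by (drule cong_dvd_modulus[of _ _ _ 2]) (simp, simp add: cong_def even_iff_mod_2_eq_zero)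

text \<open>Parities of the outer exponents are well defined and additive, so the elements with both
  even form a subgroup, and \<open>A\<close> is not in it.\<close>

lemma even_exponents_not_generate:
  assumes "carrier G = generate G {nf a c b, nf a' c' b'}" "even a" "even b" "even a'" "even b'"
  shows False
proof -
  define H where "H = {g. \<exists>x y z. g = nf x y z \<and> even x \<and> even z}"
  have "subgroup H G"
  proof
    show "H \<subseteq> carrier G" by (auto simp: H_def)
    show "\<one> \<in> H" unfolding H_def by (auto intro!: exI[of _ 0] simp del: nf_0 simp: nf_0[symmetric])
    fix g assume g: "g \<in> H"
    then obtain x y z where x: "g = nf x y z" "even x" "even z" by (auto simp: H_def)
    obtain x' y' z' where x': "inv g = nf x' y' z'" using nf_surj[of "inv g"] x(1) by auto
    have "nf x y z \<otimes> nf x' y' z' = nf 0 0 0" using x x' r_inv[of g] by simp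
    from nf_mult_eq_parity[OF this, THEN even_iff_of_cong] show "inv g \<in> H" using x x' by (auto simp: H_def)
    fix g' assume "g' \<in> H"
    then obtain x' y' z' where x': "g' = nf x' y' z'" "even x'" "even z'" by (auto simp: H_def)
    obtain x'' y'' z'' where x'': "g \<otimes> g' = nf x'' y'' z''" using nf_surj[of "g \<otimes> g'"] x(1) x'(1) by auto
    from nf_mult_eq_parity[OF x''[unfolded x(1) x'(1)], THEN even_iff_of_cong] show "g \<otimes> g' \<in> H"
      using x x' x'' by (auto simp: H_def)
  qed
  moreover have "{nf a c b, nf a' c' b'} \<subseteq> H" using assms by (auto simp: H_def)
  ultimately have "A \<in> H" using generate_subgroup_incl assms(1) A_closed by blast
  then obtain x y z where "nf 1 0 0 = nf x y z" "even x" by (auto simp: H_def nf_def)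
  then show False using nf_eq_parity[of 1 0 0 x y z] even_iff_of_cong[of 1 x] by simp
qed

lemma macdonald_pair_exponents:
  assumes pair: "macdonald_pair G m (1 + 8 * e * int n) (nf a c b) y"
  obtains w p d q b2 c2 a2 where "y = B [^] (b2::int) \<otimes> C [^] (- c2 :: int) \<otimes> A [^] (a2::int)" "w = nf (8 * e * p) d (8 * e * q)"
    "y \<otimes> nf a c b \<otimes> w = nf a c b \<otimes> y" "nf a c b \<otimes> w = w \<otimes> nf a c b [^] (1 + 8 * e * int n)"
    "w \<otimes> y = y [^] (1 + 8 * e * int n) \<otimes> w"
proof -
  have y: "y \<in> carrier G" using pair by (simp add: macdonald_pair_def)
  then obtain a' c' b' where Y': "y = nf a' c' b'" using nf_surj by blast
  let ?x = "nf a c b" and ?y = "nf a' c' b'"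
  let ?w = "grp_comm G ?x ?y"
  have w: "?w \<in> carrier G" by simp
  obtain x d z where W: "?w = nf x d z" using nf_surj[OF w] by blast
  obtain x1 y1 z1 where 1: "?y \<otimes> ?x = nf x1 y1 z1" using nf_surj[of "?y \<otimes> ?x"] by auto
  obtain x2 y2 z2 where 2: "?x \<otimes> ?y = nf x2 y2 z2" using nf_surj[of "?x \<otimes> ?y"] by auto
  have R: "?y \<otimes> ?x \<otimes> ?w = ?x \<otimes> ?y" by (rule mult_comm_eq) simp_all
  \<comment> \<open>The outer exponents are additive modulo \<open>8 * e\<close>, so those of a
    commutator vanish there.\<close>
  have "8 * e dvd x" "8 * e dvd z"
  proof -
    note e1 = nf_mult_eq_parity[OF 1] and e2 = nf_mult_eq_parity[OF 2]
      and e3 = nf_mult_eq_parity[OF R[unfolded 1 2 W]]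
    have "[x1 + x = x1 + 0] (mod 8 * e)"
      using cong_trans[OF cong_sym[OF e3(1)] cong_trans[OF e2(1)]] e1(1) by (simp add: add.commute cong_sym)
    then show "8 * e dvd x" unfolding cong_add_lcancel by (simp add: cong_0_iff)
    have "[z1 + z = z1 + 0] (mod 8 * e)"
      using cong_trans[OF cong_sym[OF e3(2)] cong_trans[OF e2(2)]] e1(2) by (simp add: add.commute cong_sym)
    then show "8 * e dvd z" unfolding cong_add_lcancel by (simp add: cong_0_iff)
  qed
  then obtain p q where pq: "x = 8 * e * p" "z = 8 * e * q" by (auto simp: dvd_def)
  interpret S: macdonald m l G B A by (rule swap)
  obtain b2 c2 a2 where Y: "?y = S.nf b2 c2 a2" using S.nf_surj[of ?y] by auto
  have inv_w: "grp_comm G ?y ?x = inv ?w" by (rule comm_swap) simp_all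
  have R2: "?x \<otimes> ?w = ?w \<otimes> ?x [^] (1 + 8 * e * int n)" and "?y \<otimes> inv ?w = inv ?w \<otimes> ?y [^] (1 + 8 * e * int n)"
    using pair unfolding macdonald_pair_def Y' inv_w by (simp_all add: grp_conj_eq_iff)
  then have R3: "?w \<otimes> ?y = ?y [^] (1 + 8 * e * int n) \<otimes> ?w"
    using mult_inv_swap[of "inv ?w" "?y [^] (1 + 8 * e * int n)" ?y] w by simp
  show ?thesis
    by (rule that[OF Y[unfolded nf_swap, folded Y'] W[unfolded pq], folded Y']) (fact R[folded Y'] R2[folded Y'] R3[folded Y'])+
qed

lemma parameter_of_odd_generator:
  assumes "macdonald_pair G m (1 + 8 * e * int n) (nf a c b) y" "odd a" "odd n"
  shows "8 * e dvd l - int n"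
proof -
  obtain w p d q b2 c2 a2 where "y = B [^] (b2::int) \<otimes> C [^] (- c2 :: int) \<otimes> A [^] (a2::int)" "w = nf (8 * e * p) d (8 * e * q)"
    "y \<otimes> nf a c b \<otimes> w = nf a c b \<otimes> y" "nf a c b \<otimes> w = w \<otimes> nf a c b [^] (1 + 8 * e * int n)"
    "w \<otimes> y = y [^] (1 + 8 * e * int n) \<otimes> w"
    using macdonald_pair_exponents[OF assms(1)] .
  then show ?thesis using parameter_of_odd_exponent[OF refl _ _ _ _ _ assms(2,3)] by blast
qed

text \<open>Even exponents of \<open>X\<close> make \<open>d\<close> even, so
  \<open>l * d - n\<close> and \<open>l * d + n\<close> are odd. \<open>conj_rough\<close> for
  \<open>Y\<close> in the interchanged group then forces its exponents to be even.\<close>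

lemma even_generator:
  assumes pair: "macdonald_pair G m (1 + 8 * e * int n) (nf a c b) y" and even: "even a" "even b" "odd n"
  shows "\<exists>a' c' b'. y = nf a' c' b' \<and> even a' \<and> even b'"
proof -
  interpret S: macdonald_trunc m l G B A by (rule trunc_swap)
  obtain w p d q b2 c2 a2 where y: "y = B [^] (b2::int) \<otimes> C [^] (- c2 :: int) \<otimes> A [^] (a2::int)" and w: "w = nf (8 * e * p) d (8 * e * q)"
    and R: "y \<otimes> nf a c b \<otimes> w = nf a c b \<otimes> y" "w \<otimes> y = y [^] (1 + 8 * e * int n) \<otimes> w"
    using macdonald_pair_exponents[OF pair] by metis
  have closed: "y \<in> carrier G" "w \<in> carrier G" by (simp_all add: y w)
  have "2 dvd a * b2 - a2 * b - d"
    by (rule dvd_trans[OF _ commutator_exponents(1)[OF R(1)[unfolded y w]]]) simp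
  then have d: "even d" using even by simp
  have "y \<otimes> inv w = inv w \<otimes> y [^] (1 + 8 * e * int n)"
    using mult_inv_swap[OF closed(2,1) int_pow_closed[OF closed(1)] R(2)] by simp
  moreover have sY: "y = S.nf b2 c2 a2" unfolding y nf_swap ..
  moreover have "inv w = S.nf (8 * e * (- q)) d (8 * e * (- p))" unfolding w nf_swap inv_nf by simp
  ultimately have "S.nf b2 c2 a2 \<otimes> S.nf (8 * e * (- q)) d (8 * e * (- p)) =
      S.nf (8 * e * (- q)) d (8 * e * (- p)) \<otimes> S.nf b2 c2 a2 [^] (1 + 8 * e * int n)" by simp
  note D = S.conj_rough[OF this]
  have "2 dvd b2 * (l * d - int n)" "2 dvd a2 * (l * d + int n)"
    by (rule dvd_trans[OF _ D(1)] dvd_trans[OF _ D(2)]; simp)+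
  then have ev: "even b2" "even a2" using d even(3) by auto
  obtain a' c' b' where Y: "y = nf a' c' b'" using nf_surj[OF closed(1)] by blast
  have "even a'" "even b'"
    using parity_of_swapped[of b2 "- c2" a2 a' c' b', THEN even_iff_of_cong] Y y ev by auto
  then show ?thesis using Y by blast
qed

text \<open>It suffices that \<open>X\<close> has one odd outer exponent: if it is that of
  \<open>B\<close>, the argument runs in the interchanged group. If both are even, so are those of
  \<open>Y\<close>, and the pair cannot generate.\<close>

lemma parameter_of_generating_pair:
  assumes pair: "macdonald_pair G m (1 + 8 * e * int n) x y" and gen: "carrier G = generate G {x, y}" and n: "odd n"
  shows "8 * e dvd l - int n"
proof -
  interpret S: macdonald_trunc m l G B A by (rule trunc_swap)
  have xy: "x \<in> carrier G" "y \<in> carrier G" using pair by (auto simp: macdonald_pair_def)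
  obtain a c b where X: "x = nf a c b" using nf_surj[OF xy(1)] by blast
  obtain b1 c1 a1 where X1: "x = S.nf b1 c1 a1" using S.nf_surj[OF xy(1)] by blast
  have px: "even a \<longleftrightarrow> even a1" "even b \<longleftrightarrow> even b1"
    using parity_of_swapped[of b1 "- c1" a1 a c b, THEN even_iff_of_cong] X X1 by (simp_all add: nf_swap)
  consider "odd a" | "odd b1" | "even a" "even b" using px by blast
  then show ?thesis
  proof cases
    case 1
    then show ?thesis using parameter_of_odd_generator[OF pair[unfolded X]] n by blast
  next
    case 2
    then show ?thesis using S.parameter_of_odd_generator[OF pair[unfolded X1]] n by blast
  next
    case 3
    then obtain a' c' b' where "y = nf a' c' b'" "even a'" "even b'"
      using even_generator[OF pair[unfolded X] _ _ n] by blast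
    then show ?thesis using even_exponents_not_generate[of a c b a' c' b'] gen 3 by (simp add: X)
  qed
qed

end

section \<open>The truncated quotient of \<open>J2\<close> and the converse direction of the
  classification\<close>

context macdonald_faithful
begin

definition trunc_kernel where "trunc_kernel = range (\<lambda>k::int. A [^] (128 * e\<^sup>2 * k))"

context
  assumes m3: "3 \<le> m"
begin

lemma h_eq: "h = 4 * e"
proof -
  have "m - 1 = Suc (Suc (m - 3))" using m3 by simp
  then show ?thesis unfolding h_def e_def by simp
qed

lemma trunc_kernel_normal: "trunc_kernel \<lhd> G"
proof -
  have central: "g \<otimes> x = x \<otimes> g" if g: "g \<in> trunc_kernel" and x: "x \<in> carrier G" for g x
  proof -
    obtain k where "g = A [^] (128 * e\<^sup>2 * k)" using g by (auto simp: trunc_kernel_def)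
    moreover have "128 * e\<^sup>2 * k = 2 * h\<^sup>2 * (4 * k)" by (simp add: h_eq power2_eq_square)
    ultimately show ?thesis using A_2h2_central[OF x, of "4 * k"] by simp
  qed
  have "subgroup trunc_kernel G"
  proof
    show sub: "trunc_kernel \<subseteq> carrier G" by (auto simp: trunc_kernel_def)
    show "\<one> \<in> trunc_kernel" unfolding trunc_kernel_def by (rule image_eqI[of _ _ 0]) simp_all
    fix g g' assume "g \<in> trunc_kernel" "g' \<in> trunc_kernel"
    then obtain k k' where k: "g = A [^] (128 * e\<^sup>2 * k)" "g' = A [^] (128 * e\<^sup>2 * k')" by (auto simp: trunc_kernel_def)
    show "g \<otimes> g' \<in> trunc_kernel" unfolding trunc_kernel_def k
      by (rule image_eqI[of _ _ "k + k'"]) (simp_all add: distrib_left int_pow_mult)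
    show "inv g \<in> trunc_kernel" unfolding trunc_kernel_def k
      by (rule image_eqI[of _ _ "- k"]) (simp_all add: int_pow_neg)
  qed
  moreover have "x \<otimes> g \<otimes> inv x \<in> trunc_kernel" if g: "g \<in> trunc_kernel" and x: "x \<in> carrier G" for g x
  proof -
    have g': "g \<in> carrier G" using g by (auto simp: trunc_kernel_def)
    have "x \<otimes> g \<otimes> inv x = g \<otimes> x \<otimes> inv x" by (simp only: central[OF g x])
    also have "\<dots> = g" using x g' by (simp add: m_assoc)
    finally show ?thesis using g by simp
  qed
  ultimately show ?thesis unfolding normal_inv_iff by blast
qed

lemma quotient_trunc: "macdonald_trunc m l (G Mod trunc_kernel) (trunc_kernel #> A) (trunc_kernel #> B)"
proof -
  interpret N: normal trunc_kernel G by (rule trunc_kernel_normal)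
  let ?Q = "G Mod trunc_kernel" and ?q = "\<lambda>x. trunc_kernel #> x"
  interpret Q: group ?Q by (rule N.factorgroup_is_group)
  interpret q: group_hom G ?Q ?q using N.r_coset_hom_Mod by unfold_locales
  have "carrier ?Q = ?q ` generate G {A, B}" unfolding gen[symmetric] by (auto simp: carrier_FactGroup)
  also have "\<dots> = generate ?Q {?q A, ?q B}" using q.generate_img[of "{A, B}"] by simp
  finally have gen': "carrier ?Q = generate ?Q {?q A, ?q B}" .
  interpret M: macdonald m l ?Q "?q A" "?q B"
    using q.macdonald_pair_hom[OF pair] gen' by unfold_locales
  have C: "M.C = ?q C" unfolding C_def M.C_def by (rule q.hom_grp_comm[symmetric]) simp_all
  have nf: "M.nf a c b = ?q (nf a c b)" for a c b
    by (simp add: nf_def M.nf_def C q.hom_int_pow)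
  show ?thesis
  proof
    show "3 \<le> m" by (rule m3)
    have "A [^] (128 * e\<^sup>2) \<in> trunc_kernel" unfolding trunc_kernel_def by (rule image_eqI[of _ _ 1]) simp_all
    then have "?q (A [^] (128 * e\<^sup>2)) = \<one>\<^bsub>?Q\<^esub>" using N.rcos_const by (simp add: one_FactGroup)
    then show "?q A [^]\<^bsub>?Q\<^esub> (128 * e\<^sup>2) = \<one>\<^bsub>?Q\<^esub>" by (simp add: q.hom_int_pow)
    fix a c b a' c' b'
    assume "M.nf a c b = M.nf a' c' b'"
    then have "nf a c b \<otimes> inv (nf a' c' b') \<in> trunc_kernel"
      unfolding nf using r_coset_eq_iff[OF trunc_kernel_normal nf_closed nf_closed] by simp
    then obtain k where "nf a c b \<otimes> inv (nf a' c' b') = A [^] (128 * e\<^sup>2 * k)" by (auto simp: trunc_kernel_def)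
    then have "nf a c b = A [^] (128 * e\<^sup>2 * k) \<otimes> nf a' c' b'"
      by (metis inv_closed inv_solve_right' nf_closed int_pow_closed A_closed m_closed)
    then have "nf a c b = nf (128 * e\<^sup>2 * k + a') c' b'" by (simp add: A_nf)
    note eq = nf_eqD[OF this]
    note eq = eq[unfolded cong_iff_dvd_diff h_eq]
    obtain r where r: "b = b' + 2 * (4 * e)\<^sup>2 * r" using dvd_diff_ex(1)[OF eq(1)] by blast
    obtain s where s: "c = c' + 2 * (4 * e)\<^sup>2 * s" using dvd_diff_ex(1)[OF eq(2)] by blast
    obtain t where t: "a - b + 4 * e * c = 128 * e\<^sup>2 * k + a' - b' + 4 * e * c' + 4 * (4 * e) ^ 3 * t"
      using dvd_diff_ex(1)[OF eq(3)] by blast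
    \<comment> \<open>The summand \<open>h * c\<close> drops out: \<open>c - c'\<close> is a
      multiple of \<open>32 * e\<^sup>2\<close>, and its product with \<open>h = 4 * e\<close> is a
      multiple of the new modulus.\<close>
    have "a - b = a' - b' + 128 * e\<^sup>2 * (k + 2 * e * t - e * s)"
      using t s by Groebner_Basis.algebra
    moreover have "b = b' + 32 * e\<^sup>2 * r" "c = c' + 32 * e\<^sup>2 * s" using r s by (simp_all add: power2_eq_square)
    ultimately show "[b = b'] (mod 32 * e\<^sup>2) \<and> [c = c'] (mod 32 * e\<^sup>2) \<and> [a - b = a' - b'] (mod 128 * e\<^sup>2)"
      using congI by blast
  qed
qed

end
end

lemma J2_iso_imp_cong:
  assumes m: "2 < m" and l: "odd l" "odd l'" and iso: "J2 (1 + 2 ^ m * l) \<cong> J2 (1 + 2 ^ m * l')"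
  shows "[l = l'] (mod 2 ^ m)"
proof -
  let ?J = "J2 (1 + 2 ^ m * l)"
  interpret p: macdonald_param m l using m l by unfold_locales simp_all
  interpret G: macdonald_faithful m l ?J "J2_x (1 + 2 ^ m * l)" "J2_y (1 + 2 ^ m * l)" by (rule p.J2_macdonald)
  have m3: "3 \<le> m" "2 \<le> m" using m by simp_all
  interpret Q: macdonald_trunc m l "?J Mod G.trunc_kernel" "G.trunc_kernel #>\<^bsub>?J\<^esub> J2_x (1 + 2 ^ m * l)"
    "G.trunc_kernel #>\<^bsub>?J\<^esub> J2_y (1 + 2 ^ m * l)"
    by (rule G.quotient_trunc[OF m3(1)])
  \<comment> \<open>The power formulas are for natural multiples of \<open>2 ^ m\<close>. Replacing
    \<open>l'\<close> by its residue is allowed by the isomorphisms already established.\<close>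
  define n where "n = nat (l' mod 2 ^ m)"
  have n: "int n = l' mod 2 ^ m" by (simp add: n_def)
  have cong: "[l' = int n] (mod 2 ^ m)" by (simp add: n cong_def)
  have odd: "odd n"
  proof -
    have "even (l' mod 2 ^ m) \<longleftrightarrow> even l'" using m by (intro dvd_mod_iff) simp
    then show ?thesis using l(2) n by (metis even_of_nat)
  qed
  let ?n = "1 + 2 ^ m * int n"
  have "?J \<cong> J2 ?n"
    using iso J2_iso_of_cong[OF m3(2) l(2) _ cong] odd iso_trans by auto
  then have "J2 ?n \<cong> ?J" by (rule group.iso_sym[OF group_J2])
  then obtain f where f: "f \<in> iso (J2 ?n) ?J" by (auto simp: is_iso_def)
  interpret f: group_hom "J2 ?n" ?J f
    using f group_J2 by (simp add: group_hom_def group_hom_axioms_def iso_def)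
  interpret N: normal G.trunc_kernel ?J by (rule G.trunc_kernel_normal[OF m3(1)])
  let ?q = "\<lambda>x. G.trunc_kernel #>\<^bsub>?J\<^esub> x"
  interpret q: group_hom ?J "?J Mod G.trunc_kernel" ?q using N.r_coset_hom_Mod by unfold_locales
  have mult: "multiplicity 2 (?n - 1) = m" using multiplicity_alpha[of "int n" m] odd by simp
  have pair: "macdonald_pair (J2 ?n) m ?n (J2_x ?n) (J2_y ?n)" using J2_pair[of ?n] unfolding mult .
  have closed: "J2_x ?n \<in> carrier (J2 ?n)" "J2_y ?n \<in> carrier (J2 ?n)" using pair by (auto simp: macdonald_pair_def)
  have "macdonald_pair (?J Mod G.trunc_kernel) m ?n (?q (f (J2_x ?n))) (?q (f (J2_y ?n)))"
    by (rule q.macdonald_pair_hom[OF f.macdonald_pair_hom[OF pair]])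
  then have pair': "macdonald_pair (?J Mod G.trunc_kernel) m (1 + 8 * p.e * int n) (?q (f (J2_x ?n))) (?q (f (J2_y ?n)))"
    unfolding Q.two_m .
  have "carrier (?J Mod G.trunc_kernel) = ?q ` f ` carrier (J2 ?n)"
    using f by (auto simp: carrier_FactGroup iso_def bij_betw_def)
  also have "\<dots> = ?q ` generate ?J {f (J2_x ?n), f (J2_y ?n)}"
    unfolding J2_generate[symmetric, of ?n] using f.generate_img[of "{J2_x ?n, J2_y ?n}"] closed by simp
  also have "\<dots> = generate (?J Mod G.trunc_kernel) {?q (f (J2_x ?n)), ?q (f (J2_y ?n))}"
    using q.generate_img[of "{f (J2_x ?n), f (J2_y ?n)}"] closed by simp
  finally have "8 * p.e dvd l - int n"
    by (rule Q.parameter_of_generating_pair[OF pair' _ odd])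
  then have "[l = int n] (mod 2 ^ m)" by (simp add: cong_iff_dvd_diff Q.two_m)
  then show ?thesis using cong cong_sym cong_trans by blast
qed

section \<open>Counting the isomorphism classes and assembling the theorem\<close>

lemma alpha_cong_iff:
  fixes l l' :: int
  shows "[1 + 2 ^ m * l = 1 + 2 ^ m * l'] (mod 2 ^ (2 * m)) \<longleftrightarrow> [l = l'] (mod 2 ^ m)"
proof -
  have "(1 + 2 ^ m * l) - (1 + 2 ^ m * l') = 2 ^ m * (l - l')" by (simp add: algebra_simps)
  moreover have "(2::int) ^ (2 * m) = 2 ^ m * 2 ^ m" by (simp add: mult_2 power_add)
  ultimately show ?thesis unfolding cong_iff_dvd_diff by simp
qed

lemma J2_iso_iff:
  assumes "2 < m" "odd l" "odd l'"
  shows "J2 (1 + 2 ^ m * l) \<cong> J2 (1 + 2 ^ m * l') \<longleftrightarrow> [l = l'] (mod 2 ^ m)"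
  using J2_iso_of_cong[of m l l'] J2_iso_imp_cong[of m l l'] assms by auto

lemma card_odd_residues:
  assumes m: "1 \<le> m"
  shows "card {r::int. odd r \<and> 0 \<le> r \<and> r < 2 ^ m} = totient (2 ^ m)"
proof -
  have "bij_betw int (totatives (2 ^ m)) {r::int. odd r \<and> 0 \<le> r \<and> r < 2 ^ m}"
  proof (rule bij_betw_byWitness[where f' = nat])
    show "int ` totatives (2 ^ m) \<subseteq> {r. odd r \<and> 0 \<le> r \<and> r < 2 ^ m}"
    proof
      fix r assume "r \<in> int ` totatives (2 ^ m)"
      then obtain k where k: "r = int k" "coprime k (2 ^ m)" "k \<le> 2 ^ m" "0 < k" by (auto simp: totatives_def)
      then have "odd k" using m by (simp add: coprime_commute)
      moreover have "even ((2::nat) ^ m)" using m by simp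
      ultimately have "k < 2 ^ m" using k(3) by (metis nat_less_le)
      then have "int k < 2 ^ m" by (metis of_nat_less_iff of_nat_numeral of_nat_power)
      then show "r \<in> {r. odd r \<and> 0 \<le> r \<and> r < 2 ^ m}" using k(1) \<open>odd k\<close> by simp
    qed
    show "nat ` {r. odd r \<and> 0 \<le> r \<and> r < 2 ^ m} \<subseteq> totatives (2 ^ m)"
    proof
      fix k assume "k \<in> nat ` {r. odd r \<and> 0 \<le> r \<and> r < 2 ^ m}"
      then obtain r where r: "k = nat r" "odd r" "0 \<le> r" "r < 2 ^ m" by blast
      then have "odd k" by (simp add: even_nat_iff)
      moreover have "k < 2 ^ m" using r by (simp add: nat_less_iff)
      ultimately show "k \<in> totatives (2 ^ m)" by (auto simp: totatives_def coprime_commute intro: odd_pos)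
    qed
  qed auto
  then show ?thesis unfolding totient_def by (rule bij_betw_same_card[symmetric])
qed

lemma card_iso_classes:
  assumes m: "2 < m"
  defines "S \<equiv> {J2 (1 + 2 ^ m * l) |l::int. odd l}"
  shows "card (S // {(G, H). G \<in> S \<and> H \<in> S \<and> G \<cong> H}) = totient (2 ^ m)"
proof -
  define R where "R = {r::int. odd r \<and> 0 \<le> r \<and> r < 2 ^ m}"
  define E where "E = {(G, H). G \<in> S \<and> H \<in> S \<and> G \<cong> H}"
  have cls: "E `` {J2 (1 + 2 ^ m * l)} = E `` {J2 (1 + 2 ^ m * l')} \<longleftrightarrow> [l = l'] (mod 2 ^ m)"
    if l: "odd l" "odd l'" for l l'
  proof
    assume eq: "E `` {J2 (1 + 2 ^ m * l)} = E `` {J2 (1 + 2 ^ m * l')}"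
    have "J2 (1 + 2 ^ m * l') \<in> E `` {J2 (1 + 2 ^ m * l')}"
      using l(2) iso_refl by (auto simp: E_def S_def)
    then have "J2 (1 + 2 ^ m * l) \<cong> J2 (1 + 2 ^ m * l')" unfolding eq[symmetric] by (simp add: E_def)
    then show "[l = l'] (mod 2 ^ m)" using J2_iso_iff[OF m l] by simp
  next
    assume "[l = l'] (mod 2 ^ m)"
    then have iso: "J2 (1 + 2 ^ m * l) \<cong> J2 (1 + 2 ^ m * l')" using J2_iso_iff[OF m l] by simp
    have "J2 (1 + 2 ^ m * l') \<cong> J2 (1 + 2 ^ m * l)" by (rule group.iso_sym[OF group_J2 iso])
    then have "J2 (1 + 2 ^ m * l) \<cong> H \<longleftrightarrow> J2 (1 + 2 ^ m * l') \<cong> H" for H :: "gen word set set monoid"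
      using iso iso_trans by blast
    moreover have "J2 (1 + 2 ^ m * l) \<in> S" "J2 (1 + 2 ^ m * l') \<in> S" using l by (auto simp: S_def)
    ultimately show "E `` {J2 (1 + 2 ^ m * l)} = E `` {J2 (1 + 2 ^ m * l')}" by (auto simp: E_def)
  qed
  have "bij_betw (\<lambda>r. E `` {J2 (1 + 2 ^ m * r)}) R (S // E)"
  proof (rule bij_betwI')
    fix r r' assume r: "r \<in> R" "r' \<in> R"
    then have "[r = r'] (mod 2 ^ m) \<longleftrightarrow> r = r'" by (auto simp: R_def cong_def)
    then show "E `` {J2 (1 + 2 ^ m * r)} = E `` {J2 (1 + 2 ^ m * r')} \<longleftrightarrow> r = r'"
      using cls[of r r'] r by (simp add: R_def)
  next
    fix r assume "r \<in> R"
    then show "E `` {J2 (1 + 2 ^ m * r)} \<in> S // E" by (auto simp: R_def S_def intro: quotientI)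
  next
    fix c assume "c \<in> S // E"
    then obtain l where l: "odd l" "c = E `` {J2 (1 + 2 ^ m * l)}" by (auto simp: quotient_def S_def)
    have "even (l mod 2 ^ m) \<longleftrightarrow> even l" using m by (intro dvd_mod_iff) simp
    then have o: "odd (l mod 2 ^ m)" using l by simp
    then have "l mod 2 ^ m \<in> R" by (simp add: R_def)
    moreover have "c = E `` {J2 (1 + 2 ^ m * (l mod 2 ^ m))}"
      unfolding l(2) using cls[OF l(1) o] by simp
    ultimately show "\<exists>r\<in>R. c = E `` {J2 (1 + 2 ^ m * r)}" by blast
  qed
  then have "card (S // E) = card R" by (rule bij_betw_same_card[symmetric])
  then show ?thesis using card_odd_residues[of m] m by (simp add: R_def E_def)
qed

lemma J2_iso_m2:
  assumes "odd (l::int)" shows "J2 (1 + 4 * l) \<cong> J2 5"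
proof -
  have J: "J2 (1 + 2 ^ 2 * l) \<cong> J2 (1 + 2 ^ 2 * k)" if "odd k" "[l = k] (mod 4)" for k
    using J2_iso_of_cong[of 2 l k] assms that by simp
  have "l mod 4 = 1 \<or> l mod 4 = 3" using assms by presburger
  then show ?thesis
  proof
    assume "l mod 4 = 1"
    then show ?thesis using J[of 1] by (simp add: cong_def)
  next
    assume "l mod 4 = 3"
    then have "J2 (1 + 4 * l) \<cong> J2 13" using J[of 3] by (simp add: cong_def)
    then show ?thesis using group.iso_sym[OF group_J2 J2_5_iso_J2_13] iso_trans by blast
  qed
qed

theorem theoremB:
  fixes m :: nat
  assumes "m \<ge> 1"
  shows
    "(m = 1 \<longrightarrow> (\<forall>l::int. odd l \<longrightarrow> J2 (1 + 2 * l) \<cong> J2 3)) \<and>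
     (m = 2 \<longrightarrow> (\<forall>l::int. odd l \<longrightarrow> J2 (1 + 4 * l) \<cong> J2 5)) \<and>
     (m > 2 \<longrightarrow>
        (\<forall>l l'::int. odd l \<longrightarrow> odd l' \<longrightarrow>
          (J2 (1 + 2 ^ m * l) \<cong> J2 (1 + 2 ^ m * l') \<longleftrightarrow>
           [1 + 2 ^ m * l = 1 + 2 ^ m * l'] (mod 2 ^ (2 * m)))) \<and>
        card ({J2 (1 + 2 ^ m * l) |l::int. odd l} //
          {(G, H). G \<in> {J2 (1 + 2 ^ m * l) |l::int. odd l} \<and>
                   H \<in> {J2 (1 + 2 ^ m * l) |l::int. odd l} \<and> G \<cong> H}) = totient (2 ^ m)) \<and>
     (\<forall>l l'::int. odd l \<longrightarrow> odd l' \<longrightarrow>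
        derived_subgroup (J2 (1 + 2 ^ m * l)) \<cong> derived_subgroup (J2 (1 + 2 ^ m * l')) \<and>
        (\<forall>i. upper_central_factor (J2 (1 + 2 ^ m * l)) i \<cong>
             upper_central_factor (J2 (1 + 2 ^ m * l')) i)) \<and>
     (\<forall>l::int. odd l \<longrightarrow> K2 (1 + 2 ^ m * l) \<cong> K2 (1 + 2 ^ m))"
proof -
  have J1: "J2 (1 + 2 ^ m * l) \<cong> J2 (1 + 2 ^ m * l')" if "m = 1" "odd l" "odd l'" for l l' :: int
  proof -
    have "J2 (1 + 2 * l) \<cong> J2 (1 + 2 * l')"
      using iso_trans[OF J2_iso_m1[OF that(2)] group.iso_sym[OF group_J2 J2_iso_m1[OF that(3)]]] .
    then show ?thesis using that(1) by simp
  qed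
  have param: "macdonald_param m l" if "m \<noteq> 1" "odd l" for l
    using that assms by unfold_locales auto
  have derived: "derived_subgroup (J2 (1 + 2 ^ m * l)) \<cong> derived_subgroup (J2 (1 + 2 ^ m * l'))"
    if l: "odd l" "odd l'" for l l' :: int
  proof (cases "m = 1")
    case True
    show ?thesis by (rule derived_subgroup_iso[OF J1[OF True l] group_J2 group_J2])
  next
    case False
    show ?thesis
      by (rule derived_iso_param[OF macdonald_param.J2_macdonald[OF param[OF False l(1)]]
        macdonald_param.J2_macdonald[OF param[OF False l(2)]]])
  qed
  have central: "upper_central_factor (J2 (1 + 2 ^ m * l)) i \<cong> upper_central_factor (J2 (1 + 2 ^ m * l')) i"
    if l: "odd l" "odd l'" for l l' :: int and i
  proof (cases "m = 1")
    case True
    show ?thesis by (rule upper_central_factor_iso[OF J1[OF True l] group_J2 group_J2])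
  next
    case False
    then show ?thesis using upper_central_factor_J2_iso[of m l l' i] assms l by simp
  qed
  have K: "K2 (1 + 2 ^ m * l) \<cong> K2 (1 + 2 ^ m)" if l: "odd l" for l :: int
  proof (cases "m = 1")
    case True
    show ?thesis
      using upper_central_quotient_iso[OF J1[OF True l, of 1] group_J2 group_J2, of 2] by (simp add: K2_def)
  next
    case False
    then show ?thesis using K2_iso[of m 1 l] assms l by simp
  qed
  show ?thesis
    unfolding alpha_cong_iff
    by (intro conjI allI impI) (rule J2_iso_m1 J2_iso_m2 J2_iso_iff card_iso_classes derived central K; assumption)+
qed

end
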